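(* Let $G$ be a (simple) cubic graph which has exactly one end, and suppose this end has degree at most $3$. If $G$ has a Hamilton cycle, then $G$ has at least two distinct Hamilton cycles.
   Context: Graphs are simple. A cubic graph is a graph in which every vertex has degree $3$; it may be infinite (it is then locally finite). For a locally finite connected graph $G$, $|G|$ denotes its Freudenthal compactification ($G$ viewed as a 1-complex together with its ends). A circle in $|G|$ is a homeomorphic image of the unit circle in $|G|$; it is a Hamilton circle if it contains all vertices and all ends of $G$. A Hamilton cycle of $G$ is the subgraph formed by the vertices and edges contained in a Hamilton circle of $|G|$ (in a one-ended graph, Hamilton cycles correspond to spanning double rays); $G$ is Hamiltonian if it has one. The degree of an end $\omega$ is the maximum number of pairwise edge-disjoint rays in $G$ belonging to $\omega$. *)

theory Defs
  imports "HOL-Analysis.Analysis"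
begin

record 'a graph =
  verts :: "'a set"
  edges :: "'a set set"

definition simple_graph :: "'a graph \<Rightarrow> bool" where
  "simple_graph G \<longleftrightarrow>
     (\<forall>e\<in>edges G. \<exists>u v. u \<in> verts G \<and> v \<in> verts G \<and> u \<noteq> v \<and> e = {u, v})"

definition vertex_degree :: "'a graph \<Rightarrow> 'a \<Rightarrow> nat" where
  "vertex_degree G v = card {e \<in> edges G. v \<in> e}"

(* Since card of an infinite set is 0, a cubic graph is locally finite. *)
definition cubic :: "'a graph \<Rightarrow> bool" where
  "cubic G \<longleftrightarrow> (\<forall>v\<in>verts G. vertex_degree G v = 3)"

definition adjacent :: "'a graph \<Rightarrow> 'a \<Rightarrow> 'a \<Rightarrow> bool" where
  "adjacent G u v \<longleftrightarrow> {u, v} \<in> edges G"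

definition graph_connected :: "'a graph \<Rightarrow> bool" where
  "graph_connected G \<longleftrightarrow>
     verts G \<noteq> {} \<and> (\<forall>u\<in>verts G. \<forall>v\<in>verts G. (adjacent G)\<^sup>*\<^sup>* u v)"

definition delete_verts :: "'a graph \<Rightarrow> 'a set \<Rightarrow> 'a graph" where
  "delete_verts G S = \<lparr>verts = verts G - S, edges = {e \<in> edges G. e \<inter> S = {}}\<rparr>"

(* Components are represented by their vertex sets. *)
definition graph_components :: "'a graph \<Rightarrow> 'a set set" where
  "graph_components G = (\<lambda>v. {w \<in> verts G. (adjacent G)\<^sup>*\<^sup>* v w}) ` verts G"

(* A ray is given by its sequence of vertices from its first vertex on; this sequence is
   determined by the ray as a subgraph, so distinct sequences are distinct rays. *)
definition ray :: "'a graph \<Rightarrow> (nat \<Rightarrow> 'a) \<Rightarrow> bool" where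
  "ray G r \<longleftrightarrow> inj r \<and> (\<forall>i. r i \<in> verts G \<and> {r i, r (Suc i)} \<in> edges G)"

definition ray_edges :: "(nat \<Rightarrow> 'a) \<Rightarrow> 'a set set" where
  "ray_edges r = range (\<lambda>i. {r i, r (Suc i)})"

definition has_tail_in :: "(nat \<Rightarrow> 'a) \<Rightarrow> 'a set \<Rightarrow> bool" where
  "has_tail_in r C \<longleftrightarrow> (\<exists>n. \<forall>i\<ge>n. r i \<in> C)"

definition ray_equiv :: "'a graph \<Rightarrow> ((nat \<Rightarrow> 'a) \<times> (nat \<Rightarrow> 'a)) set" where
  "ray_equiv G = {(r, s). ray G r \<and> ray G s \<and>
     (\<forall>S. finite S \<and> S \<subseteq> verts G \<longrightarrow>
        (\<exists>C\<in>graph_components (delete_verts G S). has_tail_in r C \<and> has_tail_in s C))}"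

definition ends :: "'a graph \<Rightarrow> (nat \<Rightarrow> 'a) set set" where
  "ends G = {r. ray G r} // ray_equiv G"

(* The value is \<infinity> if there are arbitrarily large finite families of edge-disjoint rays in
   the end; otherwise the supremum is a maximum. *)
definition end_degree :: "(nat \<Rightarrow> 'a) set \<Rightarrow> enat" where
  "end_degree \<omega> =
     (SUP R\<in>{R. R \<subseteq> \<omega> \<and> finite R \<and> pairwise (\<lambda>r s. ray_edges r \<inter> ray_edges s = {}) R}.
        enat (card R))"

(* The component C(S, \<omega>) of G - S in which every ray of the end \<omega> has a tail. *)
definition end_component :: "'a graph \<Rightarrow> 'a set \<Rightarrow> (nat \<Rightarrow> 'a) set \<Rightarrow> 'a set" where
  "end_component G S \<omega> =
     (THE C. C \<in> graph_components (delete_verts G S) \<and> (\<forall>r\<in>\<omega>. has_tail_in r C))"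

(* Points of the 1-complex G are written in barycentric coordinates with respect to the
   vertices. *)
datatype 'a point = Complex_Point "'a \<Rightarrow> real" | End_Point "(nat \<Rightarrow> 'a) set"

definition vertex_point :: "'a \<Rightarrow> 'a point" where
  "vertex_point v = Complex_Point (indicator {v})"

(* The point at distance t from u on the edge uv, which has length 1. *)
definition edge_point :: "'a \<Rightarrow> 'a \<Rightarrow> real \<Rightarrow> 'a point" where
  "edge_point u v t = Complex_Point (\<lambda>w. (1 - t) * indicator {u} w + t * indicator {v} w)"

definition vertex_nbhd :: "'a graph \<Rightarrow> 'a \<Rightarrow> real \<Rightarrow> 'a point set" where
  "vertex_nbhd G v \<epsilon> =
     {vertex_point v} \<union> {edge_point v w t | w t. {v, w} \<in> edges G \<and> 0 \<le> t \<and> t < \<epsilon>}"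

(* The component C(S, \<omega>) as a subcomplex, the ends living in it, and of each edge between
   C(S, \<omega>) and S the inner points at distance less than \<epsilon> from its endpoint in C(S, \<omega>). *)
definition end_nbhd ::
  "'a graph \<Rightarrow> 'a set \<Rightarrow> (nat \<Rightarrow> 'a) set \<Rightarrow> real \<Rightarrow> 'a point set" where
  "end_nbhd G S \<omega> \<epsilon> = (let C = end_component G S \<omega> in
     vertex_point ` C \<union>
     {edge_point u v t | u v t. {u, v} \<in> edges G \<and> u \<in> C \<and> v \<in> C \<and> 0 \<le> t \<and> t \<le> 1} \<union>
     {edge_point u v t | u v t. {u, v} \<in> edges G \<and> u \<in> C \<and> v \<in> S \<and> 0 < t \<and> t < \<epsilon>} \<union>
     End_Point ` {\<omega>' \<in> ends G. end_component G S \<omega>' = C})"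

(* The space |G|. For locally finite G the sets vertex_nbhd and the open subintervals of edges
   are a basis of the 1-complex topology. *)
definition freudenthal :: "'a graph \<Rightarrow> 'a point topology" where
  "freudenthal G = topology_generated_by
     ({vertex_nbhd G v \<epsilon> | v \<epsilon>. v \<in> verts G \<and> 0 < \<epsilon> \<and> \<epsilon> \<le> 1} \<union>
      {edge_point u v ` {a<..<b} | u v a b. {u, v} \<in> edges G \<and> 0 \<le> a \<and> a < b \<and> b \<le> 1} \<union>
      {end_nbhd G S \<omega> \<epsilon> | S \<omega> \<epsilon>.
         finite S \<and> S \<subseteq> verts G \<and> \<omega> \<in> ends G \<and> 0 < \<epsilon> \<and> \<epsilon> \<le> 1})"

definition circle_in :: "'b topology \<Rightarrow> 'b set \<Rightarrow> bool" where
  "circle_in X K \<longleftrightarrow> K \<subseteq> topspace X \<and>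
     top_of_set (sphere (0::complex) 1) homeomorphic_space subtopology X K"

definition hamilton_circle :: "'a graph \<Rightarrow> 'a point set \<Rightarrow> bool" where
  "hamilton_circle G K \<longleftrightarrow>
     circle_in (freudenthal G) K \<and> vertex_point ` verts G \<subseteq> K \<and> End_Point ` ends G \<subseteq> K"

definition subgraph_in :: "'a graph \<Rightarrow> 'a point set \<Rightarrow> 'a graph" where
  "subgraph_in G K =
     \<lparr>verts = {v \<in> verts G. vertex_point v \<in> K},
      edges = {e \<in> edges G. \<forall>u v t. e = {u, v} \<and> 0 \<le> t \<and> t \<le> 1 \<longrightarrow> edge_point u v t \<in> K}\<rparr>"

definition hamilton_cycle :: "'a graph \<Rightarrow> 'a graph \<Rightarrow> bool" where
  "hamilton_cycle G H \<longleftrightarrow> (\<exists>K. hamilton_circle G K \<and> H = subgraph_in G K)"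

definition hamiltonian :: "'a graph \<Rightarrow> bool" where
  "hamiltonian G \<longleftrightarrow> (\<exists>H. hamilton_cycle G H)"

end

theory Submission
  imports Defs
begin

text \<open>A Hamilton circle with the end removed is an open arc through all vertices, that is, a
  spanning double ray, and conversely every spanning double ray closes up to a Hamilton circle. So a
  second spanning double ray is needed.

  Since the end has degree at most 3, augmenting flows shows that every finite set of vertices lies
  in a finite set with at most three boundary edges. Such a set is a segment of the given double
  ray, and contracting its complement gives a finite cubic graph in which the double ray becomes a
  Hamilton cycle (if there are only two boundary edges, the contracted vertex has degree 2). By the
  parity argument of Smith, Tutte and Thomason, either the segment has a second Hamilton path with
  the same endvertices, which can replace the segment in the double ray, or a Hamilton cycle of the
  finite graph uses a prescribed edge outside the double ray. If the latter happens for all these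
  segments, then a limit of the Hamilton cycles is a spanning double ray that uses the prescribed
  edge; it is connected because three boundary edges allow a path to enter a segment only once.\<close>

section \<open>Parity of Hamilton cycles in finite graphs\<close>

text \<open>The count modulo 4 is there because evenness alone is too weak: a second Hamilton cycle
  of the contracted graph may leave through the one extra boundary edge, and such a cycle cannot be
  spliced back into the double ray. Only cycles using both double-ray edges at the contracted vertex
  can, so exactly these have to be even in number. The obstacle in the limit is that a vertex may be
  visited at times tending to infinity and so be lost. Every finite path is therefore numbered so
  that the prescribed chord is crossed from time 0 to time 1. A vertex of a fixed segment with at
  most three boundary edges is then reached without leaving that segment, hence at a time bounded by
  its size. The same chord makes the limit differ from the given double ray. The bound 3 on boundary
  edges splits as 2 + 1: the double ray itself always contributes two, which leaves room for at most
  one chord. The flows have a source but no sink; they escape to infinity, so augmenting paths are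
  rays, and a flow of value 4 would give four edge-disjoint rays of the only end.\<close>

lemma even_card_involution:
  assumes "finite S" and "\<And>s. s \<in> S \<Longrightarrow> f s \<in> S \<and> f s \<noteq> s \<and> f (f s) = s"
  shows "even (card S)"
  using assms
proof (induction S rule: finite_psubset_induct)
  case (psubset S)
  show ?case
  proof (cases "S = {}")
    case False
    then obtain s where s: "s \<in> S" by blast
    let ?T = "S - {s, f s}"
    have "even (card ?T)"
    proof (rule psubset.IH)
      show "?T \<subset> S" using s by blast
      fix t assume "t \<in> ?T"
      then show "f t \<in> ?T \<and> f t \<noteq> t \<and> f (f t) = t"
        using psubset.prems[of t] psubset.prems[of s] s by (metis DiffD1 DiffD2 DiffI insert_iff singletonD)
    qed
    moreover have "card S = card ?T + 2"
    proof -
      have "card {s, f s} = 2" using psubset.prems[OF s] by (auto simp: card_insert_if)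
      moreover have "{s, f s} \<subseteq> S" using psubset.prems[OF s] s by blast
      ultimately show ?thesis
        using psubset.hyps card_Diff_subset[of "{s, f s}" S] card_mono[of S "{s, f s}"] by simp
    qed
    ultimately show ?thesis by simp
  qed simp
qed

section \<open>Hamilton paths and cycles as lists\<close>

definition ham_path :: "('b \<Rightarrow> 'b \<Rightarrow> bool) \<Rightarrow> 'b set \<Rightarrow> 'b list \<Rightarrow> bool" where
  "ham_path E V xs \<longleftrightarrow> distinct xs \<and> set xs = V \<and> successively E xs"

lemma finite_ham_path: "finite V \<Longrightarrow> finite {xs. ham_path E V xs}"
  by (rule finite_subset[OF _ finite_subset_distinct[of V]]) (auto simp: ham_path_def)

lemma successively_rev_symp:
  assumes "symp E"
  shows "successively E (rev xs) \<longleftrightarrow> successively E xs"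
proof -
  have "(\<lambda>x y. E y x) = E" using assms by (auto simp: fun_eq_iff dest: sympD)
  then show ?thesis by (simp only: successively_rev)
qed

lemma takeWhile_split: "w \<notin> set A \<Longrightarrow> takeWhile (\<lambda>u. u \<noteq> w) (A @ w # B) = A"
  by (induction A) auto

lemma dropWhile_split: "w \<notin> set A \<Longrightarrow> dropWhile (\<lambda>u. u \<noteq> w) (A @ w # B) = w # B"
  by (induction A) auto

text \<open>The attachment vertex stays in the pair because the same vertex undoes the reversal: the
  first vertex after \<open>w\<close> becomes the last one and is still adjacent to
  \<open>w\<close>.\<close>

definition lollipop :: "'b list \<times> 'b \<Rightarrow> 'b list \<times> 'b" where
  "lollipop p = (case p of (L, w) \<Rightarrow>
     (takeWhile (\<lambda>u. u \<noteq> w) L @ w # rev (tl (dropWhile (\<lambda>u. u \<noteq> w) L)), w))"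

lemma lollipop_split: "w \<notin> set A \<Longrightarrow> lollipop (A @ w # B, w) = (A @ w # rev B, w)"
  by (simp add: lollipop_def takeWhile_split dropWhile_split)

text \<open>A cycle is cut open at \<open>x\<close>, so \<open>L ! 1\<close> and
  \<open>last L\<close> are its two neighbours of \<open>x\<close>. Lists are oriented: every cycle
  of length at least 3 is counted twice.\<close>

definition ham_cycles :: "('b \<Rightarrow> 'b \<Rightarrow> bool) \<Rightarrow> 'b set \<Rightarrow> 'b \<Rightarrow> 'b list set" where
  "ham_cycles E V x = {L. ham_path E V L \<and> hd L = x \<and> E (last L) x}"

text \<open>Thomason's lollipop argument: pair a Hamilton path starting with the edge \<open>x y\<close> with an edge
  from its last vertex to an earlier vertex \<open>w\<close>. Reversing the part of the path after \<open>w\<close> is a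
  fixed-point free involution on the pairs with \<open>w \<noteq> x\<close>, and those with \<open>w = x\<close> are the cycles.\<close>

lemma even_ham_cycles:
  assumes fin: "finite V" and card: "3 \<le> card V" and sym: "symp E" and irr: "irreflp E"
    and odd: "\<And>v. v \<in> V \<Longrightarrow> v \<noteq> x \<Longrightarrow> odd (card {w \<in> V. E v w})"
  shows "even (card {L \<in> ham_cycles E V x. L ! 1 = y})"
proof -
  define P where "P = {L. ham_path E V L \<and> hd L = x \<and> L ! 1 = y}"
  \<comment> \<open>Leaving out the predecessor of the last vertex makes \<open>W L\<close> one
    smaller than an odd neighbourhood, hence even.\<close>
  define W where "W = (\<lambda>L. {w \<in> V. E (last L) w \<and> w \<noteq> last (butlast L)})"
  define T where "T = Sigma P W"
  have len: "3 \<le> length L" if "L \<in> P" for L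
    using that card distinct_card[of L] by (auto simp: P_def ham_path_def)
  have snoc: "\<exists>A u v. L = A @ [u, v] \<and> A \<noteq> []" if L: "L \<in> P" for L
  proof -
    have "L = butlast (butlast L) @ [last (butlast L), last L]"
      using len[OF L] by (cases L rule: rev_cases; cases "butlast L" rule: rev_cases) (auto simp: butlast_append)
    moreover have "butlast (butlast L) \<noteq> []" using len[OF L] by (auto simp flip: length_greater_0_conv)
    ultimately show ?thesis by blast
  qed
  have finP: "finite P"
    by (rule finite_subset[OF _ finite_ham_path[OF fin, of E]]) (auto simp: P_def)
  have finW: "finite (W L)" for L using fin by (simp add: W_def)
  have evenW: "even (card (W L))" if L: "L \<in> P" for L
  proof -
    obtain A u v where A: "L = A @ [u, v]" "A \<noteq> []" using snoc[OF L] by blast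
    have hp: "distinct L" "set L = V" "successively E L" "hd L = x"
      using L by (auto simp: P_def ham_path_def)
    have uv: "E u v" using hp(3) by (auto simp: A(1) successively_append_iff)
    have "v \<noteq> x" using hp A by (cases A) auto
    have "v \<in> V" "u \<in> V" using hp A by auto
    have eq: "W L = {w \<in> V. E v w} - {u}" using A by (auto simp: W_def butlast_append)
    have "u \<in> {w \<in> V. E v w}" using uv sym \<open>u \<in> V\<close> by (auto dest: sympD)
    moreover have "odd (card {w \<in> V. E v w})" using odd \<open>v \<in> V\<close> \<open>v \<noteq> x\<close> by blast
    ultimately show ?thesis unfolding eq using fin by (simp add: card_Diff_singleton)
  qed
  have "even (card T)"
    unfolding T_def using finP finW evenW by (subst card_SigmaI) (auto intro: dvd_sum)
  moreover have "even (card {p \<in> T. snd p \<noteq> x})"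
  proof (rule even_card_involution[where f = lollipop])
    show "finite {p \<in> T. snd p \<noteq> x}" unfolding T_def using finP finW by auto
    fix p assume p: "p \<in> {p \<in> T. snd p \<noteq> x}"
    obtain L w where pL: "p = (L, w)" by (cases p)
    have L: "L \<in> P" and w: "w \<in> V" "E (last L) w" "w \<noteq> last (butlast L)" "w \<noteq> x"
      using p by (auto simp: pL T_def W_def)
    have hp: "distinct L" "set L = V" "successively E L" "hd L = x" "L ! 1 = y"
      using L by (auto simp: P_def ham_path_def)
    obtain A B where AB: "L = A @ w # B" "w \<notin> set A" using split_list_first[of w L] w hp by auto
    have "A \<noteq> []" using AB hp(4) w by auto
    have "B \<noteq> []" using AB w(2) irr by (auto dest: irreflpD)
    \<comment> \<open>A tail of one vertex would make \<open>w\<close> the excluded predecessor. A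
      longer tail has two different ends, so its reversal is a different list.\<close>
    have "length B \<noteq> 1"
    proof
      assume "length B = 1"
      then obtain b where "B = [b]" by (auto simp: length_Suc_conv)
      then show False using AB w(3) by (simp add: butlast_append)
    qed
    then obtain b B' c where B: "B = b # B' @ [c]"
      using \<open>B \<noteq> []\<close> by (cases B; cases "tl B" rule: rev_cases) auto
    have bc: "b \<noteq> c" using hp(1) AB B by auto
    have lp: "lollipop p = (A @ w # rev B, w)" using AB pL lollipop_split by simp
    have "rev B \<noteq> B" using B bc by simp
    then have ne: "lollipop p \<noteq> p" unfolding lp by (simp add: pL AB(1))
    have invol: "lollipop (lollipop p) = p" unfolding lp lollipop_split[OF AB(2)] by (simp add: AB pL)
    have "successively E (w # rev B)"
      using successively_rev_symp[OF sym, of B] hp(3) w(2) sympD[OF sym, of c w] unfolding AB(1)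
      by (simp add: successively_append_iff successively_Cons[of E w] B del: successively_rev)
    then have "successively E (A @ w # rev B)"
      using hp(3) unfolding AB(1) by (simp add: successively_append_iff)
    moreover have "distinct (A @ w # rev B)" "set (A @ w # rev B) = V" using hp AB by auto
    moreover have "hd (A @ w # rev B) = x" using hp AB \<open>A \<noteq> []\<close> by auto
    \<comment> \<open>As \<open>A\<close> is nonempty, position 1 lies in \<open>A\<close> or is
      \<open>w\<close> itself; the move keeps the first edge.\<close>
    moreover have "(A @ w # rev B) ! 1 = y" using hp(5) \<open>A \<noteq> []\<close>
      by (cases A; cases "tl A") (auto simp: AB(1))
    ultimately have "A @ w # rev B \<in> P" by (auto simp: P_def ham_path_def)
    moreover have "w \<in> W (A @ w # rev B)"
    proof -
      have "E b w" using hp(3) sym unfolding AB(1) B by (auto simp: successively_append_iff dest: sympD)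
      moreover have "w \<noteq> last (butlast (A @ w # rev B))"
      proof -
        have "butlast (A @ w # rev B) = A @ w # c # rev B'" by (simp add: B butlast_append)
        moreover have "last (c # rev B') \<in> set B" using last_in_set[of "c # rev B'"] by (auto simp: B)
        ultimately show ?thesis using hp(1) unfolding AB(1) by auto
      qed
      ultimately show ?thesis using w(1) by (auto simp: W_def B)
    qed
    ultimately show "lollipop p \<in> {p \<in> T. snd p \<noteq> x} \<and> lollipop p \<noteq> p \<and> lollipop (lollipop p) = p"
      using ne invol w by (auto simp: lp T_def)
  qed
  moreover have "card T = card {p \<in> T. snd p \<noteq> x} + card {p \<in> T. snd p = x}"
  proof -
    have "finite T" unfolding T_def using finP finW by auto
    moreover have "T = {p \<in> T. snd p \<noteq> x} \<union> {p \<in> T. snd p = x}" by blast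
    ultimately show ?thesis using card_Un_disjoint[of "{p \<in> T. snd p \<noteq> x}" "{p \<in> T. snd p = x}"] by auto
  qed
  ultimately have "even (card {p \<in> T. snd p = x})" by simp
  moreover have eq: "{p \<in> T. snd p = x} = (\<lambda>L. (L, x)) ` {L \<in> ham_cycles E V x. L ! 1 = y}"
  proof -
    have "x \<in> W L" if L: "L \<in> P" and "E (last L) x" for L
    proof -
      obtain A u v where A: "L = A @ [u, v]" "A \<noteq> []" using snoc[OF L] by blast
      have "x \<noteq> u" using A L by (cases A) (auto simp: P_def ham_path_def)
      moreover have "x \<in> V" using A L by (cases A) (auto simp: P_def ham_path_def)
      ultimately show ?thesis using that A by (auto simp: W_def butlast_append)
    qed
    then show ?thesis by (auto simp: T_def P_def W_def ham_cycles_def)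
  qed
  moreover have "card {p \<in> T. snd p = x} = card {L \<in> ham_cycles E V x. L ! 1 = y}"
    unfolding eq by (rule card_image) (simp add: inj_on_def)
  ultimately show ?thesis by simp
qed

lemma ham_cyclesD:
  assumes "L \<in> ham_cycles E V x" and "3 \<le> card V"
  shows "distinct L" "set L = V" "successively E L" "E (last L) x"
    "\<exists>y M z. L = x # y # M @ [z] \<and> L ! 1 = y \<and> last L = z \<and> E x y"
proof -
  show *: "distinct L" "set L = V" "successively E L" "E (last L) x"
    using assms by (auto simp: ham_cycles_def ham_path_def)
  have "3 \<le> length L" using assms(2) * distinct_card[of L] by simp
  then obtain y M z where "L = x # y # M @ [z]"
    using assms(1) by (cases L; cases "tl L"; cases "tl (tl L)" rule: rev_cases) (auto simp: ham_cycles_def)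
  then show "\<exists>y M z. L = x # y # M @ [z] \<and> L ! 1 = y \<and> last L = z \<and> E x y"
    using *(3) by (intro exI[of _ y] exI[of _ M] exI[of _ z]) auto
qed

lemma ham_cycles_rotate:
  assumes L: "L \<in> ham_cycles E V x" and v: "v \<in> V" and card: "3 \<le> card V"
  shows "dropWhile (\<lambda>u. u \<noteq> v) L @ takeWhile (\<lambda>u. u \<noteq> v) L \<in> ham_cycles E V v"
proof -
  note D = ham_cyclesD[OF L card]
  obtain A B where AB: "L = A @ v # B" "v \<notin> set A" using split_list_first[of v L] v D by auto
  have "v # B @ A \<in> ham_cycles E V v"
  proof (cases "A = []")
    case False
    then have "hd A = x" using L AB by (auto simp: ham_cycles_def)
    have "successively E ((v # B) @ A)"
      using D(3,4) False \<open>hd A = x\<close> unfolding AB(1) successively_append_iff by auto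
    then show ?thesis using D(1-3) False unfolding AB(1)
      by (auto simp: ham_cycles_def ham_path_def successively_append_iff)
  qed (use L AB in \<open>auto simp: ham_cycles_def\<close>)
  then show ?thesis using AB by (simp add: takeWhile_split dropWhile_split)
qed

text \<open>Rotating a list to start at \<open>v\<close> is undone by rotating it back to
  \<open>x\<close>, so the rotation is injective.\<close>

lemma card_ham_cycles_le:
  assumes fin: "finite V" and card: "3 \<le> card V" and "x \<in> V" "v \<in> V"
  shows "card (ham_cycles E V x) \<le> card (ham_cycles E V v)"
proof (rule card_inj_on_le)
  let ?f = "\<lambda>v L. dropWhile (\<lambda>u. u \<noteq> v) L @ takeWhile (\<lambda>u. u \<noteq> v) L"
  show "?f v ` ham_cycles E V x \<subseteq> ham_cycles E V v"
    using ham_cycles_rotate[OF _ \<open>v \<in> V\<close> card] by blast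
  show "finite (ham_cycles E V v)"
    by (rule finite_subset[OF _ finite_ham_path[OF fin, of E]]) (auto simp: ham_cycles_def)
  have "?f x (?f v L) = L" if L: "L \<in> ham_cycles E V x" for L
  proof -
    note D = ham_cyclesD[OF L card]
    obtain A B where AB: "L = A @ v # B" "v \<notin> set A" using split_list_first[of v L] \<open>v \<in> V\<close> D by auto
    show ?thesis
    proof (cases A)
      case Nil
      then show ?thesis using AB L by (auto simp: ham_cycles_def)
    next
      case (Cons x' A')
      then have "x' = x" using AB L by (auto simp: ham_cycles_def)
      then have "?f v L = (v # B) @ x # A'" "x \<notin> set (v # B)"
        using AB D(1) Cons by (auto simp: takeWhile_split dropWhile_split)
      then show ?thesis using AB Cons \<open>x' = x\<close>
        by (metis append_Cons dropWhile_split takeWhile_split)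
    qed
  qed
  then show "inj_on (?f v) (ham_cycles E V x)" by (rule inj_on_inverseI)
qed

lemma card_ham_cycles_eq:
  assumes "finite V" "3 \<le> card V" "x \<in> V" "v \<in> V"
  shows "card (ham_cycles E V x) = card (ham_cycles E V v)"
  using card_ham_cycles_le assms by (metis le_antisym)

text \<open>Reversing everything after \<open>x\<close> runs through the cycle in the other
  direction.\<close>

lemma card_ham_cycles_swap:
  assumes fin: "finite V" and card: "3 \<le> card V" and sym: "symp E"
  shows "card {L \<in> ham_cycles E V x. L ! 1 = y \<and> last L = z} =
    card {L \<in> ham_cycles E V x. L ! 1 = z \<and> last L = y}"
proof -
  have *: "x # rev (tl L) \<in> ham_cycles E V x \<and> (x # rev (tl L)) ! 1 = last L \<and>
    last (x # rev (tl L)) = L ! 1 \<and> x # rev (tl (x # rev (tl L))) = L"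
    if L: "L \<in> ham_cycles E V x" for L
  proof -
    note D = ham_cyclesD[OF L card]
    obtain y M z where yz: "L = x # y # M @ [z]" using D(5) by blast
    have "successively E (rev (y # M @ [z]))" "E x z" "E y x"
      using D(3,4) successively_rev_symp[OF sym, of "y # M @ [z]"] sympD[OF sym] unfolding yz
      by (simp_all del: successively_rev)
    then have "x # z # rev M @ [y] \<in> ham_cycles E V x"
      using D(1,2) unfolding yz by (simp add: ham_cycles_def ham_path_def) blast
    then show ?thesis by (simp add: yz)
  qed
  show ?thesis
    by (rule bij_betw_same_card[where f = "\<lambda>L. x # rev (tl L)"],
        rule bij_betw_byWitness[where f' = "\<lambda>L. x # rev (tl L)"])
       (use * in \<open>blast+\<close>)
qed

text \<open>A cycle leaves and enters \<open>x\<close> by different edges, so at a vertex of degree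
  3 the second vertex leaves only two choices for the last.\<close>

lemma ham_cycles_count:
  assumes fin: "finite V" and card: "3 \<le> card V" and sym: "symp E"
    and nb: "{w \<in> V. E x w} = {a, b, c}" "distinct [a, b, c]"
  shows "card {L \<in> ham_cycles E V x. L ! 1 = a} =
      card {L \<in> ham_cycles E V x. L ! 1 = a \<and> last L = b} +
      card {L \<in> ham_cycles E V x. L ! 1 = a \<and> last L = c}" (is ?A)
    and "card (ham_cycles E V x) = card {L \<in> ham_cycles E V x. L ! 1 = a} +
      card {L \<in> ham_cycles E V x. L ! 1 = b} + card {L \<in> ham_cycles E V x. L ! 1 = c}" (is ?B)
proof -
  have finH: "finite (ham_cycles E V x)"
    by (rule finite_subset[OF _ finite_ham_path[OF fin, of E]]) (auto simp: ham_cycles_def)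
  have *: "L ! 1 \<in> {a, b, c} \<and> last L \<in> {a, b, c} \<and> L ! 1 \<noteq> last L"
    if L: "L \<in> ham_cycles E V x" for L
  proof -
    note D = ham_cyclesD[OF L card]
    obtain y M z where yz: "L = x # y # M @ [z]" "E x y" using D(5) by blast
    have "y \<in> {w \<in> V. E x w}" "z \<in> {w \<in> V. E x w}" "y \<noteq> z"
      using D yz sym by (auto dest: sympD)
    then show ?thesis unfolding nb by (simp add: yz)
  qed
  have "{L \<in> ham_cycles E V x. L ! 1 = a} = {L \<in> ham_cycles E V x. L ! 1 = a \<and> last L = b} \<union>
      {L \<in> ham_cycles E V x. L ! 1 = a \<and> last L = c}" (is "?X = ?Y \<union> ?Z") using * by fastforce
  moreover have "finite ?Y" "finite ?Z" "?Y \<inter> ?Z = {}" using finH nb(2) by auto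
  ultimately show ?A by (simp add: card_Un_disjoint)
  have "ham_cycles E V x = {L \<in> ham_cycles E V x. L ! 1 = a} \<union>
      ({L \<in> ham_cycles E V x. L ! 1 = b} \<union> {L \<in> ham_cycles E V x. L ! 1 = c})" using * by auto
  then have "card (ham_cycles E V x) = card ({L \<in> ham_cycles E V x. L ! 1 = a} \<union>
      ({L \<in> ham_cycles E V x. L ! 1 = b} \<union> {L \<in> ham_cycles E V x. L ! 1 = c}))" by simp
  also have "\<dots> = card {L \<in> ham_cycles E V x. L ! 1 = a} +
      (card {L \<in> ham_cycles E V x. L ! 1 = b} + card {L \<in> ham_cycles E V x. L ! 1 = c})"
    by (subst card_Un_disjoint; (subst card_Un_disjoint)?) (use finH nb(2) in auto)
  finally show ?B by simp
qed

text \<open>If no Hamilton cycle uses the third edge \<open>v r\<close> at \<open>v\<close>, then all of them use one and the same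
  edge at \<open>v\<close>, so their number is even; those through the edge \<open>x c\<close> are even in number too, and
  the remaining ones are those through \<open>a x b\<close>. As each cycle is listed in both directions, the
  total is computed modulo 4.\<close>

lemma even_ham_cycles_avoiding:
  assumes fin: "finite V" and card: "3 \<le> card V" and sym: "symp E" and irr: "irreflp E"
    and cub: "\<And>v. v \<in> V \<Longrightarrow> card {w \<in> V. E v w} = 3"
    and x: "x \<in> V" "{w \<in> V. E x w} = {a, b, c}" "distinct [a, b, c]"
    and v: "v \<in> V" "r \<in> V" "E v r" "\<And>L. L \<in> ham_cycles E V v \<Longrightarrow> L ! 1 \<noteq> r"
  shows "even (card {L \<in> ham_cycles E V x. L ! 1 = a \<and> last L = b})"
proof -
  define N where "N = (\<lambda>x y z. card {L \<in> ham_cycles E V x. L ! 1 = y \<and> last L = z})"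
  define N1 where "N1 = (\<lambda>x y. card {L \<in> ham_cycles E V x. L ! 1 = y})"
  have ev: "even (N1 x y)" for x y
    unfolding N1_def by (rule even_ham_cycles[OF fin card sym irr]) (simp add: cub)
  have sw: "N x y z = N x z y" for x y z
    unfolding N_def by (rule card_ham_cycles_swap[OF fin card sym])
  obtain p q where pq: "{w \<in> V. E v w} = {r, p, q}" "distinct [r, p, q]"
  proof -
    have "card ({w \<in> V. E v w} - {r}) = 2" using cub[OF v(1)] v(2,3) fin by simp
    then obtain p q where "{w \<in> V. E v w} - {r} = {p, q}" "p \<noteq> q" by (auto simp: card_2_iff)
    then show ?thesis using v(2,3) by (intro that[of p q]) auto
  qed
  have cnt: "N1 x a = N x a b + N x a c" "card (ham_cycles E V x) = N1 x a + N1 x b + N1 x c"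
    if "{w \<in> V. E x w} = {a, b, c}" "distinct [a, b, c]" for x a b c
    using ham_cycles_count[OF fin card sym that] by (simp_all add: N_def N1_def)
  have perm: "{r, p, q} = {p, q, r}" "{r, p, q} = {q, p, r}" "{a, b, c} = {b, a, c}"
    "{a, b, c} = {c, a, b}" by auto
  \<comment> \<open>By the swap symmetry, a vertex that is never second is never last
    either.\<close>
  have zero: "N1 v r = 0" "N v p r = 0" "N v q r = 0"
  proof -
    have "{L \<in> ham_cycles E V v. L ! 1 = r} = {}" using v(4) by auto
    then show 0: "N1 v r = 0" unfolding N1_def by (metis card.empty)
    then have "N v r p = 0" "N v r q = 0" using cnt(1)[OF pq] by simp_all
    then show "N v p r = 0" "N v q r = 0" using sw by metis+
  qed
  \<comment> \<open>All cycles use both \<open>v p\<close> and \<open>v q\<close>. The two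
    orientations give equal counts \<open>N1 v p\<close>, and this number is even by the lollipop
    argument, so 4 divides the total.\<close>
  have "N1 v p = N v p q" using cnt(1)[of v p q r] pq zero by (auto simp: insert_commute)
  moreover have "N1 v q = N v p q" using cnt(1)[of v q p r] pq zero sw[of v p q] by (auto simp: insert_commute)
  ultimately have "card (ham_cycles E V v) = 2 * N1 v p" using cnt(2)[OF pq] zero by simp
  then have "4 dvd card (ham_cycles E V x)"
    using ev[of v p] card_ham_cycles_eq[OF fin card x(1) v(1), of E] by (auto elim!: evenE)
  \<comment> \<open>Half of the total is even and splits by the pair of edges used at
    \<open>x\<close>; the two pairs containing \<open>c\<close> add up to the even number
    \<open>N1 x c\<close>, which leaves the pair \<open>a\<close>, \<open>b\<close>.\<close>
  moreover have "card (ham_cycles E V x) = 2 * (N x a b + N x c a + N x c b)"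
    using cnt(2)[OF x(2,3)] cnt(1)[OF x(2,3)] cnt(1)[of x b a c] cnt(1)[of x c a b] x(2,3)
      sw[of x b a] sw[of x a c] sw[of x b c] by (auto simp: insert_commute)
  moreover have "even (N x c a + N x c b)"
    using ev[of x c] cnt(1)[of x c a b] x(2,3) by (auto simp: insert_commute)
  ultimately have "even (N x a b)" by presburger
  then show ?thesis by (simp add: N_def)
qed

section \<open>A second spanning double ray in a numbered cubic graph\<close>

lemma int_first_entry:
  fixes lo hi :: int
  assumes "lo < hi" "\<not> P lo" "P hi"
  shows "\<exists>t. lo \<le> t \<and> t < hi \<and> \<not> P t \<and> P (t + 1)"
proof (rule ccontr)
  assume *: "\<not> ?thesis"
  have "t \<le> hi \<longrightarrow> \<not> P t" if "lo \<le> t" for t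
    using that by (induction t rule: int_ge_induct) (use * assms in force)+
  then show False using assms by force
qed

text \<open>Leaving and re-entering \<open>S\<close> would use four boundary edges.\<close>

lemma convex_of_small_boundary:
  fixes f :: "int \<Rightarrow> 'b"
  assumes inj: "inj_on f {lo..hi}" and ends: "f lo \<notin> S" "f hi \<notin> S"
    and step: "\<And>t. lo \<le> t \<Longrightarrow> t < hi \<Longrightarrow> R (f t) (f (t + 1))" and sym: "symp R"
    and bd: "finite {(u, w). u \<in> S \<and> w \<notin> S \<and> R u w}"
      "card {(u, w). u \<in> S \<and> w \<notin> S \<and> R u w} \<le> 3"
    and p: "lo \<le> p" "f p \<in> S" and r: "r \<le> hi" "f r \<in> S" and q: "p \<le> q" "q \<le> r"
  shows "f q \<in> S"
proof (rule ccontr)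
  assume q': "f q \<notin> S"
  have lt: "lo < p" "p < q" "q < r" "r < hi"
    using ends p r q q' by (metis order_le_imp_less_or_eq)+
  obtain t1 where t1: "lo \<le> t1" "t1 < p" "f t1 \<notin> S" "f (t1 + 1) \<in> S"
    using int_first_entry[of lo p "\<lambda>t. f t \<in> S"] lt ends p by blast
  obtain t2 where t2: "p \<le> t2" "t2 < q" "f t2 \<in> S" "f (t2 + 1) \<notin> S"
    using int_first_entry[of p q "\<lambda>t. f t \<notin> S"] lt q' p by blast
  obtain t3 where t3: "q \<le> t3" "t3 < r" "f t3 \<notin> S" "f (t3 + 1) \<in> S"
    using int_first_entry[of q r "\<lambda>t. f t \<in> S"] lt q' r by blast
  obtain t4 where t4: "r \<le> t4" "t4 < hi" "f t4 \<in> S" "f (t4 + 1) \<notin> S"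
    using int_first_entry[of r hi "\<lambda>t. f t \<notin> S"] lt ends r by blast
  have eq: "f s = f t \<longleftrightarrow> s = t" if "lo \<le> s" "s \<le> hi" "lo \<le> t" "t \<le> hi" for s t
    using inj that by (auto simp: inj_on_def)
  let ?X = "{(f (t1 + 1), f t1), (f t2, f (t2 + 1)), (f (t3 + 1), f t3), (f t4, f (t4 + 1))}"
  have "card ?X = 4"
    using t1 t2 t3 t4 lt by (auto simp: card_insert_if eq)
  moreover have "?X \<subseteq> {(u, w). u \<in> S \<and> w \<notin> S \<and> R u w}"
    using t1 t2 t3 t4 lt step[of t1] step[of t2] step[of t3] step[of t4] sym by (auto dest: sympD)
  ultimately show False using card_mono[OF bd(1), of ?X] bd(2) by simp
qed

text \<open>A diagonal argument: the windows take finitely many values, so nested infinite index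
  sets exist on which ever larger windows are constant. Having infinitely many agreeing indices
  allows arbitrarily large ones to be picked later.\<close>

lemma pointwise_limit:
  fixes F :: "nat \<Rightarrow> int \<Rightarrow> 'b"
  assumes fin: "\<And>t. finite (B t)" and F: "\<And>n t. F n t \<in> B t"
  shows "\<exists>f. \<forall>T. infinite {n. \<forall>t\<in>{-int T..int T}. F n t = f t}"
proof -
  define Q where "Q = (\<lambda>k N. infinite N \<and> (\<forall>t\<in>{-int k..int k}. \<forall>n\<in>N. \<forall>m\<in>N. F n t = F m t))"
  have step: "\<exists>M. Q k M \<and> M \<subseteq> N" if N: "infinite N" for N k
  proof -
    let ?r = "\<lambda>n. restrict (F n) {-int k..int k}"
    have "?r ` N \<subseteq> PiE {-int k..int k} B" using F by auto
    then have "finite (?r ` N)" using fin by (auto intro: finite_subset[OF _ finite_PiE])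
    then obtain n0 where n0: "infinite {n \<in> N. ?r n = ?r n0}"
      using pigeonhole_infinite[OF N] by blast
    have *: "F n t = F n0 t" if "?r n = ?r n0" "t \<in> {-int k..int k}" for n t
      using fun_cong[OF that(1), of t] that(2) by simp
    have "Q k {n \<in> N. ?r n = ?r n0}"
      unfolding Q_def
    proof (intro conjI ballI n0)
      fix t n m assume "t \<in> {-int k..int k}" "n \<in> {n \<in> N. ?r n = ?r n0}" "m \<in> {n \<in> N. ?r n = ?r n0}"
      then show "F n t = F m t" using *[of n t] *[of m t] by simp
    qed
    then show ?thesis by (intro exI[of _ "{n \<in> N. ?r n = ?r n0}"]) simp
  qed
  have "\<exists>N. \<forall>k. Q k (N k) \<and> N (Suc k) \<subseteq> N k"
  proof (rule dependent_nat_choice)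
    show "\<exists>N. Q 0 N" using step[OF infinite_UNIV_nat] by blast
    show "\<exists>M. Q (Suc k) M \<and> M \<subseteq> N" if "Q k N" for N k
      by (rule step, rule conjunct1[OF that[unfolded Q_def]])
  qed
  then obtain N where QN: "\<And>k. Q k (N k)" "\<And>k. N (Suc k) \<subseteq> N k" by metis
  have N: "infinite (N k)" for k using QN(1)[of k] unfolding Q_def by (rule conjunct1)
  have agree: "F n t = F m t" if "t \<in> {-int k..int k}" "n \<in> N k" "m \<in> N k" for k t n m
    by (rule bspec[OF bspec[OF bspec[OF conjunct2[OF QN(1)[unfolded Q_def]] that(1)] that(2)] that(3)])
  have mono: "N l \<subseteq> N k" if "k \<le> l" for k l
    using that QN(2) by (rule lift_Suc_antimono_le[rotated])
  \<comment> \<open>All indices in \<open>N (nat \<bar>t\<bar>)\<close> agree at \<open>t\<close>,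
    so the choice does not matter.\<close>
  define f where "f = (\<lambda>t. F (SOME n. n \<in> N (nat \<bar>t\<bar>)) t)"
  have "N T \<subseteq> {n. \<forall>t\<in>{-int T..int T}. F n t = f t}" for T
  proof clarsimp
    fix n t assume n: "n \<in> N T" and t: "- int T \<le> t" "t \<le> int T"
    have "(SOME n. n \<in> N (nat \<bar>t\<bar>)) \<in> N (nat \<bar>t\<bar>)"
      using N[of "nat \<bar>t\<bar>"] by (simp add: some_in_eq infinite_imp_nonempty)
    moreover have "n \<in> N (nat \<bar>t\<bar>)"
    proof -
      have "nat \<bar>t\<bar> \<le> T" using t by linarith
      then show ?thesis using n mono by blast
    qed
    ultimately show "F n t = f t" unfolding f_def by (intro agree[of t "nat \<bar>t\<bar>"]) auto
  qed
  then have "infinite {n. \<forall>t\<in>{-int T..int T}. F n t = f t}" for T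
    using N infinite_super by blast
  then show ?thesis by (intro exI allI)
qed

text \<open>A cubic graph with a spanning double ray, with the vertices numbered along that double ray;
  \<open>c\<close> maps each vertex to its third neighbour.\<close>

locale chord_line =
  fixes c :: "int \<Rightarrow> int"
  assumes invol: "c (c n) = n" and chord: "c n \<noteq> n" "c n \<noteq> n + 1" "c n \<noteq> n - 1"
begin

definition adj :: "int \<Rightarrow> int \<Rightarrow> bool" where
  "adj m n \<longleftrightarrow> n = m + 1 \<or> n = m - 1 \<or> n = c m"

text \<open>Edge sets are compared, since a shift or a reversal of the numbering changes
  \<open>f\<close> but not the double ray.\<close>

definition rerouted :: "(int \<Rightarrow> int) \<Rightarrow> bool" where
  "rerouted f \<longleftrightarrow> bij f \<and> (\<forall>t. adj (f t) (f (t + 1))) \<and>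
     range (\<lambda>t. {f t, f (t + 1)}) \<noteq> range (\<lambda>t. {t, t + 1})"

lemma symp_adj: "symp adj"
  using invol by (auto simp: symp_def adj_def)

lemma irreflp_adj: "irreflp adj"
  using chord(1)[symmetric] by (auto simp: irreflp_def adj_def)

text \<open>The splice stays a double ray because \<open>ys\<close> keeps both end vertices. Were
  its edges the old ones, they would determine \<open>f\<close> step by step from the left and force
  \<open>ys = [i..j]\<close>.\<close>

lemma rerouted_swap:
  assumes ys: "ham_path adj {i..j} ys" "hd ys = i" "last ys = j" "ys \<noteq> [i..j]" and ij: "i \<le> j"
  shows "\<exists>f. rerouted f"
proof -
  have D: "distinct ys" "set ys = {i..j}" "successively adj ys" using ys by (auto simp: ham_path_def)
  have len: "length ys = nat (j - i + 1)" using D distinct_card[of ys] by simp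
  then have ne: "ys \<noteq> []" using ij by auto
  define f where "f = (\<lambda>t. if i \<le> t \<and> t \<le> j then ys ! nat (t - i) else t)"
  have fout: "f t = t" if "t < i \<or> j < t" for t using that by (auto simp: f_def)
  have fi: "f i = i" using ys(2) ne ij by (simp add: f_def hd_conv_nth)
  have fj: "f j = j"
  proof -
    have "nat (j - i + 1) - 1 = nat (j - i)" using ij by auto
    then show ?thesis using ys(3) ne ij by (simp add: f_def last_conv_nth len)
  qed
  have fin: "f t \<in> {i..j}" if "t \<in> {i..j}" for t
  proof -
    have "nat (t - i) < length ys" using that len by auto
    then show ?thesis using that D(2) nth_mem[of "nat (t - i)" ys] by (auto simp: f_def)
  qed
  have inj: "inj f"
  proof (rule injI)
    fix s t assume eq: "f s = f t"
    show "s = t"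
    proof (cases "s \<in> {i..j}")
      case True
      then have t: "t \<in> {i..j}" using eq fin[of s] fout[of t] by force
      then have "ys ! nat (s - i) = ys ! nat (t - i)" using eq True by (simp add: f_def)
      then have "nat (s - i) = nat (t - i)" using True t D(1) len by (subst (asm) nth_eq_iff_index_eq) auto
      then show ?thesis using True t by auto
    next
      case False
      then have "t \<notin> {i..j}" using eq fin[of t] fout[of s] by force
      then show ?thesis using False eq fout[of s] fout[of t] by force
    qed
  qed
  have surj: "z \<in> range f" for z
  proof (cases "z \<in> {i..j}")
    case True
    then obtain k where k: "k < length ys" "ys ! k = z" using D(2) by (metis in_set_conv_nth)
    then have "f (i + int k) = z" using len by (auto simp: f_def)
    then show ?thesis by (metis rangeI)
  next
    case False
    then show ?thesis using fout[of z] by (metis atLeastAtMost_iff linorder_not_le rangeI)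
  qed
  have adj: "adj (f t) (f (t + 1))" for t
  proof (cases "i \<le> t \<and> t < j")
    case True
    then have "Suc (nat (t - i)) < length ys" using len by auto
    then have "adj (ys ! nat (t - i)) (ys ! Suc (nat (t - i)))" using D(3) by (simp add: successively_nth)
    moreover have "Suc (nat (t - i)) = nat (t + 1 - i)" using True by auto
    ultimately show ?thesis using True by (simp add: f_def)
  next
    case False
    then have "f t = t" "f (t + 1) = t + 1" using fi fj fout
      by (metis linorder_not_le order_le_imp_less_or_eq zless_add1_eq zle_add1_eq_le)+
    then show ?thesis by (simp add: adj_def)
  qed
  have "range (\<lambda>t. {f t, f (t + 1)}) \<noteq> range (\<lambda>t. {t, t + 1})"
  proof
    assume eq: "range (\<lambda>t. {f t, f (t + 1)}) = range (\<lambda>t. {t, t + 1})"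
    \<comment> \<open>The previous value is carried along to rule out a step backwards.\<close>
    have "f (t - 1) = t - 1 \<and> f t = t" if "i \<le> t" for t
      using that
    proof (induction t rule: int_ge_induct)
      case base
      then show ?case using fi fout[of "i - 1"] by simp
    next
      case (step t)
      have IH: "f t = t" "f (t - 1) = t - 1" using step.IH by simp_all
      have "{f t, f (t + 1)} \<in> range (\<lambda>t. {t, t + 1})" using eq by blast
      then obtain s where "{f t, f (t + 1)} = {s, s + 1}" by blast
      then have "t = s \<and> f (t + 1) = s + 1 \<or> t = s + 1 \<and> f (t + 1) = s"
        unfolding IH(1) doubleton_eq_iff .
      then have "f (t + 1) = t + 1 \<or> f (t + 1) = t - 1" by auto
      moreover have "f (t + 1) \<noteq> f (t - 1)" using inj_eq[OF inj, of "t + 1" "t - 1"] by simp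
      ultimately show ?case using IH by auto
    qed
    then have ft: "f t = t" if "i \<le> t" for t using that by simp
    have "ys = [i..j]"
    proof (rule nth_equalityI)
      fix k assume k: "k < length ys"
      then have "i + int k \<le> j" using len by linarith
      then show "ys ! k = [i..j] ! k" using ft[of "i + int k"] by (simp add: f_def nth_upto)
    qed (simp add: len)
    then show False using ys by simp
  qed
  then show ?thesis using inj surj adj by (intro exI[of _ f]) (auto simp: rerouted_def bij_def)
qed

text \<open>\<open>cadj i j\<close> is the graph obtained by contracting the complement of \<open>{i..j}\<close> to the vertex
  \<open>i - 1\<close>.\<close>

definition proj :: "int \<Rightarrow> int \<Rightarrow> int \<Rightarrow> int" where
  "proj i j z = (if z \<in> {i..j} then z else i - 1)"

definition cadj :: "int \<Rightarrow> int \<Rightarrow> int \<Rightarrow> int \<Rightarrow> bool" where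
  "cadj i j u w \<longleftrightarrow> u \<noteq> w \<and> (\<exists>u' w'. proj i j u' = u \<and> proj i j w' = w \<and> adj u' w')"

definition exits :: "int \<Rightarrow> int \<Rightarrow> int \<Rightarrow> bool" where
  "exits i j w \<longleftrightarrow> (\<exists>z. z \<notin> {i..j} \<and> adj w z)"

lemma exits_iff: "exits i j w \<longleftrightarrow> w + 1 \<notin> {i..j} \<or> w - 1 \<notin> {i..j} \<or> c w \<notin> {i..j}"
  unfolding exits_def adj_def by blast

lemma symp_cadj: "symp (cadj i j)"
  using symp_adj by (auto simp: symp_def cadj_def)

lemma irreflp_cadj: "irreflp (cadj i j)"
  by (auto simp: irreflp_def cadj_def)

lemma proj_eq: "v \<in> {i..j} \<Longrightarrow> proj i j z = v \<longleftrightarrow> z = v"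
  by (auto simp: proj_def)

lemma proj_eq': "proj i j z = i - 1 \<longleftrightarrow> z \<notin> {i..j}"
  by (auto simp: proj_def)

lemma cadj_inside: "u \<in> {i..j} \<Longrightarrow> w \<in> {i..j} \<Longrightarrow> cadj i j u w \<longleftrightarrow> adj u w"
  using irreflp_adj by (auto simp: cadj_def proj_eq irreflp_def)

lemma cadj_outside: "w \<in> {i..j} \<Longrightarrow> cadj i j w (i - 1) \<longleftrightarrow> exits i j w"
  by (auto simp: cadj_def proj_eq proj_eq' exits_def)

lemma cadj_nbrs:
  assumes v: "v \<in> {i..j}"
  shows "{w \<in> {i - 1..j}. cadj i j v w} = proj i j ` {v + 1, v - 1, c v}"
proof -
  have "proj i j z \<noteq> v" if "adj v z" for z
    using that irreflpD[OF irreflp_adj, of v] by (auto simp: proj_eq[OF v])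
  moreover have "cadj i j v w \<longleftrightarrow> v \<noteq> w \<and> (\<exists>z. proj i j z = w \<and> adj v z)" for w
    unfolding cadj_def proj_eq[OF v] by simp
  ultimately have "cadj i j v w \<longleftrightarrow> (\<exists>z. adj v z \<and> w = proj i j z)" for w by auto
  moreover have "proj i j z \<in> {i - 1..j}" for z using v by (auto simp: proj_def)
  ultimately have "{w \<in> {i - 1..j}. cadj i j v w} = proj i j ` {z. adj v z}" by blast
  moreover have "{z. adj v z} = {v + 1, v - 1, c v}" by (auto simp: adj_def)
  ultimately show ?thesis by simp
qed

text \<open>The degree drops only if two neighbours both collapse to \<open>i - 1\<close>. Since
  \<open>i < j\<close>, at least one of \<open>v - 1\<close> and \<open>v + 1\<close> stays inside,
  so the only danger is a leaving chord at an end of the segment.\<close>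

lemma card_cadj:
  assumes v: "v \<in> {i..j}" and "i < j" and "c v \<notin> {i..j} \<Longrightarrow> i < v \<and> v < j"
  shows "card {w \<in> {i - 1..j}. cadj i j v w} = 3"
proof -
  have "inj_on (proj i j) {v + 1, v - 1, c v}"
    using assms chord[of v]
    by (cases "c v \<in> {i..j}") (auto simp: inj_on_def proj_def split: if_splits)
  moreover have "card {v + 1, v - 1, c v} = 3" using chord[of v] by auto
  ultimately show ?thesis unfolding cadj_nbrs[OF v] by (simp only: card_image)
qed

lemma ham_path_upto: "i \<le> j \<Longrightarrow> ham_path adj {i..j} [i..j]"
  by (auto simp: ham_path_def successively_conv_nth nth_upto adj_def)

lemma cadj_outside': "w \<in> {i..j} \<Longrightarrow> cadj i j (i - 1) w \<longleftrightarrow> exits i j w"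
  using cadj_outside sympD[OF symp_cadj] by blast

text \<open>The bridge by which parity results about the contracted graph are read as results about
  Hamilton paths of the segment.\<close>

lemma ham_cycles_cadj_Cons:
  assumes "i < j"
  shows "(i - 1) # ys \<in> ham_cycles (cadj i j) {i - 1..j} (i - 1) \<longleftrightarrow>
    ham_path adj {i..j} ys \<and> exits i j (hd ys) \<and> exits i j (last ys)"
proof -
  have V: "{i - 1..j} = insert (i - 1) {i..j}" using assms by auto
  have s: "i - 1 \<notin> set ys \<and> insert (i - 1) (set ys) = {i - 1..j} \<longleftrightarrow> set ys = {i..j}"
    using insert_ident[of "i - 1" "set ys" "{i..j}"] unfolding V by auto
  have "successively (cadj i j) ((i - 1) # ys) \<and> cadj i j (last ((i - 1) # ys)) (i - 1) \<longleftrightarrow>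
      successively adj ys \<and> exits i j (hd ys) \<and> exits i j (last ys)" if ys: "set ys = {i..j}"
  proof -
    have ne: "ys \<noteq> []" using ys assms by auto
    have "successively (cadj i j) ys \<longleftrightarrow> successively adj ys"
      by (rule successively_cong) (use ys cadj_inside in auto)
    moreover have "hd ys \<in> {i..j}" "last ys \<in> {i..j}" using ys ne by auto
    ultimately show ?thesis
      using ne by (simp add: successively_Cons cadj_outside cadj_outside' conj_ac)
  qed
  moreover have "(i - 1) # ys \<in> ham_cycles (cadj i j) {i - 1..j} (i - 1) \<longleftrightarrow>
      distinct ys \<and> (i - 1 \<notin> set ys \<and> insert (i - 1) (set ys) = {i - 1..j}) \<and>
      successively (cadj i j) ((i - 1) # ys) \<and> cadj i j (last ((i - 1) # ys)) (i - 1)"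
    unfolding ham_cycles_def ham_path_def mem_Collect_eq list.sel list.set distinct.simps by argo
  ultimately show ?thesis unfolding s ham_path_def by argo
qed

text \<open>The segment \<open>[i..j]\<close> itself is one of the counted cycles, so an even count
  supplies another, which enters and leaves at the same ends.\<close>

lemma rerouted_if_even:
  assumes "i < j"
    and "even (card {L \<in> ham_cycles (cadj i j) {i - 1..j} (i - 1). L ! 1 = i \<and> last L = j})"
  shows "\<exists>f. rerouted f"
proof -
  let ?H = "{L \<in> ham_cycles (cadj i j) {i - 1..j} (i - 1). L ! 1 = i \<and> last L = j}"
  have fin: "finite ?H"
    by (rule finite_subset[OF _ finite_ham_path[of "{i - 1..j}" "cadj i j"]]) (auto simp: ham_cycles_def)
  have up: "[i..j] = i # [i + 1..j]" using assms(1) by (simp add: upto.simps)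
  have "exits i j i" by (auto simp: exits_def adj_def intro!: exI[of _ "i - 1"])
  moreover have "exits i j j" by (auto simp: exits_def adj_def intro!: exI[of _ "j + 1"])
  moreover have "last [i..j] = j" using assms(1) upto_rec2[of i j] by simp
  ultimately have L0: "(i - 1) # [i..j] \<in> ?H"
    using ham_cycles_cadj_Cons[OF assms(1), of "[i..j]"] ham_path_upto[of i j] assms(1) up by simp
  have "\<exists>L\<in>?H. L \<noteq> (i - 1) # [i..j]"
  proof (rule ccontr)
    assume "\<not> ?thesis"
    then have "?H = {(i - 1) # [i..j]}" using L0 by blast
    then show False using assms(2) by simp
  qed
  then obtain L where L: "L \<in> ?H" "L \<noteq> (i - 1) # [i..j]" by blast
  then have "L \<noteq> []" "hd L = i - 1" using assms(1) by (auto simp: ham_cycles_def ham_path_def)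
  then obtain ys where ys: "L = (i - 1) # ys" by (cases L) auto
  have hp: "ham_path adj {i..j} ys" using L(1) ham_cycles_cadj_Cons[OF assms(1), of ys] unfolding ys by blast
  then have "ys \<noteq> []" using assms(1) by (auto simp: ham_path_def)
  then have "hd ys = i" "last ys = j" using L(1) by (simp_all add: ys hd_conv_nth)
  moreover have "ys \<noteq> [i..j]" using L(2) unfolding ys by blast
  ultimately show ?thesis by (rule rerouted_swap[OF hp _ _ _ less_imp_le[OF assms(1)]])
qed

text \<open>The contracted vertex has degree 2, which is harmless: \<open>even_ham_cycles\<close>
  makes no demand on the degree of its start vertex.\<close>

lemma rerouted_no_exit:
  assumes ij: "i < j" and c: "\<And>m. m \<in> {i..j} \<Longrightarrow> c m \<in> {i..j}"
  shows "\<exists>f. rerouted f"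
proof (rule rerouted_if_even[OF ij])
  have "even (card {L \<in> ham_cycles (cadj i j) {i - 1..j} (i - 1). L ! 1 = i})"
  proof (rule even_ham_cycles)
    fix v assume "v \<in> {i - 1..j}" "v \<noteq> i - 1"
    then have "v \<in> {i..j}" by auto
    then show "odd (card {w \<in> {i - 1..j}. cadj i j v w})" using card_cadj[of v i j] ij c by auto
  qed (use ij symp_cadj irreflp_cadj in auto)
  \<comment> \<open>Without leaving chords, \<open>i\<close> and \<open>j\<close> are the only
    exits, and \<open>i\<close> is already taken by the start.\<close>
  moreover have "last L = j" if L: "L \<in> ham_cycles (cadj i j) {i - 1..j} (i - 1)" "L ! 1 = i" for L
  proof -
    have "3 \<le> card {i - 1..j}" using ij by simp
    note D = ham_cyclesD[OF L(1) this]
    obtain M z where z: "L = (i - 1) # i # M @ [z]" "last L = z" using D(5) L(2) by fastforce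
    have "z \<in> set L" "z \<noteq> i - 1" "z \<noteq> i" using D(1) unfolding z(1) by auto
    then have zz: "z \<in> {i..j}" "z \<noteq> i" unfolding D(2) by auto
    moreover have "exits i j z" using D(4) cadj_outside[OF zz(1)] z(2) by simp
    ultimately show ?thesis using z c[of z] by (auto simp: exits_def adj_def)
  qed
  then have "{L \<in> ham_cycles (cadj i j) {i - 1..j} (i - 1). L ! 1 = i \<and> last L = j} =
      {L \<in> ham_cycles (cadj i j) {i - 1..j} (i - 1). L ! 1 = i}" by blast
  ultimately show "even (card {L \<in> ham_cycles (cadj i j) {i - 1..j} (i - 1). L ! 1 = i \<and> last L = j})"
    by (simp only:)
qed

text \<open>If every Hamilton cycle of the contracted graph avoided the chord at \<open>v\<close>,
  then \<open>even_ham_cycles_avoiding\<close> would make the segment reroutable. So some cycle uses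
  the chord; cut at the contracted vertex, it becomes a path numbered to cross the chord from time 0
  to time 1.\<close>

lemma exit_path:
  assumes m: "i < m" "m < j" "c m \<notin> {i..j}"
    and only: "\<forall>u\<in>{i..j}. c u \<notin> {i..j} \<longrightarrow> u = m"
    and v: "v \<in> {i..j}" "c v \<in> {i..j}" and no: "\<nexists>f. rerouted f"
  obtains f :: "int \<Rightarrow> int" and a b where "a \<le> 0" "1 \<le> b" "bij_betw f {a..b} {i..j}"
    "\<And>t. a \<le> t \<Longrightarrow> t < b \<Longrightarrow> adj (f t) (f (t + 1))" "f 0 = v" "f 1 = c v"
    "exits i j (f a)" "exits i j (f b)"
proof -
  let ?V = "{i - 1..j}" and ?E = "cadj i j"
  have one: "u = m" if "u \<in> {i..j}" "c u \<notin> {i..j}" for u using only that by blast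
  have ij: "i < j" using m by simp
  have card3: "3 \<le> card ?V" using m by simp
  have *: "exits i j w \<longleftrightarrow> w \<in> {i, j, m}" if "w \<in> {i..j}" for w
    using that m one[OF that] exits_iff[of i j w] by auto
  \<comment> \<open>With exactly one leaving chord, at an inner vertex \<open>m\<close>, the
    contracted graph is cubic at the contracted vertex too.\<close>
  have x: "{w \<in> ?V. ?E (i - 1) w} = {i, j, m}"
  proof (intro set_eqI)
    fix w
    show "w \<in> {w \<in> ?V. ?E (i - 1) w} \<longleftrightarrow> w \<in> {i, j, m}"
    proof (cases "w = i - 1")
      case True
      then show ?thesis using irreflpD[OF irreflp_cadj] m by auto
    next
      case False
      then have "w \<in> ?V \<longleftrightarrow> w \<in> {i..j}" by auto
      then show ?thesis using * cadj_outside' m by auto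
    qed
  qed
  have "\<exists>L\<in>ham_cycles ?E ?V v. L ! 1 = c v"
  proof (rule ccontr)
    assume *: "\<not> ?thesis"
    have "even (card {L \<in> ham_cycles ?E ?V (i - 1). L ! 1 = i \<and> last L = j})"
    proof (rule even_ham_cycles_avoiding[where c = m and v = v and r = "c v"])
      show "card {w \<in> ?V. ?E u w} = 3" if "u \<in> ?V" for u
      proof (cases "u = i - 1")
        case True
        have "card {i, j, m} = 3" using m by simp
        then show ?thesis unfolding True x .
      next
        case False
        then have "u \<in> {i..j}" using that by auto
        then show ?thesis using one[of u] m by (intro card_cadj) auto
      qed
      show "?E v (c v)" using v cadj_inside by (simp add: adj_def)
    qed (use * x m v symp_cadj irreflp_cadj card3 in auto)
    then show False using rerouted_if_even[OF ij] no by blast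
  qed
  then obtain L where L: "L \<in> ham_cycles ?E ?V v" "L ! 1 = c v" by blast
  note D = ham_cyclesD[OF L(1) card3]
  have iV: "i - 1 \<in> ?V" using ij by simp
  obtain A B where AB: "L = A @ (i - 1) # B" "i - 1 \<notin> set A"
    using split_list_first[of "i - 1" L] D(2) iV by auto
  obtain M z where Lv: "L = v # c v # M @ [z]" using D(5) L(2) by fastforce
  obtain A' where A': "A = v # c v # A'"
  proof -
    have "v \<noteq> i - 1" "c v \<noteq> i - 1" using v by auto
    then show ?thesis using AB Lv that by (cases A; cases "tl A") auto
  qed
  define ys where "ys = B @ A"
  have "(i - 1) # ys \<in> ham_cycles ?E ?V (i - 1)"
    using ham_cycles_rotate[OF L(1) iV card3] AB by (simp add: takeWhile_split dropWhile_split ys_def)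
  then have ys: "ham_path adj {i..j} ys" "exits i j (hd ys)" "exits i j (last ys)"
    using ham_cycles_cadj_Cons[OF ij] by blast+
  then have Y: "distinct ys" "set ys = {i..j}" "successively adj ys" by (auto simp: ham_path_def)
  \<comment> \<open>\<open>B\<close> precedes \<open>v\<close> in \<open>ys\<close>, so shifting by
    its length puts \<open>v\<close> at 0 and \<open>c v\<close> at 1.\<close>
  define q where "q = int (length B)"
  define f where "f = (\<lambda>t. ys ! nat (t + q))"
  define b where "b = int (length ys) - 1 - q"
  have ne: "ys \<noteq> []" by (simp add: ys_def A')
  have "bij_betw f {-q..b} {i..j}"
  proof (rule bij_betw_imageI)
    show "inj_on f {-q..b}"
    proof (rule inj_onI)
      fix s t assume st: "s \<in> {-q..b}" "t \<in> {-q..b}" "f s = f t"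
      then have "nat (s + q) = nat (t + q)"
        using nth_eq_iff_index_eq[OF Y(1), of "nat (s + q)" "nat (t + q)"] by (auto simp: f_def b_def)
      then show "s = t" using st by auto
    qed
    show "f ` {-q..b} = {i..j}"
    proof
      show "f ` {-q..b} \<subseteq> {i..j}"
      proof
        fix w assume "w \<in> f ` {-q..b}"
        then obtain t where "w = ys ! nat (t + q)" "t \<in> {-q..b}" by (auto simp: f_def)
        then show "w \<in> {i..j}" using nth_mem[of "nat (t + q)" ys] unfolding Y(2) by (auto simp: b_def)
      qed
      show "{i..j} \<subseteq> f ` {-q..b}"
      proof
        fix w assume "w \<in> {i..j}"
        then obtain k where "k < length ys" "ys ! k = w" using Y(2) by (metis in_set_conv_nth)
        then show "w \<in> f ` {-q..b}"
          by (intro image_eqI[of _ _ "int k - q"]) (auto simp: f_def b_def)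
      qed
    qed
  qed
  moreover have "adj (f t) (f (t + 1))" if "-q \<le> t" "t < b" for t
  proof -
    have "Suc (nat (t + q)) = nat (t + 1 + q)" using that by auto
    moreover have "Suc (nat (t + q)) < length ys" using that by (auto simp: b_def)
    ultimately show ?thesis using successively_nth[OF Y(3)] unfolding f_def by metis
  qed
  moreover have "f 0 = v" "f 1 = c v"
    by (auto simp: f_def q_def ys_def A' nth_append nat_add_distrib)
  moreover have "f (-q) = hd ys" "f b = last ys"
  proof -
    have "nat (int (length ys) - 1) = length ys - 1" by simp
    then show "f (-q) = hd ys" "f b = last ys"
      using ne by (simp_all add: f_def b_def hd_conv_nth last_conv_nth)
  qed
  moreover have "1 \<le> b" "-q \<le> 0" by (auto simp: b_def q_def ys_def A')
  ultimately show thesis using ys(2,3) by (intro that[of "- q" b f]) simp_all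
qed

text \<open>If no finite segment can be rerouted, the Hamilton paths through the chord at \<open>0\<close> have a
  spanning double ray as a limit.\<close>

theorem rerouted_exists:
  assumes good: "\<And>N. \<exists>i j. i \<le> - N \<and> N \<le> j \<and> card {m \<in> {i..j}. c m \<notin> {i..j}} \<le> 1"
  shows "\<exists>f. rerouted f"
proof (rule ccontr)
  assume no: "\<nexists>f. rerouted f"
  define W where "W = (\<lambda>N i j (f :: int \<Rightarrow> int) a b. i \<le> - N \<and> N \<le> j \<and> card {m \<in> {i..j}. c m \<notin> {i..j}} \<le> 1 \<and>
      a \<le> 0 \<and> 1 \<le> b \<and> bij_betw f {a..b} {i..j} \<and>
      (\<forall>t. a \<le> t \<longrightarrow> t < b \<longrightarrow> adj (f t) (f (t + 1))) \<and> f 0 = 0 \<and> f 1 = c 0 \<and>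
      exits i j (f a) \<and> exits i j (f b))"
  have "\<exists>i j f a b. W N i j f a b" for N
  proof -
    \<comment> \<open>The enlarged bound puts \<open>0\<close> and \<open>c 0\<close> inside; the 2
      keeps a segment of at least two vertices after an end is cut off.\<close>
    obtain i j where ij: "i \<le> - (max N (\<bar>c 0\<bar> + 2))" "max N (\<bar>c 0\<bar> + 2) \<le> j"
      and card: "card {m \<in> {i..j}. c m \<notin> {i..j}} \<le> 1" using good by blast
    have "2 \<le> max N (\<bar>c 0\<bar> + 2)" "N \<le> max N (\<bar>c 0\<bar> + 2)" "\<bar>c 0\<bar> \<le> max N (\<bar>c 0\<bar> + 2)"
      by linarith+
    then have lt: "i + 1 < j - 1" and in_ij: "0 \<in> {i..j}" "c 0 \<in> {i..j}" "i \<le> - N" "N \<le> j"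
      using ij unfolding atLeastAtMost_iff by linarith+
    let ?M = "{m \<in> {i..j}. c m \<notin> {i..j}}"
    have fin: "finite ?M" by (rule finite_subset[of _ "{i..j}"]) auto
    have "?M \<noteq> {}" using rerouted_no_exit[of i j] lt no by auto
    then have "card ?M = 1" using card fin by (metis card_0_eq le_antisym less_one not_le)
    then obtain m where "?M = {m}" by (auto simp: card_1_singleton_iff)
    then have m: "m \<in> {i..j}" "c m \<notin> {i..j}"
      and one: "\<And>u. u \<in> {i..j} \<Longrightarrow> c u \<notin> {i..j} \<Longrightarrow> u = m" by blast+
    \<comment> \<open>Were the leaving chord at the end \<open>i\<close>, dropping \<open>i\<close>
      would give a segment with no leaving chord: the partner of \<open>i\<close> is outside, so no
      inner chord leads to \<open>i\<close>.\<close>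
    have "m \<noteq> i"
    proof
      assume "m = i"
      have "c u \<in> {i + 1..j}" if u: "u \<in> {i + 1..j}" for u
      proof -
        have "c u \<in> {i..j}" using one[of u] u \<open>m = i\<close> by auto
        moreover have "c u \<noteq> i" using m(2) \<open>m = i\<close> u invol[of u] by auto
        ultimately show ?thesis by auto
      qed
      then show False using rerouted_no_exit[of "i + 1" j] lt no by auto
    qed
    moreover have "m \<noteq> j"
    proof
      assume "m = j"
      have "c u \<in> {i..j - 1}" if u: "u \<in> {i..j - 1}" for u
      proof -
        have "c u \<in> {i..j}" using one[of u] u \<open>m = j\<close> by auto
        moreover have "c u \<noteq> j" using m(2) \<open>m = j\<close> u invol[of u] by auto
        ultimately show ?thesis by auto
      qed
      then show False using rerouted_no_exit[of i "j - 1"] lt no by auto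
    qed
    ultimately have "i < m" "m < j" using m(1) by auto
    moreover have "\<forall>u\<in>{i..j}. c u \<notin> {i..j} \<longrightarrow> u = m" using one by blast
    ultimately obtain f :: "int \<Rightarrow> int" and a b where "a \<le> 0" "1 \<le> b" "bij_betw f {a..b} {i..j}"
      "\<And>t. a \<le> t \<Longrightarrow> t < b \<Longrightarrow> adj (f t) (f (t + 1))" "f 0 = 0" "f 1 = c 0"
      "exits i j (f a)" "exits i j (f b)"
      by (rule exit_path[OF _ _ m(2) _ in_ij(1,2) no]) (rule that)
    then have "W N i j f a b" using card in_ij(3,4) unfolding W_def by simp
    then show ?thesis by blast
  qed
  then have "\<forall>n::nat. \<exists>i j f a b. W (int n) i j f a b" by blast
  then obtain i j F a b where W: "\<And>n. W (int n) (i n) (j n) (F n) (a n) (b n)" by metis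
  have ij: "i n \<le> - int n" "int n \<le> j n" and card: "card {m \<in> {i n..j n}. c m \<notin> {i n..j n}} \<le> 1"
    and ab: "a n \<le> 0" "1 \<le> b n" and bij: "bij_betw (F n) {a n..b n} {i n..j n}"
    and step: "\<And>t. a n \<le> t \<Longrightarrow> t < b n \<Longrightarrow> adj (F n t) (F n (t + 1))"
    and F01: "F n 0 = 0" "F n 1 = c 0"
    and ex: "exits (i n) (j n) (F n (a n))" "exits (i n) (j n) (F n (b n))" for n
    using W[of n] unfolding W_def by blast+
  have inj: "inj_on (F n) {a n..b n}" for n using bij by (rule bij_betw_imp_inj_on)
  have nbrs: "{w. adj u w} = {u + 1, u - 1, c u}" for u by (auto simp: adj_def)
  \<comment> \<open>The ball of radius \<open>k\<close> around 0. A path at 0 at time 0 is within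
    distance \<bar>t\<bar> at time \<open>t\<close>, which gives the finite ranges needed for the
    limit.\<close>
  define ball where "ball = (\<lambda>k. ((\<lambda>X. X \<union> (\<Union>u\<in>X. {w. adj u w})) ^^ k) {0})"
  have ball_Suc: "ball (Suc k) = ball k \<union> (\<Union>u\<in>ball k. {w. adj u w})" for k by (simp add: ball_def)
  have fin_ball: "finite (ball k)" for k
  proof (induction k)
    case 0
    then show ?case by (simp add: ball_def)
  next
    case (Suc k)
    then show ?case by (simp add: ball_Suc nbrs)
  qed
  have ball_mono: "ball k \<subseteq> ball l" if "k \<le> l" for k l
    using that by (rule lift_Suc_mono_le[rotated]) (simp add: ball_Suc)
  have zero: "0 \<in> ball k" for k using ball_mono[of 0 k] by (auto simp: ball_def)
  have pos: "F n (int k) \<in> ball k" if "int k \<le> b n" for n k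
    using that
  proof (induction k)
    case (Suc k)
    then have "adj (F n (int k)) (F n (int k + 1))" using step ab(1)[of n] by auto
    then show ?case using Suc by (auto simp: ball_Suc add.commute)
  qed (simp add: F01 zero)
  have neg: "F n (- int k) \<in> ball k" if "a n \<le> - int k" for n k
    using that
  proof (induction k)
    case (Suc k)
    then have "adj (F n (- 1 - int k)) (F n (- int k))" using step[of n "- 1 - int k"] ab(2)[of n] by auto
    then have "adj (F n (- int k)) (F n (- 1 - int k))" by (rule sympD[OF symp_adj])
    then show ?case using Suc by (auto simp: ball_Suc)
  qed (simp add: F01 zero)
  have F_ball: "F n t \<in> ball (nat \<bar>t\<bar>)" if "t \<in> {a n..b n}" for n t
    using that pos[of "nat t" n] neg[of n "nat (- t)"] by (cases "0 \<le> t") auto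
  \<comment> \<open>The segments exhaust all integers, so a finite set together with its neighbours
    is eventually swallowed.\<close>
  have wide: "\<exists>M. \<forall>n\<ge>M. \<forall>u\<in>X. \<not> exits (i n) (j n) u" if X: "finite X" for X
  proof -
    have "finite (\<Union>u\<in>X. {w. adj u w})" using X by (simp add: nbrs)
    then have "finite (nat ` abs ` (\<Union>u\<in>X. {w. adj u w}))" by blast
    then obtain M where M: "\<And>k. k \<in> nat ` abs ` (\<Union>u\<in>X. {w. adj u w}) \<Longrightarrow> k \<le> M"
      by (meson finite_nat_set_iff_bounded_le)
    have "\<not> exits (i n) (j n) u" if "M \<le> n" "u \<in> X" for n u
    proof -
      have "w \<in> {i n..j n}" if "adj u w" for w
      proof -
        have "nat \<bar>w\<bar> \<le> M" using M that \<open>u \<in> X\<close> by blast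
        then show ?thesis using ij[of n] \<open>M \<le> n\<close> by auto
      qed
      then show ?thesis by (auto simp: exits_def)
    qed
    then show ?thesis by blast
  qed
  \<comment> \<open>The default 0 lies in every ball; by the next step it never shows up in the
    windows chosen for the limit.\<close>
  define F' where "F' = (\<lambda>n t. if t \<in> {a n..b n} then F n t else 0)"
  have "F' n t \<in> ball (nat \<bar>t\<bar>)" for n t using F_ball zero by (simp add: F'_def)
  from pointwise_limit[of "\<lambda>t. ball (nat \<bar>t\<bar>)" F', OF fin_ball this]
  obtain f where f: "\<And>T. infinite {n. \<forall>t\<in>{-int T..int T}. F' n t = f t}" by blast
  \<comment> \<open>The finite paths start and stop at exits. Exits eventually leave every ball, so
    the time intervals grow beyond any window.\<close>
  have key: "\<exists>n\<ge>M. a n < - int T \<and> int T < b n \<and> (\<forall>t\<in>{-int T..int T}. F n t = f t)" for M T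
  proof -
    obtain M' where M': "\<And>n u. M' \<le> n \<Longrightarrow> u \<in> ball T \<Longrightarrow> \<not> exits (i n) (j n) u"
      using wide[OF fin_ball[of T]] by blast
    obtain n where n: "max M M' \<le> n" "\<forall>t\<in>{-int T..int T}. F' n t = f t"
      using f[of T] unfolding infinite_nat_iff_unbounded_le by blast
    have a: "a n < - int T"
    proof (rule ccontr)
      assume "\<not> ?thesis"
      then have "nat \<bar>a n\<bar> \<le> T" using ab[of n] by linarith
      moreover have "F n (a n) \<in> ball (nat \<bar>a n\<bar>)" using F_ball[of "a n" n] ab[of n] by simp
      ultimately have "F n (a n) \<in> ball T" using ball_mono by blast
      then show False using M'[of n "F n (a n)"] n(1) ex(1)[of n] by simp
    qed
    have b: "int T < b n"
    proof (rule ccontr)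
      assume "\<not> ?thesis"
      then have "nat \<bar>b n\<bar> \<le> T" using ab[of n] by linarith
      moreover have "F n (b n) \<in> ball (nat \<bar>b n\<bar>)" using F_ball[of "b n" n] ab[of n] by simp
      ultimately have "F n (b n) \<in> ball T" using ball_mono by blast
      then show False using M'[of n "F n (b n)"] n(1) ex(2)[of n] by simp
    qed
    show ?thesis using n a b by (intro exI[of _ n]) (auto simp: F'_def)
  qed
  have inj_f: "inj f"
  proof (rule injI)
    fix s t assume st: "f s = f t"
    define T where "T = nat (\<bar>s\<bar> + \<bar>t\<bar>)"
    then have T: "s \<in> {-int T..int T}" "t \<in> {-int T..int T}" by auto
    obtain n where n: "a n < - int T" "int T < b n" "\<forall>t\<in>{-int T..int T}. F n t = f t"
      using key[of 0 T] by blast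
    then have "F n s = F n t" using st T by simp
    then show "s = t" using inj_onD[OF inj[of n]] n(1,2) T by simp
  qed
  \<comment> \<open>Take a segment \<open>?I\<close> around 0 and \<open>z\<close> with at most
    three boundary edges. For large \<open>n\<close> the path starts and ends outside
    \<open>?I\<close>, so it stays in \<open>?I\<close> between its visits to 0 and
    \<open>z\<close>; by injectivity the time of \<open>z\<close> is then bounded by
    \<open>card ?I\<close>, independently of \<open>n\<close>.\<close>
  have onto: "z \<in> range f" for z
  proof -
    define k where "k = nat \<bar>z\<bar>"
    let ?I = "{i k..j k}"
    have in_I: "0 \<in> ?I" "z \<in> ?I" using ij[of k] by (auto simp: k_def)
    let ?X = "{(u, w). u \<in> ?I \<and> w \<notin> ?I \<and> adj u w}"
    let ?Y = "(\<lambda>m. (m, c m)) ` {m \<in> ?I. c m \<notin> ?I}"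
    have sub: "?X \<subseteq> {(i k, i k - 1), (j k, j k + 1)} \<union> ?Y" by (auto simp: adj_def)
    have fin_M: "finite {m \<in> ?I. c m \<notin> ?I}" by (rule finite_subset[of _ ?I]) auto
    then have fin_Y: "finite ?Y" by (rule finite_imageI)
    have fin: "finite ?X"
      by (rule finite_subset[OF sub]) (simp only: finite_Un finite_insert finite.emptyI fin_Y simp_thms)
    have "card ?X \<le> card ({(i k, i k - 1), (j k, j k + 1)} \<union> ?Y)"
      using sub fin_Y by (intro card_mono) simp_all
    also have "\<dots> \<le> card {(i k, i k - 1), (j k, j k + 1)} + card ?Y" by (rule card_Un_le)
    \<comment> \<open>Two edges of the line at the ends of the segment, plus at most one
      chord.\<close>
    also have "\<dots> \<le> 2 + 1"
      using order_trans[OF card_image_le[OF fin_M, of "\<lambda>m. (m, c m)"] card[of k]]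
      by (intro add_mono) (simp_all add: card_insert_if)
    finally have card_X: "card ?X \<le> 3" by simp
    define T where "T = card ?I"
    obtain M where M: "\<And>n u. M \<le> n \<Longrightarrow> u \<in> ?I \<Longrightarrow> \<not> exits (i n) (j n) u"
      using wide[of ?I] by blast
    obtain n where n: "M + k \<le> n" "\<forall>t\<in>{-int T..int T}. F n t = f t" using key[of "M + k" T] by blast
    have "\<bar>z\<bar> \<le> int n" using n(1) by (simp add: k_def)
    then have "z \<in> {i n..j n}" using ij[of n] by (simp add: abs_le_iff)
    then have "z \<in> F n ` {a n..b n}" unfolding bij_betw_imp_surj_on[OF bij] .
    then obtain t where t: "t \<in> {a n..b n}" "F n t = z" by (elim imageE) simp
    have "F n (a n) \<notin> ?I" "F n (b n) \<notin> ?I"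
      using M[of n "F n (a n)"] M[of n "F n (b n)"] n(1) ex[of n] by auto
    note conv = convex_of_small_boundary[OF inj this step symp_adj fin card_X]
    have "F n q \<in> ?I" if "q \<in> {min 0 t..max 0 t}" for q
    proof (cases "0 \<le> t")
      case True
      show ?thesis by (rule conv[of 0 t]) (use True that t in_I F01[of n] ab[of n] in simp_all)
    next
      case False
      show ?thesis by (rule conv[of t 0]) (use False that t in_I F01[of n] ab[of n] in simp_all)
    qed
    then have "F n ` {min 0 t..max 0 t} \<subseteq> ?I" by blast
    moreover have "inj_on (F n) {min 0 t..max 0 t}" using inj by (rule inj_on_subset) (use t ab[of n] in auto)
    ultimately have "card {min 0 t..max 0 t} \<le> T" unfolding T_def by (metis card_inj_on_le finite_atLeastAtMost_int)
    then have "t \<in> {-int T..int T}" by (cases "0 \<le> t") auto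
    then have "f t = z" using n(2) t(2) by simp
    then show ?thesis by blast
  qed
  have "adj (f t) (f (t + 1))" for t
  proof -
    define T where "T = nat (\<bar>t\<bar> + 1)"
    then have T: "t \<in> {-int T..int T}" "t + 1 \<in> {-int T..int T}" by auto
    obtain n where n: "a n < - int T" "int T < b n" "\<forall>t\<in>{-int T..int T}. F n t = f t"
      using key[of 0 T] by blast
    then have "adj (F n t) (F n (t + 1))" using T by (intro step) simp_all
    then show ?thesis using n(3) T by simp
  qed
  \<comment> \<open>The prescribed chord \<open>{0, c 0}\<close> lies on the limit, but no chord is
    an edge of the original line.\<close>
  moreover have "range (\<lambda>t. {f t, f (t + 1)}) \<noteq> range (\<lambda>t. {t, t + 1})"
  proof -
    obtain n where "\<forall>t\<in>{-int 1..int 1}. F n t = f t" using key[of 0 1] by blast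
    then have f01: "f 0 = 0" "f 1 = c 0" using F01[of n] by auto
    have "{0, c 0} \<noteq> {t, t + 1}" for t using chord[of 0] by (auto simp: doubleton_eq_iff)
    then have notin: "{0, c 0} \<notin> range (\<lambda>t. {t, t + 1})" by (simp add: image_iff)
    show ?thesis
    proof
      assume eq: "range (\<lambda>t. {f t, f (t + 1)}) = range (\<lambda>t. {t, t + 1})"
      have "{0, c 0} \<in> range (\<lambda>t. {f t, f (t + 1)})" using f01 by (intro range_eqI[of _ _ 0]) simp
      then show False using notin unfolding eq by (rule notE[rotated])
    qed
  qed
  moreover have "surj f" using onto by blast
  moreover note inj_f
  ultimately have "rerouted f" unfolding rerouted_def bij_def by (intro conjI allI)
  then show False using no by blast
qed

end

section \<open>Small edge cuts from the end degree\<close>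

text \<open>Koenig's lemma for a directed relation. Only steps that increase the distance
  \<open>d\<close> from \<open>A\<close> are taken, so the ray is injective and never returns to
  \<open>A\<close>.\<close>

lemma geodesic_ray_exists:
  fixes R :: "'b \<Rightarrow> 'b \<Rightarrow> bool"
  assumes A: "finite A" and fin: "\<And>u. finite {w. R u w}" and inf: "infinite {v. \<exists>a\<in>A. R\<^sup>*\<^sup>* a v}"
  obtains p :: "nat \<Rightarrow> 'b" where "p 0 \<in> A" "\<And>n. R (p n) (p (Suc n))" "inj p" "\<And>n. p (Suc n) \<notin> A"
proof -
  define L where "L = (\<lambda>n. {v. \<exists>a\<in>A. (R ^^ n) a v})"
  define d where "d = (\<lambda>v. LEAST n. v \<in> L n)"
  have d_le: "d v \<le> n" if "v \<in> L n" for v n unfolding d_def by (rule Least_le) (rule that)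
  have L_d: "v \<in> L (d v)" if "v \<in> L n" for v n unfolding d_def by (rule LeastI) (rule that)
  have L_Suc: "w \<in> L (Suc n)" if "v \<in> L n" "R v w" for v w n using that by (auto simp: L_def)
  have d0: "d a = 0" if "a \<in> A" for a
    using d_le[of a 0] that by (auto simp: L_def)
  define R' where "R' = (\<lambda>u w. R u w \<and> d w = Suc (d u))"
  define D where "D = (\<lambda>u. {w. R'\<^sup>*\<^sup>* u w})"
  \<comment> \<open>On a shortest walk from \<open>A\<close> the distance grows by one at each step,
    so increasing steps already reach everything; since \<open>A\<close> is finite, one start has
    infinitely many descendants.\<close>
  have reach: "\<exists>a\<in>A. v \<in> D a" if "v \<in> L n" "d v = n" for v n
    using that
  proof (induction n arbitrary: v)
    case 0
    then have "v \<in> A" by (auto simp: L_def)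
    then show ?case by (auto simp: D_def)
  next
    case (Suc n)
    then obtain u where u: "u \<in> L n" "R u v" by (auto simp: L_def)
    have "d v \<le> Suc (d u)" using d_le[OF L_Suc[OF L_d[OF u(1)] u(2)]] .
    then have du: "d u = n" using d_le[OF u(1)] Suc.prems(2) by simp
    then obtain a where a: "a \<in> A" "R'\<^sup>*\<^sup>* a u" using Suc.IH[OF u(1)] by (auto simp: D_def)
    have "R' u v" using u(2) du Suc.prems(2) by (simp add: R'_def)
    then have "R'\<^sup>*\<^sup>* a v" using a(2) by simp
    then show ?case using a(1) by (auto simp: D_def)
  qed
  have "{v. \<exists>a\<in>A. R\<^sup>*\<^sup>* a v} \<subseteq> (\<Union>a\<in>A. D a)"
  proof
    fix v assume "v \<in> {v. \<exists>a\<in>A. R\<^sup>*\<^sup>* a v}"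
    then obtain n where "v \<in> L n" by (auto simp: L_def rtranclp_power)
    then show "v \<in> (\<Union>a\<in>A. D a)" using reach[OF L_d] by blast
  qed
  then have "infinite (\<Union>a\<in>A. D a)" using inf infinite_super by blast
  then obtain a0 where a0: "a0 \<in> A" "infinite (D a0)" using A by blast
  have step: "\<exists>w. infinite (D w) \<and> R' u w" if "infinite (D u)" for u
  proof (rule ccontr)
    assume no: "\<not> ?thesis"
    have "D u \<subseteq> insert u (\<Union>w\<in>{w. R' u w}. D w)"
    proof
      fix v assume "v \<in> D u"
      then have "R'\<^sup>*\<^sup>* u v" by (simp add: D_def)
      then show "v \<in> insert u (\<Union>w\<in>{w. R' u w}. D w)"
        by (cases rule: converse_rtranclpE) (auto simp: D_def)
    qed
    moreover have "finite {w. R' u w}"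
      by (rule finite_subset[OF _ fin[of u]]) (auto simp: R'_def)
    then have "finite (insert u (\<Union>w\<in>{w. R' u w}. D w))" using no by blast
    ultimately show False using that finite_subset by blast
  qed
  have "\<exists>p. \<forall>n. (infinite (D (p n)) \<and> (n = 0 \<longrightarrow> p n \<in> A)) \<and> R' (p n) (p (Suc n))"
  proof (rule dependent_nat_choice)
    show "\<exists>x. infinite (D x) \<and> (0 = (0::nat) \<longrightarrow> x \<in> A)" using a0 by blast
    fix x and n :: nat assume "infinite (D x) \<and> (n = 0 \<longrightarrow> x \<in> A)"
    then obtain w where "infinite (D w)" "R' x w" using step by blast
    then show "\<exists>y. (infinite (D y) \<and> (Suc n = 0 \<longrightarrow> y \<in> A)) \<and> R' x y" by simp blast
  qed
  then obtain p where p: "p 0 \<in> A" "\<And>n. R' (p n) (p (Suc n))" by blast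
  have dp: "d (p n) = n" for n
  proof (induction n)
    case (Suc n)
    then show ?case using p(2)[of n] by (simp add: R'_def)
  qed (rule d0[OF p(1)])
  show ?thesis
  proof (rule that[of p])
    show "R (p n) (p (Suc n))" for n using p(2)[of n] by (simp add: R'_def)
    show "inj p" by (rule inj_on_inverseI[where g = d]) (rule dp)
    show "p (Suc n) \<notin> A" for n using d0[of "p (Suc n)"] dp[of "Suc n"] by auto
  qed (rule p(1))
qed

section \<open>Neighbourhoods, edge boundaries and unit flows to infinity\<close>

locale cubic_graph =
  fixes G :: "'a graph"
  assumes simple: "simple_graph G" and cubic: "cubic G"
begin

definition nbrs :: "'a \<Rightarrow> 'a set" where
  "nbrs v = {w. {v, w} \<in> edges G}"

lemma nbrsD: assumes "w \<in> nbrs v" shows "v \<in> verts G" "w \<in> verts G" "v \<noteq> w" "v \<in> nbrs w"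
proof -
  have e: "{v, w} \<in> edges G" using assms by (simp add: nbrs_def)
  then obtain a b where ab: "a \<in> verts G" "b \<in> verts G" "a \<noteq> b" "{v, w} = {a, b}"
    using simple unfolding simple_graph_def by blast
  then have "v = a \<and> w = b \<or> v = b \<and> w = a" by (simp add: doubleton_eq_iff)
  then show "v \<in> verts G" "w \<in> verts G" "v \<noteq> w" using ab by auto
  show "v \<in> nbrs w" using e by (simp add: nbrs_def insert_commute)
qed

lemma card_nbrs: "v \<in> verts G \<Longrightarrow> card (nbrs v) = 3"
proof -
  assume v: "v \<in> verts G"
  have "bij_betw (\<lambda>w. {v, w}) (nbrs v) {e \<in> edges G. v \<in> e}"
  proof (rule bij_betw_imageI)
    show "inj_on (\<lambda>w. {v, w}) (nbrs v)" by (auto simp: inj_on_def doubleton_eq_iff)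
    show "(\<lambda>w. {v, w}) ` nbrs v = {e \<in> edges G. v \<in> e}"
    proof
      show "{e \<in> edges G. v \<in> e} \<subseteq> (\<lambda>w. {v, w}) ` nbrs v"
      proof
        fix e assume e: "e \<in> {e \<in> edges G. v \<in> e}"
        then obtain a b where ab: "e = {a, b}" using simple unfolding simple_graph_def by blast
        then have "e = {v, a} \<or> e = {v, b}" using e by auto
        then show "e \<in> (\<lambda>w. {v, w}) ` nbrs v" using e by (auto simp: nbrs_def)
      qed
    qed (auto simp: nbrs_def)
  qed
  then have "card (nbrs v) = vertex_degree G v" by (simp add: vertex_degree_def bij_betw_same_card)
  then show ?thesis using cubic v by (simp add: cubic_def)
qed

lemma finite_nbrs: "finite (nbrs v)"
proof (cases "v \<in> verts G")
  case True
  then show ?thesis by (intro card_ge_0_finite) (simp add: card_nbrs)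
next
  case False
  then have "nbrs v = {}" using nbrsD(1) by blast
  then show ?thesis by simp
qed

text \<open>Pairs are oriented outwards, so each boundary edge is counted once.\<close>

definition boundary :: "'a set \<Rightarrow> ('a \<times> 'a) set" where
  "boundary S = {(u, w). u \<in> S \<and> w \<notin> S \<and> w \<in> nbrs u}"

lemma boundary_Sigma: "boundary S = Sigma S (\<lambda>u. nbrs u - S)"
  by (auto simp: boundary_def)

lemma finite_boundary: "finite S \<Longrightarrow> finite (boundary S)"
  by (simp add: boundary_Sigma finite_nbrs)

text \<open>An integral flow with unit capacities and source set \<open>A\<close>, without sinks.
  Antisymmetry and the upper bound 1 confine the values to -1, 0 and 1; nothing flows into
  \<open>A\<close>.\<close>

definition flow :: "'a set \<Rightarrow> ('a \<Rightarrow> 'a \<Rightarrow> int) \<Rightarrow> bool" where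
  "flow A f \<longleftrightarrow> (\<forall>u v. f u v = - f v u) \<and> (\<forall>u v. v \<notin> nbrs u \<longrightarrow> f u v = 0) \<and> (\<forall>u v. f u v \<le> 1) \<and>
     (\<forall>u v. v \<in> A \<longrightarrow> f u v \<le> 0) \<and> (\<forall>v. v \<notin> A \<longrightarrow> (\<Sum>w\<in>nbrs v. f v w) = 0)"

lemma flowD:
  assumes "flow A f"
  shows "f u v = - f v u" "v \<notin> nbrs u \<Longrightarrow> f u v = 0" "f u v \<le> 1" "v \<in> A \<Longrightarrow> f u v \<le> 0"
    "v \<notin> A \<Longrightarrow> (\<Sum>w\<in>nbrs v. f v w) = 0"
  using assms unfolding flow_def by blast+

definition flow_value :: "'a set \<Rightarrow> ('a \<Rightarrow> 'a \<Rightarrow> int) \<Rightarrow> int" where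
  "flow_value A f = (\<Sum>u\<in>A. \<Sum>w\<in>nbrs u. f u w)"

text \<open>Conservation lets the sum run over \<open>S\<close> instead of \<open>A\<close>, and the
  contributions of pairs inside \<open>S\<close> cancel by antisymmetry.\<close>

lemma flow_value_cut:
  assumes f: "flow A f" and S: "finite S" "A \<subseteq> S"
  shows "flow_value A f = (\<Sum>u\<in>S. \<Sum>w\<in>nbrs u - S. f u w)"
proof -
  have "flow_value A f = (\<Sum>u\<in>S. \<Sum>w\<in>nbrs u. f u w)"
    unfolding flow_value_def using S flowD(5)[OF f] by (intro sum.mono_neutral_left) auto
  also have "\<dots> = (\<Sum>u\<in>S. (\<Sum>w\<in>nbrs u - S. f u w) + (\<Sum>w\<in>S. f u w))"
  proof (rule sum.cong[OF refl])
    fix u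
    have "(\<Sum>w\<in>nbrs u. f u w) = (\<Sum>w\<in>nbrs u - S. f u w) + (\<Sum>w\<in>nbrs u \<inter> S. f u w)"
      using sum.Int_Diff[OF finite_nbrs[of u], of "f u" S] by simp
    moreover have "(\<Sum>w\<in>nbrs u \<inter> S. f u w) = (\<Sum>w\<in>S. f u w)"
      using S flowD(2)[OF f] by (intro sum.mono_neutral_left) auto
    ultimately show "(\<Sum>w\<in>nbrs u. f u w) = (\<Sum>w\<in>nbrs u - S. f u w) + (\<Sum>w\<in>S. f u w)" by simp
  qed
  also have "\<dots> = (\<Sum>u\<in>S. \<Sum>w\<in>nbrs u - S. f u w) + (\<Sum>u\<in>S. \<Sum>w\<in>S. f u w)"
    by (rule sum.distrib)
  also have "(\<Sum>u\<in>S. \<Sum>w\<in>S. f u w) = 0"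
  proof -
    have "(\<Sum>u\<in>S. \<Sum>w\<in>S. f u w) = (\<Sum>w\<in>S. \<Sum>u\<in>S. f u w)" by (rule sum.swap)
    also have "\<dots> = (\<Sum>w\<in>S. \<Sum>u\<in>S. - f w u)"
      using flowD(1)[OF f] by (intro sum.cong refl)
    also have "\<dots> = - (\<Sum>w\<in>S. \<Sum>u\<in>S. f w u)" by (simp add: sum_negf)
    finally show ?thesis by simp
  qed
  finally show ?thesis by simp
qed

text \<open>The relation consists of the residual arcs, those with room for one more unit. Pushing a
  unit along a whole residual ray violates conservation only at its start, which lies in
  \<open>A\<close>; the ray avoids \<open>A\<close> afterwards, so still nothing flows into
  \<open>A\<close>.\<close>

lemma flow_augment:
  assumes f: "flow A f" and A: "finite A"
    and inf: "infinite {v. \<exists>a\<in>A. (\<lambda>u w. w \<in> nbrs u \<and> f u w \<le> 0)\<^sup>*\<^sup>* a v}"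
  shows "\<exists>f'. flow A f' \<and> flow_value A f' = flow_value A f + 1"
proof -
  have "finite {w. w \<in> nbrs u \<and> f u w \<le> 0}" for u
    by (rule finite_subset[OF _ finite_nbrs[of u]]) auto
  from geodesic_ray_exists[OF A this inf] obtain p where p: "p 0 \<in> A"
    "\<And>n. p (Suc n) \<in> nbrs (p n) \<and> f (p n) (p (Suc n)) \<le> 0" "inj p" "\<And>n. p (Suc n) \<notin> A"
    by metis
  have p_eq: "p m = p n \<longleftrightarrow> m = n" for m n using p(3) by (rule inj_eq)
  define out where "out = (\<lambda>u w. \<exists>n. u = p n \<and> w = p (Suc n))"
  define g :: "'a \<Rightarrow> 'a \<Rightarrow> int" where
    "g = (\<lambda>u w. (if out u w then 1 else 0) - (if out w u then 1 else 0))"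
  have out_p: "out (p n) w \<longleftrightarrow> w = p (Suc n)" for n w by (auto simp: out_def p_eq)
  have out_p': "out w (p (Suc n)) \<longleftrightarrow> w = p n" for n w by (auto simp: out_def p_eq)
  have out_p0: "\<not> out w (p 0)" for w by (auto simp: out_def p_eq)
  have sum1: "(\<Sum>w\<in>nbrs u. if w = z then 1 else (0::int)) = 1" if "z \<in> nbrs u" for u z
    using that finite_nbrs[of u] by simp
  have nb: "p (Suc n) \<in> nbrs (p n)" "p n \<in> nbrs (p (Suc n))" for n
    using p(2)[of n] nbrsD(4)[of "p (Suc n)" "p n"] by simp_all
  have split: "(\<Sum>w\<in>nbrs u. g u w) =
      (\<Sum>w\<in>nbrs u. if out u w then 1 else 0) - (\<Sum>w\<in>nbrs u. if out w u then 1 else 0)" for u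
    unfolding g_def by (rule sum_subtractf)
  have sum_g: "(\<Sum>w\<in>nbrs u. g u w) = (if u = p 0 then 1 else 0)" for u
  proof -
    consider "u \<notin> range p" | "u = p 0" | n where "u = p (Suc n)"
      by (metis not0_implies_Suc rangeE)
    then show ?thesis
    proof cases
      case 1
      then have "\<not> out u w" "\<not> out w u" for w by (auto simp: out_def)
      moreover have "u \<noteq> p 0" using 1 by blast
      ultimately show ?thesis unfolding split by simp
    next
      case 2
      show ?thesis unfolding 2 split out_p sum1[OF nb(1)] by (simp add: out_p0)
    next
      case (3 n)
      show ?thesis unfolding 3 split out_p out_p' sum1[OF nb(1)] sum1[OF nb(2)] by (simp add: p_eq)
    qed
  qed
  define f' where "f' = (\<lambda>u w. f u w + g u w)"
  have g_le: "g u w \<le> 1" "\<not> out u w \<Longrightarrow> g u w \<le> 0" for u w by (auto simp: g_def)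
  have "flow A f'"
    unfolding flow_def
  proof (intro conjI allI impI)
    fix u v
    show "f' u v = - f' v u" using flowD(1)[OF f, of u v] by (simp add: f'_def g_def)
    show "f' u v = 0" if "v \<notin> nbrs u"
    proof -
      have "\<not> out u v" "\<not> out v u" using that nb by (auto simp: out_def)
      then show ?thesis using flowD(2)[OF f that] by (simp add: f'_def g_def)
    qed
    show "f' u v \<le> 1"
    proof (cases "out u v")
      case True
      then have "f u v \<le> 0" using p(2) by (auto simp: out_def)
      then show ?thesis using g_le(1)[of u v] by (simp add: f'_def)
    next
      case False
      then show ?thesis using g_le(2)[of u v] flowD(3)[OF f, of u v] by (simp add: f'_def)
    qed
    show "f' u v \<le> 0" if "v \<in> A"
    proof -
      have "\<not> out u v" using that p(4) by (auto simp: out_def)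
      then show ?thesis using g_le(2)[of u v] flowD(4)[OF f that, of u] by (simp add: f'_def)
    qed
    show "(\<Sum>w\<in>nbrs v. f' v w) = 0" if "v \<notin> A"
    proof -
      have "v \<noteq> p 0" using that p(1) by blast
      then show ?thesis using flowD(5)[OF f that] sum_g[of v] by (simp add: f'_def sum.distrib)
    qed
  qed
  moreover have "flow_value A f' = flow_value A f + 1"
    using A p(1) unfolding flow_value_def f'_def sum.distrib sum_g by simp
  ultimately show ?thesis by blast
qed

text \<open>The max-flow min-cut argument. If the vertices reachable by residual arcs formed a
  finite set, all its boundary edges would be saturated and the value would be at least
  \<open>K\<close>; so there are infinitely many and the flow can be augmented.\<close>

lemma flow_exists:
  assumes A: "finite A" "A \<subseteq> verts G"
    and cut: "\<And>S. finite S \<Longrightarrow> A \<subseteq> S \<Longrightarrow> S \<subseteq> verts G \<Longrightarrow> K \<le> card (boundary S)" and "k \<le> K"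
  shows "\<exists>f. flow A f \<and> flow_value A f = int k"
  using \<open>k \<le> K\<close>
proof (induction k)
  case 0
  have "flow A (\<lambda>u w. 0)" by (simp add: flow_def)
  moreover have "flow_value A (\<lambda>u w. 0) = 0" by (simp add: flow_value_def)
  ultimately show ?case by auto
next
  case (Suc k)
  then obtain f where f: "flow A f" "flow_value A f = int k" by auto
  let ?R = "\<lambda>u w. w \<in> nbrs u \<and> f u w \<le> 0"
  let ?S = "{v. \<exists>a\<in>A. ?R\<^sup>*\<^sup>* a v}"
  have "infinite ?S"
  proof
    assume fin: "finite ?S"
    have sub: "A \<subseteq> ?S" by auto
    have "v \<in> verts G" if "a \<in> A" "?R\<^sup>*\<^sup>* a v" for a v
      using that(2) by (cases rule: rtranclp.cases) (use that(1) A nbrsD(2) in auto)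
    then have "?S \<subseteq> verts G" by blast
    then have card: "K \<le> card (boundary ?S)" by (rule cut[OF fin sub])
    have one: "f u w = 1" if uw: "u \<in> ?S" "w \<in> nbrs u - ?S" for u w
    proof (rule ccontr)
      assume "f u w \<noteq> 1"
      then have "?R u w" using flowD(3)[OF f(1), of u w] uw by auto
      moreover obtain a where "a \<in> A" "?R\<^sup>*\<^sup>* a u" using uw(1) by blast
      ultimately have "w \<in> ?S" using rtranclp.rtrancl_into_rtrancl[of ?R a u w] by blast
      then show False using uw(2) by blast
    qed
    have "flow_value A f = (\<Sum>u\<in>?S. \<Sum>w\<in>nbrs u - ?S. f u w)" by (rule flow_value_cut[OF f(1) fin sub])
    also have "\<dots> = (\<Sum>u\<in>?S. \<Sum>w\<in>nbrs u - ?S. 1)" by (intro sum.cong refl one)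
    also have "\<dots> = int (card (boundary ?S))"
      unfolding boundary_Sigma using fin finite_nbrs by (subst card_SigmaI) auto
    finally show False using card f(2) Suc.prems by simp
  qed
  then show ?case using flow_augment[OF f(1) A(1)] f(2) by auto
qed

text \<open>Degree 3 is essential. With value -1 towards \<open>u\<close>, the other two values at
  \<open>v\<close> sum to 1 and are at most 1, so they are 1 and 0: one way out and no second way
  in.\<close>

lemma flow_succ:
  assumes f: "flow A f" and uv: "f u v = 1"
  shows "v \<notin> A" "\<exists>w. f v w = 1" "f u' v = 1 \<Longrightarrow> u' = u" "v \<in> nbrs u"
proof -
  show vA: "v \<notin> A" using flowD(4)[OF f, of v u] uv by auto
  show vu: "v \<in> nbrs u" using flowD(2)[OF f, of v u] uv by auto
  have u: "u \<in> nbrs v" "v \<in> verts G" using nbrsD[OF vu] by simp_all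
  have "card (nbrs v - {u}) = 2" using card_nbrs[OF u(2)] u(1) finite_nbrs by simp
  then obtain x y where xy: "nbrs v - {u} = {x, y}" "x \<noteq> y" by (auto simp: card_2_iff)
  have "(\<Sum>w\<in>nbrs v. f v w) = f v u + (\<Sum>w\<in>nbrs v - {u}. f v w)"
    by (rule sum.remove[OF finite_nbrs u(1)])
  then have s: "f v x + f v y = 1"
    using flowD(5)[OF f vA] flowD(1)[OF f, of v u] uv xy by simp
  have "f v x = 1 \<or> f v y = 1" using s flowD(3)[OF f, of v x] flowD(3)[OF f, of v y] by linarith
  then show "\<exists>w. f v w = 1" by blast
  show "u' = u" if "f u' v = 1"
  proof (rule ccontr)
    assume ne: "u' \<noteq> u"
    have "v \<in> nbrs u'" using flowD(2)[OF f, of v u'] that by auto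
    then have "u' \<in> nbrs v - {u}" using nbrsD(4) ne by blast
    then have "u' = x \<or> u' = y" using xy by blast
    moreover have "f v u' = - 1" using that flowD(1)[OF f, of v u'] by simp
    ultimately show False using s flowD(3)[OF f, of v x] flowD(3)[OF f, of v y] by auto
  qed
qed

text \<open>Distinct flow paths from \<open>A\<close> never meet, as every vertex outside \<open>A\<close> has at most one
  incoming flow edge.\<close>

lemma flow_rays:
  assumes f: "flow A f" and A: "finite A" and val: "flow_value A f = int k"
  shows "\<exists>R. finite R \<and> card R = k \<and> (\<forall>r\<in>R. ray G r) \<and>
    pairwise (\<lambda>r s. ray_edges r \<inter> ray_edges s = {}) R"
proof -
  \<comment> \<open>One path for each arc on which flow leaves \<open>A\<close>; their number is the
    value of the flow.\<close>
  define X where "X = Sigma A (\<lambda>u. {w \<in> nbrs u. f u w = 1})"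
  define nxt where "nxt = (\<lambda>v. SOME w. f v w = 1)"
  define path where "path = (\<lambda>x n. case n of 0 \<Rightarrow> fst x | Suc m \<Rightarrow> (nxt ^^ m) (snd x))"
  have path0: "path x 0 = fst x" "path x (Suc 0) = snd x" for x by (simp_all add: path_def)
  have finX: "finite X" unfolding X_def
    by (intro finite_SigmaI A) (rule finite_subset[OF _ finite_nbrs], auto)
  have "flow_value A f = (\<Sum>u\<in>A. int (card {w \<in> nbrs u. f u w = 1}))"
    unfolding flow_value_def
  proof (rule sum.cong[OF refl])
    fix u assume u: "u \<in> A"
    \<comment> \<open>Flow into \<open>u\<close> is forbidden, so all values at \<open>u\<close> are
      0 or 1.\<close>
    have "f u w = (if f u w = 1 then 1 else 0)" for w
      using flowD(1)[OF f, of u w] flowD(4)[OF f u, of w] flowD(3)[OF f, of u w] by auto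
    then have "(\<Sum>w\<in>nbrs u. f u w) = (\<Sum>w\<in>nbrs u. if f u w = 1 then 1 else 0)" by (intro sum.cong refl)
    also have "\<dots> = int (card {w \<in> nbrs u. f u w = 1})"
      using finite_nbrs[of u] by (simp add: sum.If_cases Int_def)
    finally show "(\<Sum>w\<in>nbrs u. f u w) = int (card {w \<in> nbrs u. f u w = 1})" .
  qed
  also have "\<dots> = int (card X)"
    unfolding X_def using A finite_nbrs by (subst card_SigmaI) auto
  finally have cardX: "card X = k" using val by simp
  have arc: "f (path x n) (path x (Suc n)) = 1" if x: "x \<in> X" for x n
  proof (induction n)
    case 0
    then show ?case using x by (auto simp: path0 X_def)
  next
    case (Suc n)
    have "path x (Suc (Suc n)) = nxt (path x (Suc n))" by (simp add: path_def)
    then show ?case using someI_ex[OF flow_succ(2)[OF f Suc]] by (simp add: nxt_def)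
  qed
  have start: "path x 0 \<in> A" if "x \<in> X" for x using that by (auto simp: path0 X_def)
  have later: "path x (Suc n) \<notin> A" if "x \<in> X" for x n using flow_succ(1)[OF f arc[OF that]] .
  \<comment> \<open>Unique predecessors allow tracing both paths back in step. They reach
    \<open>A\<close> simultaneously, since a path is in \<open>A\<close> only at index 0.\<close>
  have meet: "i = j \<and> (\<forall>l\<le>i. path x l = path y l)"
    if "x \<in> X" "y \<in> X" "path x i = path y j" for x y i j
    using that(3)
  proof (induction i arbitrary: j)
    case 0
    then have "j = 0" using start[OF that(1)] later[OF that(2)] by (cases j) auto
    then show ?case using 0 by simp
  next
    case (Suc i)
    have "j \<noteq> 0" using Suc.prems later[OF that(1), of i] start[OF that(2)] by (intro notI) simp
    then obtain j' where j: "j = Suc j'" by (cases j) auto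
    have "f (path y j') (path x (Suc i)) = 1" using arc[OF that(2), of j'] Suc.prems j by simp
    then have "path x i = path y j'" using flow_succ(3)[OF f arc[OF that(1)]] by simp
    then show ?case using Suc.IH[of j'] Suc.prems j by (auto simp: le_Suc_eq)
  qed
  have ray: "ray G (path x)" if x: "x \<in> X" for x
    unfolding ray_def
  proof (intro conjI allI)
    show "inj (path x)" using meet[OF x x] by (intro injI) blast
    fix i
    have nb: "path x (Suc i) \<in> nbrs (path x i)" by (rule flow_succ(4)[OF f arc[OF x]])
    then show "path x i \<in> verts G" by (rule nbrsD(1))
    show "{path x i, path x (Suc i)} \<in> edges G" using nb by (simp add: nbrs_def)
  qed
  have eq: "x = y" if xy: "x \<in> X" "y \<in> X" "path x i = path y j" "path x (Suc i) = path y (Suc j)" for x y i j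
  proof -
    have "\<forall>l\<le>Suc i. path x l = path y l" using meet[OF xy(1,2,4)] by blast
    then have "path x 0 = path y 0" "path x (Suc 0) = path y (Suc 0)" by auto
    then show ?thesis by (simp add: path0 prod_eq_iff)
  qed
  have inj: "inj_on path X"
  proof (rule inj_onI)
    fix x y assume "x \<in> X" "y \<in> X" "path x = path y"
    then show "x = y" using eq[of x y 0 0] by simp
  qed
  have disj: "ray_edges (path x) \<inter> ray_edges (path y) = {}" if xy: "x \<in> X" "y \<in> X" "x \<noteq> y" for x y
  proof (rule ccontr)
    assume "\<not> ?thesis"
    then obtain i j where "{path x i, path x (Suc i)} = {path y j, path y (Suc j)}"
      by (auto simp: ray_edges_def)
    then consider "path x i = path y j" "path x (Suc i) = path y (Suc j)"
      | "path x i = path y (Suc j)" "path x (Suc i) = path y j" by (auto simp: doubleton_eq_iff)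
    then show False
    proof cases
      case 1
      then show ?thesis using eq[OF xy(1,2)] xy(3) by blast
    next
      case 2
      \<comment> \<open>A common edge traversed in opposite directions would carry 1 both ways,
        against antisymmetry.\<close>
      then have "f (path y (Suc j)) (path y j) = 1" using arc[OF xy(1), of i] by simp
      then show ?thesis using arc[OF xy(2), of j] flowD(1)[OF f, of "path y j" "path y (Suc j)"] by simp
    qed
  qed
  have "finite (path ` X) \<and> card (path ` X) = k \<and> (\<forall>r\<in>path ` X. ray G r) \<and>
      pairwise (\<lambda>r s. ray_edges r \<inter> ray_edges s = {}) (path ` X)"
  proof (intro conjI ballI pairwiseI)
    show "finite (path ` X)" using finX by (rule finite_imageI)
    show "card (path ` X) = k" using card_image[OF inj] cardX by simp
    show "ray G r" if "r \<in> path ` X" for r using that ray by (elim imageE) simp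
    fix r s assume rs: "r \<in> path ` X" "s \<in> path ` X" "r \<noteq> s"
    obtain x y where xy: "r = path x" "s = path y" "x \<in> X" "y \<in> X" using rs(1,2) by (elim imageE) (rule that)
    then have "x \<noteq> y" using rs(3) by blast
    then show "ray_edges r \<inter> ray_edges s = {}" unfolding xy(1,2) by (rule disj[OF xy(3,4)])
  qed
  then show ?thesis by (rule exI)
qed

text \<open>Otherwise every finite set around \<open>A\<close> has at least 4 boundary edges, and a
  flow of value 4 yields four edge-disjoint rays in \<omega>.\<close>

lemma small_boundary_exists:
  assumes A: "finite A" "A \<subseteq> verts G" and rays: "\<And>r. ray G r \<Longrightarrow> r \<in> \<omega>" and deg: "end_degree \<omega> \<le> 3"
  shows "\<exists>S. finite S \<and> A \<subseteq> S \<and> S \<subseteq> verts G \<and> card (boundary S) \<le> 3"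
proof (rule ccontr)
  assume no: "\<not> ?thesis"
  have "4 \<le> card (boundary S)" if "finite S" "A \<subseteq> S" "S \<subseteq> verts G" for S
  proof (rule ccontr)
    assume "\<not> 4 \<le> card (boundary S)"
    then have "card (boundary S) \<le> 3" by simp
    then show False using no that by blast
  qed
  then obtain f where f: "flow A f" "flow_value A f = int 4" using flow_exists[OF A, of 4 4] by blast
  obtain R where "finite R \<and> card R = 4 \<and> (\<forall>r\<in>R. ray G r) \<and>
      pairwise (\<lambda>r s. ray_edges r \<inter> ray_edges s = {}) R"
    using flow_rays[OF f(1) A(1) f(2)] by (rule exE)
  then have R: "finite R" "card R = 4" "\<forall>r\<in>R. ray G r"
    "pairwise (\<lambda>r s. ray_edges r \<inter> ray_edges s = {}) R" by simp_all
  then have "R \<subseteq> \<omega>" using rays by blast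
  then have "enat (card R) \<le> end_degree \<omega>"
    unfolding end_degree_def using R by (intro SUP_upper) simp
  then have "enat 4 \<le> 3" using deg R(2) by simp
  then show False by (simp add: numeral_eq_enat)
qed

end

section \<open>Components and rays of one-ended graphs\<close>

lemma adjacent_delete_verts:
  "adjacent (delete_verts G S) u v \<longleftrightarrow> {u, v} \<in> edges G \<and> u \<notin> S \<and> v \<notin> S"
  by (auto simp: adjacent_def delete_verts_def)

lemma component_eq:
  assumes "C \<in> graph_components H" "x \<in> C"
  shows "C = {w \<in> verts H. (adjacent H)\<^sup>*\<^sup>* x w}"
proof -
  obtain v where C: "C = {w \<in> verts H. (adjacent H)\<^sup>*\<^sup>* v w}"
    using assms(1) by (auto simp: graph_components_def)
  have vx: "(adjacent H)\<^sup>*\<^sup>* v x" using assms(2) C by simp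
  have "symp (adjacent H)" by (auto simp: symp_def adjacent_def insert_commute)
  then have xv: "(adjacent H)\<^sup>*\<^sup>* x v" using vx by (metis sympD symp_rtranclp)
  show ?thesis unfolding C using rtranclp_trans[OF vx] rtranclp_trans[OF xv] by blast
qed

lemma component_unique:
  "C \<in> graph_components H \<Longrightarrow> C' \<in> graph_components H \<Longrightarrow> x \<in> C \<Longrightarrow> x \<in> C' \<Longrightarrow> C = C'"
  using component_eq[of C H x] component_eq[of C' H x] by simp

lemma tail_component_unique:
  assumes "C \<in> graph_components H" "C' \<in> graph_components H" "has_tail_in r C" "has_tail_in r C'"
  shows "C = C'"
proof -
  obtain m n where "\<forall>i\<ge>m. r i \<in> C" "\<forall>i\<ge>n. r i \<in> C'" using assms(3,4) by (auto simp: has_tail_in_def)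
  then have "r (m + n) \<in> C" "r (m + n) \<in> C'" by simp_all
  then show ?thesis by (rule component_unique[OF assms(1,2)])
qed

lemma component_subset: "C \<in> graph_components (delete_verts G S) \<Longrightarrow> C \<subseteq> verts G - S"
  by (auto simp: graph_components_def delete_verts_def)

lemma component_closed:
  assumes C: "C \<in> graph_components (delete_verts G S)" "u \<in> C"
    and w: "{u, w} \<in> edges G" "w \<in> verts G" "w \<notin> S"
  shows "w \<in> C"
proof -
  have "adjacent (delete_verts G S) u w"
    using w component_subset[OF C(1)] C(2) by (auto simp: adjacent_delete_verts)
  then show ?thesis
    unfolding component_eq[OF C] using w by (auto simp: delete_verts_def)
qed

text \<open>Being injective, the ray meets the finite set \<open>S\<close> only finitely often, and
  the rest of it is connected outside \<open>S\<close>.\<close>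

lemma ray_tail_component:
  assumes r: "ray G r" and S: "finite S"
  shows "\<exists>C\<in>graph_components (delete_verts G S). has_tail_in r C"
proof -
  have inj: "inj r" and nb: "\<And>i. r i \<in> verts G" "\<And>i. {r i, r (Suc i)} \<in> edges G"
    using r by (auto simp: ray_def)
  have "finite (r -` S)" using S inj by (rule finite_vimageI)
  then obtain n where n: "\<And>i. i \<in> r -` S \<Longrightarrow> i < n" by (meson finite_nat_set_iff_bounded)
  then have out: "r i \<notin> S" if "n \<le> i" for i using that by (meson not_le vimageI)
  have "(adjacent (delete_verts G S))\<^sup>*\<^sup>* (r n) (r i)" if "n \<le> i" for i
    using that
  proof (induction i rule: dec_induct)
    case (step i)
    have "adjacent (delete_verts G S) (r i) (r (Suc i))"
      using nb(2) out step.hyps by (simp add: adjacent_delete_verts)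
    then show ?case using step.IH by simp
  qed simp
  then have "has_tail_in r {w \<in> verts (delete_verts G S). (adjacent (delete_verts G S))\<^sup>*\<^sup>* (r n) w}"
    using nb(1) out unfolding has_tail_in_def by (intro exI[of _ n]) (simp add: delete_verts_def)
  moreover have "r n \<in> verts (delete_verts G S)" using nb(1) out by (simp add: delete_verts_def)
  ultimately show ?thesis by (auto simp: graph_components_def)
qed

locale one_ended_graph =
  fixes G :: "'a graph" and \<omega> :: "(nat \<Rightarrow> 'a) set"
  assumes simple: "simple_graph G" and one_end: "ends G = {\<omega>}"
begin

lemma edge_verts: "{u, v} \<in> edges G \<Longrightarrow> u \<in> verts G \<and> v \<in> verts G \<and> u \<noteq> v"
  using simple by (fastforce simp: simple_graph_def doubleton_eq_iff)

text \<open>The class of \<open>r\<close> is an end, hence \<omega>, and contains \<open>r\<close>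
  by reflexivity.\<close>

lemma ray_in_end:
  assumes "ray G r" shows "r \<in> \<omega>"
proof -
  have "(r, r) \<in> ray_equiv G" using assms ray_tail_component[OF assms] by (auto simp: ray_equiv_def)
  moreover have "ray_equiv G `` {r} \<in> ends G" using assms by (auto simp: ends_def quotient_def)
  ultimately show ?thesis using one_end by auto
qed

lemma end_obtain:
  obtains r where "ray G r" "\<omega> = {s. (r, s) \<in> ray_equiv G}"
proof -
  have "\<omega> \<in> {r. ray G r} // ray_equiv G" using one_end by (simp add: ends_def)
  then obtain r where "ray G r" "\<omega> = ray_equiv G `` {r}" by (auto elim: quotientE)
  then show thesis using that[of r] by (simp add: Image_singleton)
qed

text \<open>Justifies the definite description: a representative ray singles out a component,
  equivalence brings every other tail into it, and components sharing a tail coincide.\<close>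

lemma end_component:
  assumes S: "finite S" "S \<subseteq> verts G"
  shows "end_component G S \<omega> \<in> graph_components (delete_verts G S)"
    and "ray G r \<Longrightarrow> has_tail_in r (end_component G S \<omega>)"
proof -
  obtain r0 where r0: "ray G r0" "\<omega> = {s. (r0, s) \<in> ray_equiv G}" by (rule end_obtain)
  obtain C where C: "C \<in> graph_components (delete_verts G S)" "has_tail_in r0 C"
    using ray_tail_component[OF r0(1) S(1)] by blast
  have tails: "has_tail_in s C" if s: "s \<in> \<omega>" for s
  proof -
    have "\<exists>C\<in>graph_components (delete_verts G S). has_tail_in r0 C \<and> has_tail_in s C"
      using s S r0(2) by (simp add: ray_equiv_def)
    then obtain C' where C': "C' \<in> graph_components (delete_verts G S)" "has_tail_in r0 C'" "has_tail_in s C'"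
      by blast
    then show ?thesis using tail_component_unique[OF C(1) C'(1) C(2) C'(2)] by simp
  qed
  have eq: "end_component G S \<omega> = C"
    unfolding end_component_def
  proof (rule the_equality)
    show "C \<in> graph_components (delete_verts G S) \<and> (\<forall>r\<in>\<omega>. has_tail_in r C)" using C(1) tails by blast
    fix C' assume "C' \<in> graph_components (delete_verts G S) \<and> (\<forall>r\<in>\<omega>. has_tail_in r C')"
    then show "C' = C" using tail_component_unique[of C' _ C r0] C ray_in_end[OF r0(1)] by blast
  qed
  show "end_component G S \<omega> \<in> graph_components (delete_verts G S)" unfolding eq by (rule C(1))
  show "has_tail_in r (end_component G S \<omega>)" if "ray G r" unfolding eq by (rule tails[OF ray_in_end[OF that]])
qed

lemma end_component_subset: "finite S \<Longrightarrow> S \<subseteq> verts G \<Longrightarrow> end_component G S \<omega> \<subseteq> verts G - S"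
  by (rule component_subset[OF end_component(1)])

lemma end_component_closed:
  assumes "finite S" "S \<subseteq> verts G" "u \<in> end_component G S \<omega>" "{u, w} \<in> edges G"
  shows "w \<in> end_component G S \<omega> \<or> w \<in> S"
  using component_closed[OF end_component(1)[OF assms(1,2)] assms(3,4)] edge_verts[OF assms(4)] by blast

end

section \<open>Circles parametrized by the real line\<close>

text \<open>The Cayley transform, a homeomorphism from the real line onto the unit circle without 1;
  the missing point 1 stands for infinity.\<close>

definition cayley :: "real \<Rightarrow> complex" where
  "cayley t = (of_real t - \<i>) / (of_real t + \<i>)"

text \<open>The quotient is already real at all points of the unit circle other than 1;
  \<open>Re\<close> only turns it into a real number.\<close>

definition cayley_inv :: "complex \<Rightarrow> real" where
  "cayley_inv z = Re (\<i> * (1 + z) / (1 - z))"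

lemma of_real_add_i_nz: "complex_of_real t + \<i> \<noteq> 0"
  by (simp add: complex_eq_iff)

lemma cayley_minus_one: "cayley t - 1 = - 2 * \<i> / (of_real t + \<i>)"
  using of_real_add_i_nz[of t] by (simp add: cayley_def field_simps)

lemma cayley_neq_one: "cayley t \<noteq> 1"
  using cayley_minus_one[of t] of_real_add_i_nz[of t] by auto

lemma norm_of_real_i: "cmod (of_real t + \<i>) = sqrt (t\<^sup>2 + 1)" "cmod (of_real t - \<i>) = sqrt (t\<^sup>2 + 1)"
  by (simp_all add: cmod_def)

lemma norm_cayley: "cmod (cayley t) = 1"
proof -
  have "t\<^sup>2 + 1 > 0" by (simp add: add_nonneg_pos)
  then show ?thesis by (simp add: cayley_def norm_divide norm_of_real_i)
qed

lemma dist_cayley_one: "cmod (cayley t - 1) = 2 / sqrt (t\<^sup>2 + 1)"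
  by (simp add: cayley_minus_one norm_divide norm_mult norm_of_real_i)

lemma cayley_inv_cayley [simp]: "cayley_inv (cayley t) = t"
proof -
  have nz: "complex_of_real t + \<i> \<noteq> 0" by (rule of_real_add_i_nz)
  have "1 - cayley t = 2 * \<i> / (of_real t + \<i>)" using nz by (simp add: cayley_def field_simps)
  moreover have "1 + cayley t = 2 * of_real t / (of_real t + \<i>)" using nz by (simp add: cayley_def field_simps)
  ultimately have "\<i> * (1 + cayley t) / (1 - cayley t) =
      \<i> * (2 * of_real t / (of_real t + \<i>)) / (2 * \<i> / (of_real t + \<i>))" by (simp only:)
  also have "\<dots> = of_real t" using nz by simp
  finally have "\<i> * (1 + cayley t) / (1 - cayley t) = of_real t" .
  then show ?thesis by (simp add: cayley_inv_def)
qed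

lemma cayley_cayley_inv:
  assumes "cmod z = 1" "z \<noteq> 1" shows "cayley (cayley_inv z) = z"
proof -
  define w where "w = \<i> * (1 + z) / (1 - z)"
  have nz: "1 - z \<noteq> 0" "1 - cnj z \<noteq> 0" using assms(2) by (auto simp: complex_eq_iff)
  have zz: "z * cnj z = 1" using assms(1) by (simp add: complex_norm_square[symmetric])
  have "cnj w = w"
  proof -
    have "cnj w = (- \<i> * (1 + cnj z)) / (1 - cnj z)" by (simp add: w_def)
    moreover have "- \<i> * (1 + cnj z) * (1 - z) = \<i> * (1 + z) * (1 - cnj z)"
      using zz by (simp add: algebra_simps)
    then have "(- \<i> * (1 + cnj z)) / (1 - cnj z) = (\<i> * (1 + z)) / (1 - z)"
      by (simp only: frac_eq_eq[OF nz(2) nz(1)])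
    ultimately show ?thesis by (simp only: w_def)
  qed
  then have w: "w = of_real (cayley_inv z)"
    by (simp add: cayley_inv_def w_def[symmetric] complex_eq_iff)
  have "w * (1 - z) = \<i> * (1 + z)" using nz by (simp add: w_def)
  then have "z * (w + \<i>) = w - \<i>" by (simp add: algebra_simps)
  then have "cayley (cayley_inv z) = z"
    using of_real_add_i_nz[of "cayley_inv z"] by (simp add: cayley_def w[symmetric] field_simps)
  then show ?thesis .
qed

lemma continuous_cayley: "continuous_on UNIV cayley"
  unfolding cayley_def by (intro continuous_intros) (use of_real_add_i_nz in auto)

lemma continuous_cayley_inv: "continuous_on (- {1}) cayley_inv"
  unfolding cayley_inv_def by (intro continuous_intros) auto

text \<open>Together with \<open>cayley_near\<close>, this matches neighbourhoods of 1 on the circle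
  with the sets where \<bar>t\<bar> is large.\<close>

lemma cayley_far:
  assumes "0 < \<delta>" "2 / \<delta> < \<bar>t\<bar>" shows "cmod (cayley t - 1) < \<delta>"
proof -
  have "\<bar>t\<bar> \<le> sqrt (t\<^sup>2 + 1)" by (rule real_le_rsqrt) simp
  then have "2 / \<delta> < sqrt (t\<^sup>2 + 1)" using assms(2) by linarith
  moreover have "0 < sqrt (t\<^sup>2 + 1)" by (simp add: add_nonneg_pos)
  ultimately show ?thesis using assms(1) unfolding dist_cayley_one by (simp add: field_simps)
qed

lemma cayley_near:
  assumes "0 \<le> N" "\<bar>t\<bar> \<le> N" shows "2 / sqrt (N\<^sup>2 + 1) \<le> cmod (cayley t - 1)"
proof -
  have "t\<^sup>2 \<le> N\<^sup>2" using assms by (simp add: abs_le_square_iff[symmetric])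
  moreover have "0 < sqrt (t\<^sup>2 + 1)" by (simp add: add_nonneg_pos)
  ultimately show ?thesis unfolding dist_cayley_one by (intro divide_left_mono) (auto simp: add_nonneg_pos)
qed

text \<open>The circle is treated as the line with one point \<open>p\<close> at infinity.
  \<open>cont\<close> and \<open>cont_p\<close> give continuity on generating sets;
  \<open>loc\<close> and \<open>loc_p\<close> make the map open, which replaces the usual argument
  from compactness into a Hausdorff space.\<close>

lemma circle_inI:
  fixes \<phi> :: "real \<Rightarrow> 'b"
  assumes inj: "inj \<phi>" and p: "p \<notin> range \<phi>" and top: "insert p (range \<phi>) \<subseteq> \<Union>B"
    and cont: "\<And>U. U \<in> B \<Longrightarrow> open (\<phi> -` U)"
    and cont_p: "\<And>U. U \<in> B \<Longrightarrow> p \<in> U \<Longrightarrow> \<exists>N. \<forall>t. N < \<bar>t\<bar> \<longrightarrow> \<phi> t \<in> U"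
    and loc: "\<And>s \<eta>. 0 < \<eta> \<Longrightarrow> \<exists>U\<in>B. \<phi> s \<in> U \<and> p \<notin> U \<and> \<phi> -` U \<subseteq> {s - \<eta><..<s + \<eta>}"
    and loc_p: "\<And>N. \<exists>U\<in>B. p \<in> U \<and> \<phi> -` U \<subseteq> {t. N < \<bar>t\<bar>}"
  shows "circle_in (topology_generated_by B) (insert p (range \<phi>))"
proof -
  let ?S = "sphere (0::complex) 1" and ?X = "topology_generated_by B" and ?K = "insert p (range \<phi>)"
  define g where "g = (\<lambda>z. if z = 1 then p else \<phi> (cayley_inv z))"
  have g_cayley: "g (cayley t) = \<phi> t" for t by (simp add: g_def cayley_neq_one)
  have cS: "cayley t \<in> ?S" for t by (simp add: norm_cayley)
  have S_cases: "z = 1 \<or> (\<exists>t. z = cayley t)" if "z \<in> ?S" for z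
    using cayley_cayley_inv[of z] that by (metis dist_0_norm mem_sphere)
  have topX: "topspace ?X = \<Union>B" by simp
  have img: "g ` ?S = ?K"
  proof
    show "g ` ?S \<subseteq> ?K" by (auto simp: g_def)
    show "?K \<subseteq> g ` ?S"
    proof
      fix q assume "q \<in> ?K"
      then consider "q = p" | t where "q = \<phi> t" by blast
      then show "q \<in> g ` ?S"
      proof cases
        case 1
        then show ?thesis by (intro image_eqI[of _ _ 1]) (simp_all add: g_def)
      next
        case (2 t)
        then show ?thesis by (intro image_eqI[of _ _ "cayley t"] cS) (simp add: g_cayley)
      qed
    qed
  qed
  have injg: "inj_on g ?S"
  proof (rule inj_onI)
    fix y z assume yz: "y \<in> ?S" "z \<in> ?S" "g y = g z"
    have gp: "g (cayley t) \<noteq> p" for t using p g_cayley[of t] by (metis rangeI)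
    have g1: "g 1 = p" by (simp add: g_def)
    show "y = z"
      using S_cases[OF yz(1)] S_cases[OF yz(2)]
    proof (elim disjE exE)
      fix s t assume y: "y = cayley s" and z: "z = cayley t"
      have "\<phi> s = \<phi> t" using yz(3) unfolding y z g_cayley .
      then show ?thesis unfolding y z using inj_eq[OF inj] by simp
    next
      fix t assume y: "y = 1" and z: "z = cayley t"
      show ?thesis using yz(3) gp[of t] unfolding y z g1 by simp
    next
      fix t assume y: "y = cayley t" and z: "z = 1"
      show ?thesis using yz(3) gp[of t] unfolding y z g1 by simp
    qed simp
  qed
  have contg: "continuous_map (top_of_set ?S) ?X g"
  proof (rule continuous_on_generated_topo)
    fix U assume U: "U \<in> B"
    show "openin (top_of_set ?S) (g -` U \<inter> topspace (top_of_set ?S))"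
    proof (subst openin_subopen, intro ballI)
      fix z assume z: "z \<in> g -` U \<inter> topspace (top_of_set ?S)"
      show "\<exists>T. openin (top_of_set ?S) T \<and> z \<in> T \<and> T \<subseteq> g -` U \<inter> topspace (top_of_set ?S)"
      proof (cases "z = 1")
        case True
        then have "p \<in> U" using z by (simp add: g_def)
        then obtain N where N: "\<And>t. N < \<bar>t\<bar> \<Longrightarrow> \<phi> t \<in> U" using cont_p[OF U] by blast
        \<comment> \<open>\<open>cayley_near\<close> asks for a nonnegative bound.\<close>
        define N' where "N' = max N 0"
        have N': "0 \<le> N'" "N \<le> N'" by (simp_all add: N'_def)
        let ?T = "?S \<inter> ball 1 (2 / sqrt (N'\<^sup>2 + 1))"
        have "?T \<subseteq> g -` U \<inter> topspace (top_of_set ?S)"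
        proof
          fix y assume y: "y \<in> ?T"
          show "y \<in> g -` U \<inter> topspace (top_of_set ?S)"
          proof (cases "y = 1")
            case True
            then show ?thesis using \<open>p \<in> U\<close> by (simp add: g_def)
          next
            case False
            then obtain t where t: "y = cayley t" using S_cases y by blast
            have "cmod (cayley t - 1) < 2 / sqrt (N'\<^sup>2 + 1)" using y t by (simp add: dist_norm norm_minus_commute)
            then have "N' < \<bar>t\<bar>" using cayley_near[OF N'(1), of t] by fastforce
            then show ?thesis using N[of t] N'(2) y by (simp add: t g_cayley)
          qed
        qed
        moreover have "0 < 2 / sqrt (N'\<^sup>2 + 1)" by (simp add: add_nonneg_pos)
        then have "1 \<in> ?T" by simp
        moreover have "openin (top_of_set ?S) ?T" by (simp add: openin_open_Int)
        ultimately show ?thesis using True by blast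
      next
        case False
        let ?P = "- {1} \<inter> cayley_inv -` (\<phi> -` U)"
        have "open ?P"
          using continuous_cayley_inv cont[OF U] by (intro continuous_open_preimage) auto
        then have "openin (top_of_set ?S) (?S \<inter> ?P)" by (simp add: openin_open_Int)
        moreover have "?S \<inter> ?P \<subseteq> g -` U \<inter> topspace (top_of_set ?S)" by (auto simp: g_def)
        moreover have "z \<in> ?S \<inter> ?P" using z False by (simp add: g_def)
        ultimately show ?thesis by blast
      qed
    qed
  next
    show "g ` topspace (top_of_set ?S) \<subseteq> \<Union>B" using img top by simp
  qed
  have openg: "open_map (top_of_set ?S) (subtopology ?X ?K) g"
    unfolding open_map_def
  proof (intro allI impI)
    fix W assume W: "openin (top_of_set ?S) W"
    then obtain W' where W': "open W'" "W = ?S \<inter> W'" by (auto simp: openin_open)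
    show "openin (subtopology ?X ?K) (g ` W)"
    proof (subst openin_subopen, intro ballI)
      fix q assume "q \<in> g ` W"
      then obtain z where z: "z \<in> W" "q = g z" by blast
      have "\<exists>U\<in>B. q \<in> U \<and> ?K \<inter> U \<subseteq> g ` W"
      proof (cases "z = 1")
        case True
        then have "1 \<in> W'" using z W' by blast
        then obtain \<delta> where \<delta>: "0 < \<delta>" "ball 1 \<delta> \<subseteq> W'" using W'(1) open_contains_ball by blast
        obtain U where U: "U \<in> B" "p \<in> U" "\<phi> -` U \<subseteq> {t. 2 / \<delta> < \<bar>t\<bar>}" using loc_p by blast
        have "?K \<inter> U \<subseteq> g ` W"
        proof
          fix x assume x: "x \<in> ?K \<inter> U"
          then consider "x = p" | t where "x = \<phi> t" by blast
          then show "x \<in> g ` W"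
          proof cases
            case 1
            then show ?thesis using z True by (intro image_eqI[of _ _ 1]) (simp_all add: g_def)
          next
            case (2 t)
            then have "2 / \<delta> < \<bar>t\<bar>" using x U(3) by blast
            then have "cayley t \<in> ball 1 \<delta>"
              using cayley_far[OF \<delta>(1)] by (simp add: dist_norm norm_minus_commute)
            then have "cayley t \<in> W" using \<delta>(2) W'(2) cS by blast
            then show ?thesis using 2 by (intro image_eqI[of _ _ "cayley t"]) (simp_all add: g_cayley)
          qed
        qed
        then show ?thesis using U z True by (intro bexI[of _ U]) (simp_all add: g_def)
      next
        case False
        then obtain s where s: "z = cayley s" using S_cases z(1) W'(2) by blast
        have "open (cayley -` W')" using continuous_cayley W'(1) by (simp add: open_vimage)
        moreover have "s \<in> cayley -` W'" using s z(1) W'(2) by simp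
        ultimately obtain \<eta> where \<eta>: "0 < \<eta>" "ball s \<eta> \<subseteq> cayley -` W'" using open_contains_ball by blast
        obtain U where U: "U \<in> B" "\<phi> s \<in> U" "p \<notin> U" "\<phi> -` U \<subseteq> {s - \<eta><..<s + \<eta>}"
          using loc[OF \<eta>(1)] by blast
        have "?K \<inter> U \<subseteq> g ` W"
        proof
          fix x assume x: "x \<in> ?K \<inter> U"
          then obtain t where t: "x = \<phi> t" using U(3) by blast
          then have "t \<in> {s - \<eta><..<s + \<eta>}" using x U(4) by blast
          then have "t \<in> ball s \<eta>" by (auto simp: dist_real_def)
          then have "cayley t \<in> W" using \<eta>(2) W'(2) cS by blast
          then show "x \<in> g ` W" using t by (intro image_eqI[of _ _ "cayley t"]) (simp_all add: g_cayley)
        qed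
        then show ?thesis using U z s by (intro bexI[of _ U]) (simp_all add: g_cayley)
      qed
      then obtain U where U: "U \<in> B" "q \<in> U" "?K \<inter> U \<subseteq> g ` W" by blast
      have "openin ?X U" by (rule topology_generated_by_Basis[OF U(1)])
      then have "openin (subtopology ?X ?K) (?K \<inter> U)" by (rule openin_subtopology_Int2)
      moreover have "q \<in> ?K \<inter> U"
        using U(2) z W'(2) img by blast
      ultimately show "\<exists>T. openin (subtopology ?X ?K) T \<and> q \<in> T \<and> T \<subseteq> g ` W" using U(3) by blast
    qed
  qed
  have topK: "topspace (subtopology ?X ?K) = ?K"
    unfolding topspace_subtopology topX by (rule Int_absorb1[OF top])
  have "g \<in> ?S \<rightarrow> ?K" using img by blast
  then have "continuous_map (top_of_set ?S) (subtopology ?X ?K) g"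
    using contg by (simp add: continuous_map_in_subtopology)
  then have "homeomorphic_map (top_of_set ?S) (subtopology ?X ?K) g"
    by (rule bijective_open_imp_homeomorphic_map[OF _ openg]) (use img injg topK in simp_all)
  then have "top_of_set ?S homeomorphic_space subtopology ?X ?K"
    by (rule homeomorphic_map_imp_homeomorphic_space)
  then show ?thesis using top topX by (simp add: circle_in_def)
qed

text \<open>The point of the circle mapped to \<open>p\<close> is some \<open>z\<close>;
  multiplication by \<open>z\<close> rotates the point 1 missed by \<open>cayley\<close> to
  it.\<close>

lemma circle_inD:
  assumes K: "circle_in X K" and p: "p \<in> K"
  obtains \<gamma> :: "real \<Rightarrow> 'b" where "inj \<gamma>" "range \<gamma> = K - {p}"
    "\<And>U. openin X U \<Longrightarrow> open (\<gamma> -` U)"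
    "\<And>U. openin X U \<Longrightarrow> p \<in> U \<Longrightarrow> \<exists>N. \<forall>t. N < \<bar>t\<bar> \<longrightarrow> \<gamma> t \<in> U"
proof -
  let ?S = "sphere (0::complex) 1"
  obtain h where h: "homeomorphic_map (top_of_set ?S) (subtopology X K) h"
    using K unfolding circle_in_def homeomorphic_space by blast
  have sub: "K \<subseteq> topspace X" using K by (simp add: circle_in_def)
  have img: "h ` ?S = K" using homeomorphic_imp_surjective_map[OF h] sub by (simp add: Int_absorb1)
  have inj: "inj_on h ?S" using homeomorphic_imp_injective_map[OF h] by simp
  have "continuous_map (top_of_set ?S) (subtopology X K) h" by (rule homeomorphic_imp_continuous_map[OF h])
  then have cont: "continuous_map (top_of_set ?S) X h" by (rule continuous_map_into_fulltopology)
  obtain z where z: "z \<in> ?S" "h z = p" using p img by blast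
  define \<gamma> where "\<gamma> = (\<lambda>t. h (z * cayley t))"
  have nz: "z \<noteq> 0" using z(1) by auto
  have zS: "z * cayley t \<in> ?S" for t using z(1) by (simp add: norm_mult norm_cayley)
  have pre: "\<exists>W. open W \<and> {y \<in> ?S. h y \<in> U} = ?S \<inter> W" if "openin X U" for U
    using openin_continuous_map_preimage[OF cont that] by (simp add: openin_open Int_commute)
  show thesis
  proof (rule that[of \<gamma>])
    show "inj \<gamma>"
    proof (rule injI)
      fix s t assume "\<gamma> s = \<gamma> t"
      then have "z * cayley s = z * cayley t" using inj_onD[OF inj _ zS zS] by (simp add: \<gamma>_def)
      then have "cayley s = cayley t" using nz by simp
      then have "cayley_inv (cayley s) = cayley_inv (cayley t)" by simp
      then show "s = t" by simp
    qed
    show "range \<gamma> = K - {p}"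
    proof
      show "range \<gamma> \<subseteq> K - {p}"
      proof
        fix q assume "q \<in> range \<gamma>"
        then obtain t where t: "q = h (z * cayley t)" by (auto simp: \<gamma>_def)
        have "q \<noteq> p"
        proof
          assume "q = p"
          then have "z * cayley t = z" using inj_onD[OF inj _ zS z(1)] t z(2) by simp
          then show False using nz cayley_neq_one[of t] by simp
        qed
        moreover have "q \<in> K" unfolding t img[symmetric] by (rule imageI) (rule zS)
        ultimately show "q \<in> K - {p}" by blast
      qed
      show "K - {p} \<subseteq> range \<gamma>"
      proof
        fix q assume q: "q \<in> K - {p}"
        then obtain y where y: "y \<in> ?S" "q = h y" using img by blast
        have "cmod (y / z) = 1" using y(1) z(1) by (simp add: norm_divide)
        moreover have "y / z \<noteq> 1" using q y(2) z(2) nz by auto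
        ultimately have "cayley (cayley_inv (y / z)) = y / z" by (rule cayley_cayley_inv)
        then have "\<gamma> (cayley_inv (y / z)) = q" using nz by (simp add: \<gamma>_def y(2))
        then show "q \<in> range \<gamma>" by (metis rangeI)
      qed
    qed
    show "open (\<gamma> -` U)" if U: "openin X U" for U
    proof -
      obtain W where W: "open W" "{y \<in> ?S. h y \<in> U} = ?S \<inter> W" using pre[OF U] by blast
      have "\<gamma> t \<in> U \<longleftrightarrow> z * cayley t \<in> W" for t
        using zS[of t] W(2) unfolding \<gamma>_def by blast
      then have eq: "\<gamma> -` U = (\<lambda>t. z * cayley t) -` W" by (intro set_eqI) simp
      have "continuous_on UNIV (\<lambda>t. z * cayley t)" by (intro continuous_intros continuous_cayley)
      then show ?thesis unfolding eq using W(1) by (simp add: open_vimage)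
    qed
    show "\<exists>N. \<forall>t. N < \<bar>t\<bar> \<longrightarrow> \<gamma> t \<in> U" if U: "openin X U" "p \<in> U" for U
    proof -
      obtain W where W: "open W" "{y \<in> ?S. h y \<in> U} = ?S \<inter> W" using pre[OF U(1)] by blast
      have "z \<in> W" using z U(2) W(2) by blast
      then obtain \<delta> where \<delta>: "0 < \<delta>" "ball z \<delta> \<subseteq> W" using W(1) open_contains_ball by blast
      have "\<gamma> t \<in> U" if t: "2 / \<delta> < \<bar>t\<bar>" for t
      proof -
        have "z * cayley t - z = z * (cayley t - 1)" by (simp add: algebra_simps)
        then have "dist (z * cayley t) z = cmod (cayley t - 1)" using z(1) by (simp add: dist_norm norm_mult)
        then have "z * cayley t \<in> ball z \<delta>" using cayley_far[OF \<delta>(1) t] by (simp add: dist_commute)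
        then show ?thesis using \<delta>(2) W(2) zS[of t] unfolding \<gamma>_def by blast
      qed
      then show ?thesis by blast
    qed
  qed
qed

section \<open>Hamilton circles from spanning double rays\<close>

lemma edge_point_0 [simp]: "edge_point u v 0 = vertex_point u"
  and edge_point_1 [simp]: "edge_point u v 1 = vertex_point v"
  by (simp_all add: edge_point_def vertex_point_def)

lemma edge_point_swap: "edge_point u v t = edge_point v u (1 - t)"
  by (simp add: edge_point_def add.commute)

lemma vertex_point_eq: "vertex_point u = vertex_point v \<longleftrightarrow> u = v"
  by (auto simp: vertex_point_def fun_eq_iff indicator_def split: if_splits)

text \<open>An inner point has exactly two nonzero coordinates, which determine the two end vertices
  and the distance up to exchanging the ends.\<close>

lemma edge_point_eqD:
  assumes eq: "edge_point u v t = edge_point u' v' t'" and ne: "u \<noteq> v" "u' \<noteq> v'"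
    and t: "0 < t" "t < 1" "0 \<le> t'" "t' \<le> 1"
  shows "u' = u \<and> v' = v \<and> t' = t \<or> u' = v \<and> v' = u \<and> t' = 1 - t"
proof -
  have c: "(1 - t) * indicator {u} w + t * indicator {v} w =
      (1 - t') * indicator {u'} w + t' * indicator {v'} w" for w
    using eq by (simp add: edge_point_def fun_eq_iff)
  have u: "1 - t = (1 - t') * indicator {u'} u + t' * indicator {v'} u" using c[of u] ne by simp
  have v: "t = (1 - t') * indicator {u'} v + t' * indicator {v'} v" using c[of v] ne by simp
  have "u = u' \<or> u = v'"
  proof (rule ccontr)
    assume "\<not> ?thesis"
    then show False using u t by simp
  qed
  moreover have "v = u' \<or> v = v'"
  proof (rule ccontr)
    assume "\<not> ?thesis"
    then show False using v t by simp
  qed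
  ultimately consider "u = u'" "v = v'" | "u = v'" "v = u'" using ne by blast
  then show ?thesis
  proof cases
    case 1
    then show ?thesis using v ne by simp
  next
    case 2
    then show ?thesis using v ne by simp
  qed
qed

lemma edge_point_vertexD:
  assumes eq: "edge_point u v t = vertex_point w" and ne: "u \<noteq> v"
  shows "t = 0 \<and> w = u \<or> t = 1 \<and> w = v"
proof -
  have c: "(1 - t) * indicator {u} x + t * indicator {v} x = indicator {w} x" for x
    using eq by (simp add: edge_point_def vertex_point_def fun_eq_iff)
  have u: "1 - t = indicator {w} u" using c[of u] ne by simp
  have v: "t = indicator {w} v" using c[of v] ne by simp
  show ?thesis using u v by (cases "w = v") (auto simp: indicator_def split: if_splits)
qed

lemma edge_point_neq_vertex: "u \<noteq> v \<Longrightarrow> 0 < t \<Longrightarrow> t < 1 \<Longrightarrow> edge_point u v t \<noteq> vertex_point w"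
  using edge_point_vertexD[of u v t w] by auto

lemma point_neq_end [simp]: "edge_point u v t \<noteq> End_Point \<epsilon>" "vertex_point v \<noteq> End_Point \<epsilon>"
  "End_Point \<epsilon> \<noteq> edge_point u v t" "End_Point \<epsilon> \<noteq> vertex_point v"
  by (simp_all add: edge_point_def vertex_point_def)

section \<open>The generating sets of the topology\<close>

definition freudenthal_basis :: "'a graph \<Rightarrow> 'a point set set" where
  "freudenthal_basis G = {vertex_nbhd G v \<epsilon> | v \<epsilon>. v \<in> verts G \<and> 0 < \<epsilon> \<and> \<epsilon> \<le> 1} \<union>
      {edge_point u v ` {a<..<b} | u v a b. {u, v} \<in> edges G \<and> 0 \<le> a \<and> a < b \<and> b \<le> 1} \<union>
      {end_nbhd G S \<omega> \<epsilon> | S \<omega> \<epsilon>.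
         finite S \<and> S \<subseteq> verts G \<and> \<omega> \<in> ends G \<and> 0 < \<epsilon> \<and> \<epsilon> \<le> 1}"

lemma freudenthal_eq: "freudenthal G = topology_generated_by (freudenthal_basis G)"
  by (simp add: freudenthal_def freudenthal_basis_def)

lemma basis_vertex:
  "v \<in> verts G \<Longrightarrow> 0 < \<epsilon> \<Longrightarrow> \<epsilon> \<le> 1 \<Longrightarrow> vertex_nbhd G v \<epsilon> \<in> freudenthal_basis G"
  unfolding freudenthal_basis_def
  by (rule UnI1, rule UnI1, rule CollectI, rule exI[of _ v], rule exI[of _ \<epsilon>]) simp

lemma basis_edge:
  "{u, v} \<in> edges G \<Longrightarrow> 0 \<le> a \<Longrightarrow> a < b \<Longrightarrow> b \<le> 1 \<Longrightarrow> edge_point u v ` {a<..<b} \<in> freudenthal_basis G"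
  unfolding freudenthal_basis_def
  by (rule UnI1, rule UnI2, rule CollectI, rule exI[of _ u], rule exI[of _ v], rule exI[of _ a],
      rule exI[of _ b]) simp

lemma basis_end:
  "finite S \<Longrightarrow> S \<subseteq> verts G \<Longrightarrow> \<omega> \<in> ends G \<Longrightarrow> 0 < \<epsilon> \<Longrightarrow> \<epsilon> \<le> 1 \<Longrightarrow>
    end_nbhd G S \<omega> \<epsilon> \<in> freudenthal_basis G"
  unfolding freudenthal_basis_def
  by (rule UnI2, rule CollectI, rule exI[of _ S], rule exI[of _ \<omega>], rule exI[of _ \<epsilon>]) simp

lemma basis_cases:
  assumes "U \<in> freudenthal_basis G"
  obtains v \<epsilon> where "U = vertex_nbhd G v \<epsilon>" "v \<in> verts G" "0 < \<epsilon>" "\<epsilon> \<le> 1"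
  | u v a b where "U = edge_point u v ` {a<..<b}" "{u, v} \<in> edges G" "0 \<le> a" "a < b" "b \<le> 1"
  | S \<omega> \<epsilon> where "U = end_nbhd G S \<omega> \<epsilon>" "finite S" "S \<subseteq> verts G" "\<omega> \<in> ends G" "0 < \<epsilon>" "\<epsilon> \<le> 1"
  using assms unfolding freudenthal_basis_def by (elim UnE CollectE exE conjE) (assumption | rule that)+

lemma vertex_nbhd_cases:
  assumes "x \<in> vertex_nbhd G v \<epsilon>"
  obtains "x = vertex_point v"
  | w t where "x = edge_point v w t" "{v, w} \<in> edges G" "0 < t" "t < \<epsilon>"
proof -
  have "x = vertex_point v \<or> (\<exists>w t. x = edge_point v w t \<and> {v, w} \<in> edges G \<and> 0 \<le> t \<and> t < \<epsilon>)"
    using assms unfolding vertex_nbhd_def by auto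
  then show thesis
  proof (elim disjE exE conjE)
    fix w t assume x: "x = edge_point v w t" "{v, w} \<in> edges G" "0 \<le> t" "t < \<epsilon>"
    show thesis
    proof (cases "t = 0")
      case False
      then show ?thesis using x by (intro that(2)[of w t]) simp_all
    qed (use x that(1) in simp)
  qed (rule that(1))
qed

lemma end_nbhd_mem_iff:
  "x \<in> end_nbhd G S \<omega> \<epsilon> \<longleftrightarrow> (\<exists>v\<in>end_component G S \<omega>. x = vertex_point v) \<or>
    (\<exists>u v t. x = edge_point u v t \<and> {u, v} \<in> edges G \<and> u \<in> end_component G S \<omega> \<and>
      v \<in> end_component G S \<omega> \<and> 0 \<le> t \<and> t \<le> 1) \<or>
    (\<exists>u v t. x = edge_point u v t \<and> {u, v} \<in> edges G \<and> u \<in> end_component G S \<omega> \<and>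
      v \<in> S \<and> 0 < t \<and> t < \<epsilon>) \<or>
    (\<exists>\<omega>'\<in>ends G. x = End_Point \<omega>' \<and> end_component G S \<omega>' = end_component G S \<omega>)"
  unfolding end_nbhd_def Let_def Un_iff image_iff mem_Collect_eq by blast

context one_ended_graph
begin

text \<open>With \<epsilon> \<le> 1, the pieces of edges towards \<open>S\<close> stop before they
  reach \<open>S\<close>.\<close>

lemma vertex_in_end_nbhdD:
  assumes x: "vertex_point v \<in> end_nbhd G S \<omega> \<epsilon>" and "\<epsilon> \<le> 1"
  shows "v \<in> end_component G S \<omega>"
proof -
  show ?thesis
    using x unfolding end_nbhd_mem_iff
  proof (elim disjE bexE exE conjE)
    fix w assume "w \<in> end_component G S \<omega>" "vertex_point v = vertex_point w"
    then show ?thesis by (simp add: vertex_point_eq)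
  next
    fix u w t
    assume 1: "vertex_point v = edge_point u w t" "{u, w} \<in> edges G"
      "u \<in> end_component G S \<omega>" "w \<in> end_component G S \<omega>"
    show ?thesis using edge_point_vertexD[OF 1(1)[symmetric]] edge_verts[OF 1(2)] 1(3,4) by blast
  next
    fix u w t
    assume 1: "vertex_point v = edge_point u w t" "{u, w} \<in> edges G"
      "u \<in> end_component G S \<omega>" "0 < t" "t < \<epsilon>"
    have "t = 0 \<or> t = 1" using edge_point_vertexD[OF 1(1)[symmetric]] edge_verts[OF 1(2)] by blast
    then show ?thesis using 1(4,5) assms(2) by simp
  qed simp
qed

text \<open>The same point is at distance \<open>t\<close> from \<open>u\<close> and
  \<open>1 - t\<close> from \<open>v\<close>, so an edge between the component and \<open>S\<close>
  gives two cases.\<close>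

lemma edge_in_end_nbhd_iff:
  assumes e: "{u, v} \<in> edges G" and t: "0 < t" "t < 1" and "\<epsilon> \<le> 1"
  shows "edge_point u v t \<in> end_nbhd G S \<omega> \<epsilon> \<longleftrightarrow>
    u \<in> end_component G S \<omega> \<and> v \<in> end_component G S \<omega> \<or>
    u \<in> end_component G S \<omega> \<and> v \<in> S \<and> t < \<epsilon> \<or>
    v \<in> end_component G S \<omega> \<and> u \<in> S \<and> 1 - t < \<epsilon>" (is "?L \<longleftrightarrow> ?R")
proof
  let ?C = "end_component G S \<omega>"
  have ne: "u \<noteq> v" using edge_verts[OF e] by simp
  assume ?L
  then consider w where "edge_point u v t = vertex_point w"
    | u' v' t' where "edge_point u v t = edge_point u' v' t'" "{u', v'} \<in> edges G" "u' \<in> ?C" "v' \<in> ?C" "0 \<le> t'" "t' \<le> 1"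
    | u' v' t' where "edge_point u v t = edge_point u' v' t'" "{u', v'} \<in> edges G" "u' \<in> ?C" "v' \<in> S" "0 < t'" "t' < \<epsilon>"
    | \<epsilon> where "edge_point u v t = End_Point \<epsilon>"
    unfolding end_nbhd_mem_iff by blast
  then show ?R
  proof cases
    case 1
    then show ?thesis using edge_point_neq_vertex[OF ne t] by simp
  next
    case (2 u' v' t')
    then show ?thesis using edge_point_eqD[OF 2(1) ne _ t 2(5,6)] edge_verts[OF 2(2)] by blast
  next
    case (3 u' v' t')
    have "0 \<le> t'" "t' \<le> 1" using 3 assms(4) by simp_all
    then have "u' = u \<and> v' = v \<and> t' = t \<or> u' = v \<and> v' = u \<and> t' = 1 - t"
      using edge_point_eqD[OF 3(1) ne _ t] edge_verts[OF 3(2)] by blast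
    then show ?thesis using 3 by auto
  next
    case 4
    then show ?thesis by (simp add: point_neq_end)
  qed
next
  let ?C = "end_component G S \<omega>"
  assume ?R
  then consider "u \<in> ?C" "v \<in> ?C" | "u \<in> ?C" "v \<in> S" "t < \<epsilon>" | "v \<in> ?C" "u \<in> S" "1 - t < \<epsilon>" by blast
  then show ?L
  proof cases
    case 1
    then show ?thesis unfolding end_nbhd_mem_iff using e t
      by - (rule disjI2, rule disjI1, rule exI[of _ u], rule exI[of _ v], rule exI[of _ t], simp)
  next
    case 2
    then show ?thesis unfolding end_nbhd_mem_iff using e t
      by - (rule disjI2, rule disjI2, rule disjI1, rule exI[of _ u], rule exI[of _ v],
            rule exI[of _ t], simp)
  next
    case 3
    then show ?thesis unfolding end_nbhd_mem_iff using e t edge_point_swap[of u v t]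
      by - (rule disjI2, rule disjI2, rule disjI1, rule exI[of _ v], rule exI[of _ u],
            rule exI[of _ "1 - t"], simp add: insert_commute)
  qed
qed

lemma End_Point_in_end_nbhd: "End_Point \<omega> \<in> end_nbhd G S \<omega> \<epsilon>"
  unfolding end_nbhd_mem_iff using one_end by blast

end

section \<open>Parametrizing a spanning double ray by the real line\<close>

locale double_ray_graph = one_ended_graph +
  fixes d :: "int \<Rightarrow> 'a"
  assumes bij: "bij_betw d UNIV (verts G)" and step: "{d n, d (n + 1)} \<in> edges G"
begin

lemma d_eq: "d m = d n \<longleftrightarrow> m = n"
  using bij by (auto simp: bij_betw_def inj_eq)

lemma d_verts: "d n \<in> verts G"
  using bij by (auto simp: bij_betw_def)

lemma d_obtain: assumes "v \<in> verts G" obtains n where "v = d n"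
  using bij assms that by (auto simp: bij_betw_def)

definition param :: "real \<Rightarrow> 'a point" where
  "param s = edge_point (d \<lfloor>s\<rfloor>) (d (\<lfloor>s\<rfloor> + 1)) (frac s)"

lemma param_int [simp]: "param (of_int n) = vertex_point (d n)"
  by (simp add: param_def)

text \<open>The right end is included although the floor jumps there; both formulas give the vertex
  \<open>d (m + 1)\<close>.\<close>

lemma param_segment:
  assumes "of_int m \<le> s" "s \<le> of_int m + 1"
  shows "param s = edge_point (d m) (d (m + 1)) (s - of_int m)"
proof (cases "s = of_int m + 1")
  case True
  then have "s = of_int (m + 1)" by simp
  then show ?thesis by (simp only: param_int) simp
next
  case False
  then have "\<lfloor>s\<rfloor> = m" using assms by (intro floor_unique) auto
  then show ?thesis by (simp add: param_def frac_def)
qed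

lemma real_cases:
  fixes s :: real
  obtains (int) m :: int where "s = of_int m" | (nonint) m :: int where "of_int m < s" "s < of_int m + 1"
proof (cases "s = of_int \<lfloor>s\<rfloor>")
  case False
  then have "of_int \<lfloor>s\<rfloor> < s" "s < of_int \<lfloor>s\<rfloor> + 1"
    using of_int_floor_le[of s] floor_less_iff[of s "\<lfloor>s\<rfloor> + 1"] by linarith+
  then show thesis by (rule nonint)
qed (rule int)

lemma param_nonint:
  assumes "of_int m < s" "s < of_int m + 1"
  shows "param s = edge_point (d m) (d (m + 1)) (s - of_int m)" "param s \<noteq> vertex_point w"
proof -
  show *: "param s = edge_point (d m) (d (m + 1)) (s - of_int m)" using assms by (intro param_segment) simp_all
  show "param s \<noteq> vertex_point w" unfolding * using assms d_eq[of m "m + 1"]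
    by (intro edge_point_neq_vertex) simp_all
qed

lemma param_eq_edge:
  assumes s: "param s = edge_point u v t" and e: "u \<noteq> v" and t: "0 < t" "t < 1"
  obtains m where "u = d m" "v = d (m + 1)" "s = of_int m + t" | m where "u = d (m + 1)" "v = d m" "s = of_int m + 1 - t"
proof (cases s rule: real_cases)
  case (int m)
  then show ?thesis using s edge_point_neq_vertex[OF e t, of "d m"] by simp
next
  case (nonint m)
  have "d m \<noteq> d (m + 1)" using d_eq by simp
  then have "d m = u \<and> d (m + 1) = v \<and> s - of_int m = t \<or> d m = v \<and> d (m + 1) = u \<and> s - of_int m = 1 - t"
    using edge_point_eqD[of u v t "d m" "d (m + 1)" "s - of_int m"] e t nonint
      param_nonint(1)[OF nonint] s by simp
  then show ?thesis
  proof (elim disjE conjE)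
    assume "d m = u" "d (m + 1) = v" "s - of_int m = t"
    then show ?thesis by (intro that(1)[of m]) simp_all
  next
    assume "d m = v" "d (m + 1) = u" "s - of_int m = 1 - t"
    then show ?thesis by (intro that(2)[of m]) simp_all
  qed
qed

lemma param_eq_vertex:
  assumes "param s = vertex_point (d n)" shows "s = of_int n"
proof (cases s rule: real_cases)
  case (int m)
  then show ?thesis using assms by (simp add: vertex_point_eq d_eq)
next
  case (nonint m)
  then show ?thesis using param_nonint(2)[OF nonint, of "d n"] assms by blast
qed

lemma inj_param: "inj param"
proof (rule injI)
  fix s t assume eq: "param s = param t"
  show "s = t"
  proof (cases t rule: real_cases)
    case (int n)
    then show ?thesis using param_eq_vertex[of s n] eq by simp
  next
    case (nonint n)
    have ne: "d n \<noteq> d (n + 1)" using d_eq by simp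
    have t: "0 < t - of_int n" "t - of_int n < 1" using nonint by simp_all
    have "param s = edge_point (d n) (d (n + 1)) (t - of_int n)"
      unfolding eq by (rule param_nonint(1)[OF nonint])
    then show ?thesis
    proof (rule param_eq_edge[OF _ ne t])
      fix m assume "d n = d m" "s = of_int m + (t - of_int n)"
      then show ?thesis by (simp add: d_eq)
    next
      fix m assume "d n = d (m + 1)" "d (n + 1) = d m"
      then have "n = m + 1" "n + 1 = m" by (simp_all only: d_eq)
      then show ?thesis by simp
    qed
  qed
qed

text \<open>The neighbourhood may also contain pieces of edges off the double ray, but
  \<open>param\<close> meets these only in \<open>d k\<close>.\<close>

lemma param_vertex_nbhd:
  assumes \<epsilon>: "0 < \<epsilon>" "\<epsilon> \<le> 1"
  shows "param s \<in> vertex_nbhd G (d k) \<epsilon> \<longleftrightarrow> \<bar>s - of_int k\<bar> < \<epsilon>"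
proof
  assume "param s \<in> vertex_nbhd G (d k) \<epsilon>"
  then show "\<bar>s - of_int k\<bar> < \<epsilon>"
  proof (cases rule: vertex_nbhd_cases)
    case 1
    then show ?thesis using param_eq_vertex \<epsilon> by simp
  next
    case (2 w t)
    have "d k \<noteq> w" "t < 1" using edge_verts[OF 2(2)] 2(4) \<epsilon> by simp_all
    from 2(1) this(1) 2(3) this(2) show ?thesis
    proof (rule param_eq_edge)
      fix m assume "d k = d m" "s = of_int m + t"
      then show ?thesis using 2 by (simp add: d_eq)
    next
      fix m assume "d k = d (m + 1)" "s = of_int m + 1 - t"
      then show ?thesis using 2 by (simp add: d_eq)
    qed
  qed
next
  assume s: "\<bar>s - of_int k\<bar> < \<epsilon>"
  show "param s \<in> vertex_nbhd G (d k) \<epsilon>"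
  proof (cases "of_int k \<le> s")
    case True
    then have "param s = edge_point (d k) (d (k + 1)) (s - of_int k)"
      using s \<epsilon> by (intro param_segment) linarith+
    moreover have "0 \<le> s - of_int k" "s - of_int k < \<epsilon>" using True s by linarith+
    ultimately show ?thesis unfolding vertex_nbhd_def using step[of k] by blast
  next
    case False
    then have "of_int (k - 1) \<le> s" "s \<le> of_int (k - 1) + 1" using s \<epsilon> by (simp_all add: abs_less_iff)
    then have "param s = edge_point (d (k - 1)) (d (k - 1 + 1)) (s - of_int (k - 1))"
      by (rule param_segment)
    then have "param s = edge_point (d k) (d (k - 1)) (of_int k - s)"
      using edge_point_swap[of "d (k - 1)" "d k" "s - of_int (k - 1)"] by simp
    moreover have "0 \<le> of_int k - s" "of_int k - s < \<epsilon>" using False s by linarith+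
    moreover have "{d k, d (k - 1)} \<in> edges G" using step[of "k - 1"] by (simp add: insert_commute)
    ultimately show ?thesis unfolding vertex_nbhd_def by blast
  qed
qed

lemma open_param_edge:
  assumes e: "{u, v} \<in> edges G" and ab: "0 \<le> a" "b \<le> 1"
  shows "open (param -` edge_point u v ` {a<..<b})"
proof (rule Topological_Spaces.openI)
  fix s assume "s \<in> param -` edge_point u v ` {a<..<b}"
  then obtain t where t: "param s = edge_point u v t" "a < t" "t < b" by auto
  have "u \<noteq> v" "0 < t" "t < 1" using edge_verts[OF e] t ab by simp_all
  from t(1) this show "\<exists>T. open T \<and> s \<in> T \<and> T \<subseteq> param -` edge_point u v ` {a<..<b}"
  proof (rule param_eq_edge)
    fix m assume m: "u = d m" "v = d (m + 1)" "s = of_int m + t"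
    have "param y = edge_point u v (y - of_int m)" if "y \<in> {of_int m + a<..<of_int m + b}" for y
      using that ab unfolding m(1,2) by (intro param_segment) auto
    then have "{of_int m + a<..<of_int m + b} \<subseteq> param -` edge_point u v ` {a<..<b}"
      by (intro subsetI vimageI2) (auto intro!: image_eqI)
    then show ?thesis using m(3) t by (intro exI[of _ "{of_int m + a<..<of_int m + b}"]) simp
  next
    fix m assume m: "u = d (m + 1)" "v = d m" "s = of_int m + 1 - t"
    have "param y = edge_point u v (of_int m + 1 - y)" if "y \<in> {of_int m + 1 - b<..<of_int m + 1 - a}" for y
    proof -
      have "param y = edge_point (d m) (d (m + 1)) (y - of_int m)"
        using that ab by (intro param_segment) auto
      then show ?thesis using edge_point_swap[of "d m" "d (m + 1)" "y - of_int m"]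
        unfolding m(1,2) by (simp add: algebra_simps)
    qed
    then have "{of_int m + 1 - b<..<of_int m + 1 - a} \<subseteq> param -` edge_point u v ` {a<..<b}"
      by (intro subsetI vimageI2) (auto intro!: image_eqI)
    then show ?thesis using m(3) t by (intro exI[of _ "{of_int m + 1 - b<..<of_int m + 1 - a}"]) simp
  qed
qed

text \<open>Next to a vertex of the component the double ray continues in the component or in
  \<open>S\<close>, so radius \<epsilon> fits at integers. Strictly between integers, the preimage
  is the whole open segment or the part within \<epsilon> of an end in the component.\<close>

lemma open_param_end:
  assumes S: "finite S" "S \<subseteq> verts G" and \<epsilon>: "0 < \<epsilon>" "\<epsilon> \<le> 1"
  shows "open (param -` end_nbhd G S \<omega> \<epsilon>)"
proof (rule Topological_Spaces.openI)
  let ?C = "end_component G S \<omega>" and ?P = "param -` end_nbhd G S \<omega> \<epsilon>"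
  have mem: "param y \<in> end_nbhd G S \<omega> \<epsilon> \<longleftrightarrow> d m \<in> ?C \<and> d (m + 1) \<in> ?C \<or>
      d m \<in> ?C \<and> d (m + 1) \<in> S \<and> y - of_int m < \<epsilon> \<or> d (m + 1) \<in> ?C \<and> d m \<in> S \<and> 1 - (y - of_int m) < \<epsilon>"
    if "of_int m < y" "y < of_int m + 1" for y m
    unfolding param_nonint(1)[OF that] using that by (intro edge_in_end_nbhd_iff step \<epsilon>(2)) simp_all
  have closed: "d n \<in> ?C \<or> d n \<in> S" if "d m \<in> ?C" "n = m + 1 \<or> m = n + 1" for m n
    using end_component_closed[OF S that(1), of "d n"] that(2) step[of m] step[of n] by (auto simp: insert_commute)
  fix s assume s: "s \<in> ?P"
  show "\<exists>T. open T \<and> s \<in> T \<and> T \<subseteq> ?P"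
  proof (cases s rule: real_cases)
    case (int k)
    then have k: "d k \<in> ?C" using s vertex_in_end_nbhdD \<epsilon>(2) by simp
    have "y \<in> ?P" if y: "y \<in> {s - \<epsilon><..<s + \<epsilon>}" for y
    proof -
      consider "y = s" | "s < y" | "y < s" by linarith
      then have "param y \<in> end_nbhd G S \<omega> \<epsilon>"
      proof cases
        case 1
        then show ?thesis using s by simp
      next
        case 2
        then have "of_int k < y" "y < of_int k + 1" "y - of_int k < \<epsilon>" using y int \<epsilon> by simp_all
        then show ?thesis using mem[of k y] k closed[OF k, of "k + 1"] by blast
      next
        case 3
        then have y': "of_int (k - 1) < y" "y < of_int (k - 1) + 1" "1 - (y - of_int (k - 1)) < \<epsilon>"
          using y int \<epsilon> by simp_all
        have "d (k - 1 + 1) \<in> ?C" using k by simp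
        moreover have "d (k - 1) \<in> ?C \<or> d (k - 1) \<in> S" by (rule closed[OF k]) simp
        ultimately show ?thesis unfolding mem[OF y'(1,2)] using y'(3) by blast
      qed
      then show ?thesis by simp
    qed
    then show ?thesis using \<epsilon>(1) by (intro exI[of _ "{s - \<epsilon><..<s + \<epsilon>}"]) auto
  next
    case (nonint m)
    have "param s \<in> end_nbhd G S \<omega> \<epsilon>" using s by simp
    then consider "d m \<in> ?C" "d (m + 1) \<in> ?C"
      | "d m \<in> ?C" "d (m + 1) \<in> S" "s - of_int m < \<epsilon>"
      | "d (m + 1) \<in> ?C" "d m \<in> S" "1 - (s - of_int m) < \<epsilon>"
      unfolding mem[OF nonint] by blast
    then show ?thesis
    proof cases
      case 1
      then have "{of_int m<..<of_int m + 1} \<subseteq> ?P" using mem by auto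
      then show ?thesis using nonint by (intro exI[of _ "{of_int m<..<of_int m + 1}"]) simp
    next
      case 2
      then have "{of_int m<..<of_int m + \<epsilon>} \<subseteq> ?P" using mem[of m] \<epsilon>(2) by auto
      then show ?thesis using nonint 2 by (intro exI[of _ "{of_int m<..<of_int m + \<epsilon>}"]) simp
    next
      case 3
      then have "{of_int m + 1 - \<epsilon><..<of_int m + 1} \<subseteq> ?P" using mem[of m] \<epsilon>(2) by auto
      then show ?thesis using nonint 3 by (intro exI[of _ "{of_int m + 1 - \<epsilon><..<of_int m + 1}"]) simp
    qed
  qed
qed

lemma ray_forward: "ray G (\<lambda>i. d (int i))"
proof -
  have "{d (int i), d (int (Suc i))} \<in> edges G" for i
    using step[of "int i"] by (simp add: add.commute)
  then show ?thesis unfolding ray_def using d_verts by (simp add: inj_def d_eq)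
qed

lemma ray_backward: "ray G (\<lambda>i. d (- int i))"
proof -
  have "{d (- int i), d (- int (Suc i))} \<in> edges G" for i
    using step[of "- int (Suc i)"] by (simp add: insert_commute)
  then show ?thesis unfolding ray_def using d_verts by (simp add: inj_def d_eq)
qed

lemma param_end_far:
  assumes S: "finite S" "S \<subseteq> verts G" and \<epsilon>: "0 < \<epsilon>" "\<epsilon> \<le> 1"
  shows "\<exists>N. \<forall>t. N < \<bar>t\<bar> \<longrightarrow> param t \<in> end_nbhd G S \<omega> \<epsilon>"
proof -
  let ?C = "end_component G S \<omega>"
  obtain n1 where n1: "\<And>i. n1 \<le> i \<Longrightarrow> d (int i) \<in> ?C"
    using end_component(2)[OF S ray_forward] by (auto simp: has_tail_in_def)
  obtain n2 where n2: "\<And>i. n2 \<le> i \<Longrightarrow> d (- int i) \<in> ?C"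
    using end_component(2)[OF S ray_backward] by (auto simp: has_tail_in_def)
  have C: "d m \<in> ?C" if "int (n1 + n2) \<le> \<bar>m\<bar>" for m
    using n1[of "nat m"] n2[of "nat (- m)"] that by (cases "0 \<le> m") auto
  \<comment> \<open>The extra 1 keeps both ends of the edge containing \<open>param t\<close> beyond
    both thresholds.\<close>
  have "param t \<in> end_nbhd G S \<omega> \<epsilon>" if t: "real (n1 + n2 + 1) < \<bar>t\<bar>" for t
  proof (cases t rule: real_cases)
    case (int m)
    then have "int (n1 + n2) \<le> \<bar>m\<bar>" using t by linarith
    then show ?thesis using C int unfolding end_nbhd_mem_iff by auto
  next
    case (nonint m)
    then have "int (n1 + n2) \<le> \<bar>m\<bar>" "int (n1 + n2) \<le> \<bar>m + 1\<bar>" using t by linarith+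
    then have "d m \<in> ?C" "d (m + 1) \<in> ?C" using C by blast+
    then show ?thesis unfolding param_nonint(1)[OF nonint]
      using nonint \<epsilon>(2) by (subst edge_in_end_nbhd_iff[OF step]) simp_all
  qed
  then show ?thesis by blast
qed

text \<open>A point of the neighbourhood on an edge needs an end of that edge in the component, but
  for \<bar>t\<bar> \<le> n both ends, or the vertex itself, have been deleted.\<close>

lemma param_end_near:
  assumes "param t \<in> end_nbhd G (d ` {-int n..int n}) \<omega> 1" shows "real n < \<bar>t\<bar>"
proof (rule ccontr)
  let ?S = "d ` {-int n..int n}"
  have "?S \<subseteq> verts G" using d_verts by auto
  then have disj: "end_component G ?S \<omega> \<inter> ?S = {}" using end_component_subset[of ?S] by auto
  assume "\<not> ?thesis"
  then have t: "\<bar>t\<bar> \<le> real n" by simp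
  show False
  proof (cases t rule: real_cases)
    case (int m)
    then have "d m \<in> ?S" using t by (intro imageI) auto
    moreover have "d m \<in> end_component G ?S \<omega>" using assms int vertex_in_end_nbhdD by simp
    ultimately show False using disj by blast
  next
    case (nonint m)
    then have "m \<in> {-int n..int n}" "m + 1 \<in> {-int n..int n}" using t by (auto; linarith)+
    then have "d m \<in> ?S" "d (m + 1) \<in> ?S" by blast+
    moreover have "d m \<in> end_component G ?S \<omega> \<or> d (m + 1) \<in> end_component G ?S \<omega>"
      using assms nonint unfolding param_nonint(1)[OF nonint]
      by (subst (asm) edge_in_end_nbhd_iff[OF step]) auto
    ultimately show False using disj by blast
  qed
qed

lemma circle_param: "circle_in (freudenthal G) (insert (End_Point \<omega>) (range param))"
  unfolding freudenthal_eq
proof (rule circle_inI)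
  let ?B = "freudenthal_basis G"
  have \<omega>: "\<omega> \<in> ends G" using one_end by simp
  have End: "End_Point \<omega> \<notin> vertex_nbhd G v \<epsilon>" "End_Point \<omega> \<notin> edge_point u v ` A" for u v \<epsilon> A
    by (auto simp: vertex_nbhd_def)
  show "inj param" by (rule inj_param)
  show "End_Point \<omega> \<notin> range param" by (auto simp: param_def)
  show "insert (End_Point \<omega>) (range param) \<subseteq> \<Union>?B"
  proof (intro insert_subsetI subsetI)
    show "End_Point \<omega> \<in> \<Union>?B"
      by (rule UnionI[OF basis_end[OF _ _ \<omega>, of "{}" 1] End_Point_in_end_nbhd]) simp_all
    fix x assume "x \<in> range param"
    then obtain s where s: "x = param s" by blast
    have "x \<in> vertex_nbhd G (d \<lfloor>s\<rfloor>) 1"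
      unfolding s by (subst param_vertex_nbhd) (simp_all, linarith)
    then show "x \<in> \<Union>?B" using basis_vertex[OF d_verts, of 1 "\<lfloor>s\<rfloor>"] by auto
  qed
  show "open (param -` U)" if "U \<in> ?B" for U
    using that
  proof (cases rule: basis_cases)
    case (1 v \<epsilon>)
    obtain k where k: "v = d k" using d_obtain[OF 1(2)] .
    have "param -` U = {of_int k - \<epsilon><..<of_int k + \<epsilon>}"
      unfolding 1(1) k using param_vertex_nbhd[OF 1(3,4)] by (auto simp: abs_less_iff)
    then show ?thesis by simp
  next
    case (2 u v a b)
    show ?thesis unfolding 2(1) by (rule open_param_edge[OF 2(2,3,5)])
  next
    case (3 S \<omega>' \<epsilon>)
    then have "\<omega>' = \<omega>" using one_end by simp
    then show ?thesis unfolding 3(1) using open_param_end[OF 3(2,3,5,6)] by simp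
  qed
  show "\<exists>N. \<forall>t. N < \<bar>t\<bar> \<longrightarrow> param t \<in> U" if "U \<in> ?B" "End_Point \<omega> \<in> U" for U
    using that(1)
  proof (cases rule: basis_cases)
    case (3 S \<omega>' \<epsilon>)
    then have "\<omega>' = \<omega>" using one_end by simp
    then show ?thesis unfolding 3(1) using param_end_far[OF 3(2,3,5,6)] by simp
  qed (use that(2) End in blast)+
  show "\<exists>U\<in>?B. param s \<in> U \<and> End_Point \<omega> \<notin> U \<and> param -` U \<subseteq> {s - \<eta><..<s + \<eta>}"
    if \<eta>: "0 < \<eta>" for s \<eta>
  proof (cases s rule: real_cases)
    case (int k)
    let ?\<epsilon> = "min \<eta> 1"
    have \<epsilon>: "0 < ?\<epsilon>" "?\<epsilon> \<le> 1" using \<eta> by simp_all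
    have "param -` vertex_nbhd G (d k) ?\<epsilon> \<subseteq> {s - \<eta><..<s + \<eta>}"
      using param_vertex_nbhd[OF \<epsilon>] int by (auto simp: abs_less_iff)
    moreover have "param s \<in> vertex_nbhd G (d k) ?\<epsilon>" unfolding param_vertex_nbhd[OF \<epsilon>] using int \<eta> by simp
    ultimately show ?thesis
      by (intro bexI[of _ "vertex_nbhd G (d k) ?\<epsilon>"] conjI End(1) basis_vertex[OF d_verts \<epsilon>])
  next
    case (nonint m)
    define a b where "a = max 0 (s - of_int m - \<eta>)" and "b = min 1 (s - of_int m + \<eta>)"
    have ab: "0 \<le> a" "a < s - of_int m" "s - of_int m < b" "b \<le> 1"
      "s - of_int m - \<eta> \<le> a" "b \<le> s - of_int m + \<eta>"
      using nonint \<eta> by (auto simp: a_def b_def)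
    let ?U = "edge_point (d m) (d (m + 1)) ` {a<..<b}"
    have "?U \<in> ?B" using ab by (intro basis_edge step) linarith+
    moreover have "param s \<in> ?U" unfolding param_nonint(1)[OF nonint] using ab by (intro imageI) simp
    moreover have "param -` ?U \<subseteq> {s - \<eta><..<s + \<eta>}"
    proof
      fix y assume "y \<in> param -` ?U"
      then obtain t where t: "param y = edge_point (d m) (d (m + 1)) t" "a < t" "t < b" by auto
      have "d m \<noteq> d (m + 1)" "0 < t" "t < 1" using t ab by (simp_all add: d_eq)
      from t(1) this show "y \<in> {s - \<eta><..<s + \<eta>}"
      proof (rule param_eq_edge)
        fix n assume "d m = d n" "y = of_int n + t"
        then show ?thesis using t ab by (simp add: d_eq)
      next
        fix n assume "d m = d (n + 1)" "d (m + 1) = d n"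
        then have "m = n + 1" "m + 1 = n" by (simp_all only: d_eq)
        then show ?thesis by simp
      qed
    qed
    ultimately show ?thesis by (intro bexI[of _ ?U] conjI End(2))
  qed
  show "\<exists>U\<in>?B. End_Point \<omega> \<in> U \<and> param -` U \<subseteq> {t. N < \<bar>t\<bar>}" for N
  proof -
    obtain n where n: "N \<le> real n" using real_arch_simple by blast
    let ?S = "d ` {-int n..int n}"
    have "end_nbhd G ?S \<omega> 1 \<in> ?B" using d_verts by (intro basis_end \<omega>) auto
    moreover have "param -` end_nbhd G ?S \<omega> 1 \<subseteq> {t. N < \<bar>t\<bar>}"
      using param_end_near n by fastforce
    ultimately show ?thesis
      by (intro bexI[of _ "end_nbhd G ?S \<omega> 1"] conjI End_Point_in_end_nbhd)
  qed
qed

theorem hamilton_cycle_of_double_ray: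
  "\<exists>H. hamilton_cycle G H \<and> edges H = range (\<lambda>n. {d n, d (n + 1)})"
proof -
  let ?K = "insert (End_Point \<omega>) (range param)"
  have "vertex_point ` verts G \<subseteq> range param"
  proof
    fix x assume "x \<in> vertex_point ` verts G"
    then obtain n where "x = vertex_point (d n)" by (auto elim: d_obtain)
    then show "x \<in> range param" by (metis param_int rangeI)
  qed
  then have "hamilton_circle G ?K" using circle_param one_end by (auto simp: hamilton_circle_def)
  then have "hamilton_cycle G (subgraph_in G ?K)" by (auto simp: hamilton_cycle_def)
  moreover have "edges (subgraph_in G ?K) = range (\<lambda>n. {d n, d (n + 1)})"
  proof (intro equalityI subsetI)
    fix e assume "e \<in> edges (subgraph_in G ?K)"
    then have e: "e \<in> edges G" "\<And>u v t. e = {u, v} \<Longrightarrow> 0 \<le> t \<Longrightarrow> t \<le> 1 \<Longrightarrow> edge_point u v t \<in> ?K"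
      by (auto simp: subgraph_in_def)
    obtain u v where uv: "e = {u, v}" "u \<noteq> v" using e(1) simple unfolding simple_graph_def by blast
    \<comment> \<open>The midpoint decides: the end vertices of every edge lie on the circle
      anyway.\<close>
    have "edge_point u v (1/2) \<in> ?K" using e(2)[OF uv(1)] by simp
    then have "edge_point u v (1/2) \<in> range param" by simp
    then obtain s where "param s = edge_point u v (1/2)" by (metis rangeE)
    then show "e \<in> range (\<lambda>n. {d n, d (n + 1)})"
      by (rule param_eq_edge[OF _ uv(2)]) (auto simp: uv(1) insert_commute)
  next
    fix e assume "e \<in> range (\<lambda>n. {d n, d (n + 1)})"
    then obtain n where n: "e = {d n, d (n + 1)}" by blast
    have seg: "edge_point (d n) (d (n + 1)) t \<in> ?K" if "0 \<le> t" "t \<le> 1" for t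
      using param_segment[of n "of_int n + t"] that by simp (metis rangeI)
    have "edge_point u v t \<in> ?K" if uv: "e = {u, v}" and t: "0 \<le> t" "t \<le> 1" for u v t
    proof -
      have "u = d n \<and> v = d (n + 1) \<or> u = d (n + 1) \<and> v = d n" using uv n by (auto simp: doubleton_eq_iff)
      then show ?thesis
      proof (elim disjE conjE)
        assume uv: "u = d n" "v = d (n + 1)"
        show ?thesis unfolding uv by (rule seg[OF t])
      next
        assume uv: "u = d (n + 1)" "v = d n"
        show ?thesis unfolding uv edge_point_swap[of "d (n + 1)"] using t by (intro seg) simp_all
      qed
    qed
    then show "e \<in> edges (subgraph_in G ?K)" using n step by (simp add: subgraph_in_def)
  qed
  ultimately show ?thesis by blast
qed

end

section \<open>Spanning double rays from Hamilton circles\<close>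

text \<open>Local finiteness and unboundedness give every real a next and a previous element of
  \<open>Z\<close>, which are iterated from one base point.\<close>

lemma int_enumeration:
  fixes Z :: "real set"
  assumes fin: "\<And>a b. finite (Z \<inter> {a..b})" and up: "\<And>M. \<exists>z\<in>Z. M < z" and down: "\<And>M. \<exists>z\<in>Z. z < M"
  obtains \<zeta> :: "int \<Rightarrow> real" where "strict_mono \<zeta>" "range \<zeta> = Z"
proof -
  have "\<exists>y\<in>Z. x < y \<and> (\<forall>z\<in>Z. x < z \<longrightarrow> y \<le> z)" for x
  proof -
    obtain b where b: "b \<in> Z" "x < b" using up by blast
    let ?F = "{z \<in> Z \<inter> {x..b}. x < z}"
    have "finite ?F" by (rule finite_subset[OF _ fin[of x b]]) auto
    moreover have "b \<in> ?F" using b by simp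
    ultimately have F: "finite ?F" "b \<in> ?F" .
    then have m: "Min ?F \<in> ?F" by (intro Min_in) auto
    have "Min ?F \<le> z" if "z \<in> Z" "x < z" for z
    proof (cases "z \<le> b")
      case True
      then show ?thesis using that F(1) by (intro Min_le) simp_all
    next
      case False
      then show ?thesis using m by simp
    qed
    then show ?thesis using m by blast
  qed
  then obtain nx where nx: "\<And>x. nx x \<in> Z" "\<And>x. x < nx x" "\<And>x z. z \<in> Z \<Longrightarrow> x < z \<Longrightarrow> nx x \<le> z" by metis
  have "\<exists>y\<in>Z. y < x \<and> (\<forall>z\<in>Z. z < x \<longrightarrow> z \<le> y)" for x
  proof -
    obtain a where a: "a \<in> Z" "a < x" using down by blast
    let ?F = "{z \<in> Z \<inter> {a..x}. z < x}"
    have "finite ?F" by (rule finite_subset[OF _ fin[of a x]]) auto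
    moreover have "a \<in> ?F" using a by simp
    ultimately have F: "finite ?F" "a \<in> ?F" .
    then have m: "Max ?F \<in> ?F" by (intro Max_in) auto
    have "z \<le> Max ?F" if "z \<in> Z" "z < x" for z
    proof (cases "a \<le> z")
      case True
      then show ?thesis using that F(1) by (intro Max_ge) simp_all
    next
      case False
      then show ?thesis using m by simp
    qed
    then show ?thesis using m by blast
  qed
  then obtain pv where pv: "\<And>x. pv x \<in> Z" "\<And>x. pv x < x" "\<And>x z. z \<in> Z \<Longrightarrow> z < x \<Longrightarrow> z \<le> pv x" by metis
  \<comment> \<open>\<open>nx 0\<close> is a base point that surely lies in \<open>Z\<close>; 0
    itself may not.\<close>
  define \<zeta> where "\<zeta> = (\<lambda>n. if 0 \<le> n then (nx ^^ nat n) (nx 0) else (pv ^^ nat (- n)) (nx 0))"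
  have \<zeta>_pos: "\<zeta> (int (Suc k)) = nx (\<zeta> (int k))" for k by (simp add: \<zeta>_def nat_add_distrib)
  have \<zeta>_neg: "\<zeta> (- int (Suc k)) = pv (\<zeta> (- int k))" for k
    by (cases k) (simp_all add: \<zeta>_def nat_add_distrib)
  have \<zeta>0: "\<zeta> 0 = nx 0" by (simp add: \<zeta>_def)
  have step: "\<zeta> n < \<zeta> (n + 1)" for n
  proof (cases "0 \<le> n")
    case True
    then show ?thesis using \<zeta>_pos[of "nat n"] nx(2)[of "\<zeta> n"] by (simp add: add.commute)
  next
    case False
    define k where "k = nat (- n - 1)"
    have k: "n = - int (Suc k)" "n + 1 = - int k" using False by (simp_all add: k_def)
    show ?thesis unfolding k(2) unfolding k(1) \<zeta>_neg by (rule pv(2))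
  qed
  have mono: "strict_mono \<zeta>"
  proof (rule strict_monoI)
    fix m n :: int assume "m < n"
    then have "m + 1 \<le> n" by simp
    then show "\<zeta> m < \<zeta> n"
    proof (induction n rule: int_ge_induct)
      case (step n)
      then show ?case using \<open>\<And>n. \<zeta> n < \<zeta> (n + 1)\<close>[of n] by simp
    qed (rule step)
  qed
  have in_Z: "\<zeta> n \<in> Z" for n
  proof (cases "0 \<le> n")
    case True
    then show ?thesis using \<zeta>0 nx(1) \<zeta>_pos by (cases "nat n") (metis int_nat_eq of_nat_0, metis int_nat_eq)
  next
    case False
    then have "n = - int (Suc (nat (- n - 1)))" by simp
    then show ?thesis using \<zeta>_neg pv(1) by metis
  qed
  have onto: "z \<in> range \<zeta>" if z: "z \<in> Z" for z
  proof (rule ccontr)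
    assume no: "z \<notin> range \<zeta>"
    then have ne: "\<zeta> n \<noteq> z" for n by blast
    \<comment> \<open>A missed \<open>z\<close> would trap all points of one half of the enumeration
      in a bounded interval, against local finiteness.\<close>
    have inf: False if "finite (\<zeta> ` f ` UNIV)" "inj f" for f :: "nat \<Rightarrow> int"
    proof -
      have "inj (\<lambda>k. \<zeta> (f k))" using that(2) strict_mono_eq[OF mono] by (auto simp: inj_def)
      then have "infinite (range (\<lambda>k. \<zeta> (f k)))" by (rule range_inj_infinite)
      then show False using that(1) by (simp add: image_image)
    qed
    show False
    proof (cases "\<zeta> 0 < z")
      case True
      have "\<zeta> 0 \<le> \<zeta> (int k) \<and> \<zeta> (int k) < z" for k
      proof (induction k)
        case (Suc k)
        have "nx (\<zeta> (int k)) \<le> z" using nx(3)[OF z] Suc by blast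
        then have "\<zeta> (int (Suc k)) < z" using ne[of "int (Suc k)"] unfolding \<zeta>_pos by simp
        moreover have "\<zeta> 0 \<le> \<zeta> (int (Suc k))" using Suc nx(2)[of "\<zeta> (int k)"] unfolding \<zeta>_pos by simp
        ultimately show ?case by blast
      qed (use True in simp)
      then have "\<zeta> ` int ` UNIV \<subseteq> Z \<inter> {\<zeta> 0..z}" using in_Z by (force intro: less_imp_le)
      then have "finite (\<zeta> ` int ` UNIV)" using fin by (rule finite_subset)
      then show False by (rule inf) simp
    next
      case False
      then have z0: "z < \<zeta> 0" using ne[of 0] by simp
      have "\<zeta> (- int k) \<le> \<zeta> 0 \<and> z < \<zeta> (- int k)" for k
      proof (induction k)
        case (Suc k)
        have "z \<le> pv (\<zeta> (- int k))" using pv(3)[OF z] Suc by blast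
        then have "z < \<zeta> (- int (Suc k))" using ne[of "- int (Suc k)"] unfolding \<zeta>_neg by simp
        moreover have "\<zeta> (- int (Suc k)) \<le> \<zeta> 0" using Suc pv(2)[of "\<zeta> (- int k)"] unfolding \<zeta>_neg by simp
        ultimately show ?case by blast
      qed (use z0 in simp)
      then have "\<zeta> ` (\<lambda>k. - int k) ` UNIV \<subseteq> Z \<inter> {z..\<zeta> 0}" using in_Z by (force intro: less_imp_le)
      then have "finite (\<zeta> ` (\<lambda>k. - int k) ` UNIV)" using fin by (rule finite_subset)
      then show False by (rule inf) (simp add: inj_def)
    qed
  qed
  show thesis by (rule that[OF mono]) (use in_Z onto in blast)
qed

context one_ended_graph
begin

text \<open>Indexed by the unoriented edge, so that different indices give disjoint sets.\<close>

definition open_edge :: "'a set \<Rightarrow> 'a point set" where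
  "open_edge e = {x. \<exists>u v t. e = {u, v} \<and> x = edge_point u v t \<and> 0 < t \<and> t < 1}"

lemma open_edge_eq: "open_edge {u, v} = edge_point u v ` {0<..<1}"
proof
  show "edge_point u v ` {0<..<1} \<subseteq> open_edge {u, v}"
  proof
    fix x assume "x \<in> edge_point u v ` {0<..<1}"
    then obtain t where "x = edge_point u v t" "0 < t" "t < 1" by auto
    then show "x \<in> open_edge {u, v}" unfolding open_edge_def by blast
  qed
  show "open_edge {u, v} \<subseteq> edge_point u v ` {0<..<1}"
  proof
    fix x assume "x \<in> open_edge {u, v}"
    then obtain u' v' t where x: "{u, v} = {u', v'}" "x = edge_point u' v' t" "0 < t" "t < 1"
      by (auto simp: open_edge_def)
    have "u = u' \<and> v = v' \<or> u = v' \<and> v = u'" using x(1) by (simp add: doubleton_eq_iff)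
    then show "x \<in> edge_point u v ` {0<..<1}"
    proof (elim disjE conjE)
      assume "u = u'" "v = v'"
      then show ?thesis using x by (intro image_eqI[of _ _ t]) simp_all
    next
      assume "u = v'" "v = u'"
      then show ?thesis using x edge_point_swap[of u' v' t] by (intro image_eqI[of _ _ "1 - t"]) simp_all
    qed
  qed
qed

lemma openin_basis: "U \<in> freudenthal_basis G \<Longrightarrow> openin (freudenthal G) U"
  unfolding freudenthal_eq by (rule topology_generated_by_Basis)

lemma edge_obtain: assumes "e \<in> edges G" obtains u v where "e = {u, v}" "u \<noteq> v" "u \<in> verts G" "v \<in> verts G"
  using assms simple unfolding simple_graph_def by blast

lemma openin_open_edge: assumes "e \<in> edges G" shows "openin (freudenthal G) (open_edge e)"
proof -
  obtain u v where e: "e = {u, v}" using edge_obtain[OF assms] by metis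
  show ?thesis unfolding e open_edge_eq
    using assms unfolding e by (intro openin_basis basis_edge) simp_all
qed

lemma open_edge_disjoint:
  assumes "e \<in> edges G" "e' \<in> edges G" "x \<in> open_edge e" "x \<in> open_edge e'"
  shows "e = e'"
proof -
  obtain u v where e: "e = {u, v}" "u \<noteq> v" using edge_obtain[OF assms(1)] by metis
  obtain u' v' where e': "e' = {u', v'}" "u' \<noteq> v'" using edge_obtain[OF assms(2)] by metis
  obtain t where t: "x = edge_point u v t" "0 < t" "t < 1" using assms(3) unfolding e open_edge_eq by auto
  obtain t' where t': "x = edge_point u' v' t'" "0 < t'" "t' < 1" using assms(4) unfolding e' open_edge_eq by auto
  have "u' = u \<and> v' = v \<and> t' = t \<or> u' = v \<and> v' = u \<and> t' = 1 - t"
    using t' t by (intro edge_point_eqD e(2) e'(2)) simp_all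
  then show ?thesis unfolding e e' by auto
qed

lemma open_edge_not_vertex: "e \<in> edges G \<Longrightarrow> vertex_point v \<notin> open_edge e"
proof
  assume e: "e \<in> edges G" "vertex_point v \<in> open_edge e"
  obtain u w where uw: "e = {u, w}" "u \<noteq> w" using edge_obtain[OF e(1)] by metis
  obtain t where "vertex_point v = edge_point u w t" "0 < t" "t < 1" using e(2) unfolding uw open_edge_eq by auto
  then show False using edge_point_neq_vertex[OF uw(2), of t v] by simp
qed

lemma freudenthal_cases:
  assumes x: "x \<in> topspace (freudenthal G)" "x \<noteq> End_Point \<omega>"
  obtains v where "v \<in> verts G" "x = vertex_point v" | e where "e \<in> edges G" "x \<in> open_edge e"
proof -
  note on_vertex = that(1) and on_edge = that(2)
  have edge: thesis if e: "x = edge_point u v t" "{u, v} \<in> edges G" and t: "0 \<le> t" "t \<le> 1" for u v t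
  proof -
    consider "t = 0" | "t = 1" | "0 < t" "t < 1" using t by linarith
    then show thesis
    proof cases
      case 1
      then show ?thesis using e edge_verts[OF e(2)] by (intro on_vertex[of u]) simp_all
    next
      case 2
      then show ?thesis using e edge_verts[OF e(2)] by (intro on_vertex[of v]) simp_all
    next
      case 3
      have "x \<in> open_edge {u, v}" unfolding open_edge_eq using e(1) 3 by simp
      then show ?thesis by (rule on_edge[OF e(2)])
    qed
  qed
  obtain U where U: "U \<in> freudenthal_basis G" "x \<in> U" using x(1) by (auto simp: freudenthal_eq)
  from U(1) show thesis
  proof (cases rule: basis_cases)
    case (1 v \<epsilon>)
    from U(2) show thesis unfolding 1(1)
    proof (cases rule: vertex_nbhd_cases)
      case 1
      show thesis by (rule on_vertex[OF \<open>v \<in> verts G\<close> 1])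
    next
      case (2 w t)
      show thesis using edge[OF 2(1,2)] 2(3,4) \<open>\<epsilon> \<le> 1\<close> by simp
    qed
  next
    case (2 u v a b)
    then obtain t where "x = edge_point u v t" "a < t" "t < b" using U(2) by auto
    then show thesis using edge[of u v t] 2 by simp
  next
    case (3 S \<omega>' \<epsilon>)
    have \<omega>': "\<omega>' = \<omega>" using 3(4) one_end by simp
    from U(2) show thesis unfolding 3(1) \<omega>' end_nbhd_mem_iff
    proof (elim disjE bexE exE conjE)
      fix v assume "v \<in> end_component G S \<omega>" "x = vertex_point v"
      then show thesis using end_component_subset[OF 3(2,3)] by (intro on_vertex[of v]) auto
    next
      fix u v t assume "x = edge_point u v t" "{u, v} \<in> edges G" "0 \<le> t" "t \<le> 1"
      then show thesis by (rule edge)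
    next
      fix u v t assume 4: "x = edge_point u v t" "{u, v} \<in> edges G" "0 < t" "t < \<epsilon>"
      show thesis using edge[OF 4(1,2)] 4(3,4) 3(6) by simp
    next
      fix \<omega>'' assume "\<omega>'' \<in> ends G" "x = End_Point \<omega>''"
      then show thesis using x(2) one_end by simp
    qed
  qed
qed

lemma vertex_nbhd_vertex:
  assumes "vertex_point w \<in> vertex_nbhd G v 1" shows "w = v"
  using assms
proof (cases rule: vertex_nbhd_cases)
  case 1
  then show ?thesis by (simp add: vertex_point_eq)
next
  case (2 u t)
  then show ?thesis using edge_point_neq_vertex[of v u t w] edge_verts[OF 2(2)] by simp
qed

lemma vertex_nbhd_open_edge:
  assumes "x \<in> vertex_nbhd G v 1" "e \<in> edges G" "x \<in> open_edge e" shows "v \<in> e"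
  using assms(1)
proof (cases rule: vertex_nbhd_cases)
  case 1
  then show ?thesis using open_edge_not_vertex[OF assms(2)] assms(3) by simp
next
  case (2 w t)
  have "x \<in> open_edge {v, w}" unfolding open_edge_eq using 2 by auto
  then have "{v, w} = e" by (rule open_edge_disjoint[OF 2(2) assms(2) _ assms(3)])
  then show ?thesis by blast
qed

text \<open>Deleting both ends of an edge separates its interior from the end; this keeps an arc
  from running to the end inside a single edge.\<close>

lemma end_nbhd_open_edge:
  assumes e: "e \<in> edges G" shows "end_nbhd G e \<omega> 1 \<inter> open_edge e = {}"
proof -
  obtain u v where uv: "e = {u, v}" "u \<in> verts G" "v \<in> verts G" using edge_obtain[OF e] by metis
  have C: "end_component G e \<omega> \<subseteq> verts G - e" using end_component_subset[of e] uv by simp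
  have "edge_point u v t \<notin> end_nbhd G e \<omega> 1" if "0 < t" "t < 1" for t
    using C e that unfolding uv(1) by (subst edge_in_end_nbhd_iff) auto
  then show ?thesis unfolding uv(1) open_edge_eq by auto
qed

text \<open>The parameters at which the arc passes vertices form a locally finite set, unbounded in
  both directions. Enumerated in order, they list the vertices; the arc between consecutive ones
  stays in one open edge, which must join them.\<close>

theorem double_ray_of_hamilton_circle:
  assumes K: "hamilton_circle G K"
  obtains d where "bij_betw d UNIV (verts G)" "\<And>n :: int. {d n, d (n + 1)} \<in> edges G"
proof -
  have circ: "circle_in (freudenthal G) K" and KV: "vertex_point ` verts G \<subseteq> K" and K\<omega>: "End_Point \<omega> \<in> K"
    using K one_end by (auto simp: hamilton_circle_def)
  obtain \<gamma> :: "real \<Rightarrow> 'a point" where \<gamma>: "inj \<gamma>" "range \<gamma> = K - {End_Point \<omega>}"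
    and cont: "\<And>U. openin (freudenthal G) U \<Longrightarrow> open (\<gamma> -` U)"
    and lim: "\<And>U. openin (freudenthal G) U \<Longrightarrow> End_Point \<omega> \<in> U \<Longrightarrow> \<exists>N. \<forall>t. N < \<bar>t\<bar> \<longrightarrow> \<gamma> t \<in> U"
    using circle_inD[OF circ K\<omega>] by metis
  have \<gamma>_eq: "\<gamma> s = \<gamma> t \<longleftrightarrow> s = t" for s t using \<gamma>(1) by (rule inj_eq)
  define Z where "Z = {t. \<exists>v\<in>verts G. \<gamma> t = vertex_point v}"
  have top: "\<gamma> t \<in> topspace (freudenthal G)" "\<gamma> t \<noteq> End_Point \<omega>" for t
  proof -
    have "\<gamma> t \<in> K - {End_Point \<omega>}" unfolding \<gamma>(2)[symmetric] by (rule rangeI)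
    then show "\<gamma> t \<in> topspace (freudenthal G)" "\<gamma> t \<noteq> End_Point \<omega>"
      using circ by (auto simp: circle_in_def)
  qed
  have not_Z: "\<exists>e\<in>edges G. \<gamma> t \<in> open_edge e" if "t \<notin> Z" for t
    using that freudenthal_cases[OF top, of t] unfolding Z_def by blast
  have isolated: "\<exists>T. open T \<and> t \<in> T \<and> Z \<inter> T \<subseteq> {t}" for t
  proof (cases "t \<in> Z")
    case True
    then obtain v where v: "v \<in> verts G" "\<gamma> t = vertex_point v" by (auto simp: Z_def)
    have "openin (freudenthal G) (vertex_nbhd G v 1)" using v(1) by (intro openin_basis basis_vertex) simp_all
    then have "open (\<gamma> -` vertex_nbhd G v 1)" by (rule cont)
    moreover have "t \<in> \<gamma> -` vertex_nbhd G v 1" using v(2) by (simp add: vertex_nbhd_def)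
    moreover have "Z \<inter> \<gamma> -` vertex_nbhd G v 1 \<subseteq> {t}"
    proof
      fix s assume s: "s \<in> Z \<inter> \<gamma> -` vertex_nbhd G v 1"
      then obtain w where w: "\<gamma> s = vertex_point w" by (auto simp: Z_def)
      then have "w = v" using s vertex_nbhd_vertex by simp
      then show "s \<in> {t}" using w v(2) \<gamma>_eq[of s t] by simp
    qed
    ultimately show ?thesis by blast
  next
    case False
    then obtain e where e: "e \<in> edges G" "\<gamma> t \<in> open_edge e" using not_Z by blast
    have "open (\<gamma> -` open_edge e)" by (rule cont[OF openin_open_edge[OF e(1)]])
    moreover have "Z \<inter> \<gamma> -` open_edge e = {}" using open_edge_not_vertex[OF e(1)] by (auto simp: Z_def)
    ultimately show ?thesis using e(2) by blast
  qed
  have fin: "finite (Z \<inter> {a..b})" for a b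
  proof -
    have "\<not> t islimpt Z" for t
    proof -
      obtain T where "open T" "t \<in> T" "Z \<inter> T \<subseteq> {t}" using isolated by blast
      then show ?thesis unfolding islimpt_def by blast
    qed
    then show ?thesis using finite_not_islimpt_in_compact[of "{a..b}" Z] by (simp add: Int_commute)
  qed
  \<comment> \<open>The preimages of the open edges are open and disjoint and cover
    \<open>I\<close>, so a connected \<open>I\<close> lies in one of them.\<close>
  have single: "\<exists>e\<in>edges G. \<gamma> ` I \<subseteq> open_edge e" if I: "connected I" "I \<noteq> {}" "I \<inter> Z = {}" for I
  proof -
    obtain t where t: "t \<in> I" using I(2) by blast
    then obtain e where e: "e \<in> edges G" "\<gamma> t \<in> open_edge e" using I(3) not_Z by blast
    let ?A = "\<gamma> -` open_edge e" and ?B = "\<Union>e'\<in>edges G - {e}. \<gamma> -` open_edge e'"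
    have "open ?A" by (rule cont[OF openin_open_edge[OF e(1)]])
    moreover have "open ?B" using cont openin_open_edge by (intro open_UN) simp
    moreover have "?A \<inter> ?B \<inter> I = {}"
    proof -
      have False if "s \<in> ?A" "s \<in> ?B" for s
      proof -
        obtain e' where "e' \<in> edges G" "e' \<noteq> e" "\<gamma> s \<in> open_edge e'" using \<open>s \<in> ?B\<close> by blast
        then show False using open_edge_disjoint[OF e(1)] \<open>s \<in> ?A\<close> by blast
      qed
      then show ?thesis by blast
    qed
    moreover have cover: "I \<subseteq> ?A \<union> ?B"
    proof
      fix s assume "s \<in> I"
      then have "s \<notin> Z" using I(3) by blast
      then obtain e' where "e' \<in> edges G" "\<gamma> s \<in> open_edge e'" using not_Z by blast
      then show "s \<in> ?A \<union> ?B" by (cases "e' = e") auto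
    qed
    ultimately have "?A \<inter> I = {} \<or> ?B \<inter> I = {}" by (rule connectedD[OF I(1)])
    moreover have "t \<in> ?A \<inter> I" using t e(2) by simp
    ultimately have "?B \<inter> I = {}" by (elim disjE) simp_all
    have aux: "I \<subseteq> A" if "I \<subseteq> A \<union> B" "B \<inter> I = {}" for A B using that by blast
    have "I \<subseteq> ?A" by (rule aux[OF cover \<open>?B \<inter> I = {}\<close>])
    then have "\<gamma> ` I \<subseteq> open_edge e" by (simp only: image_subset_iff_subset_vimage)
    then show ?thesis using e(1) by (intro bexI)
  qed
  \<comment> \<open>Otherwise the arc would tend to the end within one open edge, yet the end has a
    neighbourhood missing that edge.\<close>
  have unbounded: "I \<inter> Z \<noteq> {}" if I: "connected I" "\<And>N. \<exists>t\<in>I. N < \<bar>t\<bar>" for I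
  proof
    assume IZ: "I \<inter> Z = {}"
    have "I \<noteq> {}" using I(2) by blast
    from single[OF I(1) this IZ] obtain e where e: "e \<in> edges G" "\<gamma> ` I \<subseteq> open_edge e" by (elim bexE)
    have "finite e" "e \<subseteq> verts G" using edge_obtain[OF e(1)] by (metis finite.emptyI finite.insertI, blast)
    then have "openin (freudenthal G) (end_nbhd G e \<omega> 1)"
      using one_end by (intro openin_basis basis_end) simp_all
    then obtain N where N: "\<And>t. N < \<bar>t\<bar> \<Longrightarrow> \<gamma> t \<in> end_nbhd G e \<omega> 1" using lim End_Point_in_end_nbhd by blast
    obtain t where "t \<in> I" "N < \<bar>t\<bar>" using I(2) by blast
    then have "\<gamma> t \<in> end_nbhd G e \<omega> 1 \<inter> open_edge e" using N e(2) by blast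
    then show False unfolding end_nbhd_open_edge[OF e(1)] by simp
  qed
  have up: "\<exists>z\<in>Z. M < z" for M
  proof -
    have "\<exists>t\<in>{M<..}. N < \<bar>t\<bar>" for N by (intro bexI[of _ "\<bar>M\<bar> + \<bar>N\<bar> + 1"]) auto
    then have "{M<..} \<inter> Z \<noteq> {}" by (intro unbounded) auto
    then show ?thesis by auto
  qed
  have down: "\<exists>z\<in>Z. z < M" for M
  proof -
    have "\<exists>t\<in>{..<M}. N < \<bar>t\<bar>" for N by (intro bexI[of _ "- (\<bar>M\<bar> + \<bar>N\<bar> + 1)"]) auto
    then have "{..<M} \<inter> Z \<noteq> {}" by (intro unbounded) auto
    then show ?thesis by auto
  qed
  obtain \<zeta> :: "int \<Rightarrow> real" where \<zeta>: "strict_mono \<zeta>" "range \<zeta> = Z" by (rule int_enumeration[OF fin up down])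
  have "\<exists>v\<in>verts G. \<gamma> (\<zeta> n) = vertex_point v" for n
  proof -
    have "\<zeta> n \<in> Z" unfolding \<zeta>(2)[symmetric] by (rule rangeI)
    then show ?thesis by (simp add: Z_def)
  qed
  then obtain d where d: "\<And>n. d n \<in> verts G" "\<And>n. \<gamma> (\<zeta> n) = vertex_point (d n)" by metis
  have inj: "inj d"
  proof (rule injI)
    fix m n assume "d m = d n"
    then have "\<gamma> (\<zeta> m) = \<gamma> (\<zeta> n)" by (simp add: d(2))
    then show "m = n" using \<gamma>_eq strict_mono_eq[OF \<zeta>(1)] by simp
  qed
  have "v \<in> range d" if v: "v \<in> verts G" for v
  proof -
    have "vertex_point v \<in> range \<gamma>" unfolding \<gamma>(2) using KV v by auto
    then obtain t where t: "\<gamma> t = vertex_point v" by (metis rangeE)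
    then have "t \<in> range \<zeta>" unfolding \<zeta>(2) Z_def using v by blast
    then obtain n where "t = \<zeta> n" by blast
    then have "v = d n" using t d(2)[of n] by (simp add: vertex_point_eq)
    then show ?thesis by blast
  qed
  then have "bij_betw d UNIV (verts G)" using inj d(1) by (intro bij_betw_imageI) auto
  moreover have "{d n, d (n + 1)} \<in> edges G" for n
  proof -
    let ?I = "{\<zeta> n<..<\<zeta> (n + 1)}"
    have lt: "\<zeta> n < \<zeta> (n + 1)" using \<zeta>(1) by (simp add: strict_mono_less)
    have "?I \<inter> Z = {}"
    proof -
      have False if "\<zeta> n < \<zeta> m" "\<zeta> m < \<zeta> (n + 1)" for m
        using that by (simp add: strict_mono_less[OF \<zeta>(1)])
      then show ?thesis unfolding \<zeta>(2)[symmetric] by auto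
    qed
    moreover have "?I \<noteq> {}" using lt by simp
    moreover have "connected ?I" by simp
    ultimately have "\<exists>e\<in>edges G. \<gamma> ` ?I \<subseteq> open_edge e" by (intro single)
    then obtain e where e: "e \<in> edges G" "\<gamma> ` ?I \<subseteq> open_edge e" by (elim bexE)
    \<comment> \<open>Every neighbourhood of \<open>d m\<close> meets the arc just beside \<zeta> m,
      hence the open edge \<open>e\<close>; only edges at \<open>d m\<close> come that
      close.\<close>
    have mem: "d m \<in> e" if m: "m = n \<or> m = n + 1" for m
    proof -
      have "openin (freudenthal G) (vertex_nbhd G (d m) 1)" using d(1) by (intro openin_basis basis_vertex) simp_all
      then have "open (\<gamma> -` vertex_nbhd G (d m) 1)" by (rule cont)
      moreover have "\<zeta> m \<in> \<gamma> -` vertex_nbhd G (d m) 1" by (simp add: d(2) vertex_nbhd_def)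
      ultimately have "open (\<gamma> -` vertex_nbhd G (d m) 1) \<and> \<zeta> m \<in> \<gamma> -` vertex_nbhd G (d m) 1" by simp
      moreover have "\<zeta> m \<in> closure ?I" using m lt by auto
      ultimately obtain t where t: "t \<in> ?I" "t \<in> \<gamma> -` vertex_nbhd G (d m) 1"
        by (metis disjoint_iff open_Int_closure_eq_empty)
      then have "\<gamma> t \<in> open_edge e" using e(2) by blast
      then show ?thesis using vertex_nbhd_open_edge[OF _ e(1)] t(2) by simp
    qed
    have "d n \<noteq> d (n + 1)" using inj_eq[OF inj] by simp
    obtain u v where uv: "e = {u, v}" using edge_obtain[OF e(1)] by metis
    have "e = {d n, d (n + 1)}" using mem[of n] mem[of "n + 1"] \<open>d n \<noteq> d (n + 1)\<close> unfolding uv by auto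
    then show ?thesis using e(1) by simp
  qed
  ultimately show thesis by (rule that)
qed

end

section \<open>The second Hamilton cycle\<close>

context cubic_graph
begin

text \<open>Two of the three neighbours of a vertex are its neighbours on the line; the third
  defines \<open>c\<close>. Since \<open>n\<close> is a neighbour of \<open>c n\<close> but not next
  to it on the line, it is the third neighbour of \<open>c n\<close>.\<close>

lemma chord_line_exists:
  fixes d :: "int \<Rightarrow> 'a"
  assumes bij: "bij_betw d UNIV (verts G)" and step: "\<And>n. {d n, d (n + 1)} \<in> edges G"
  obtains c where "chord_line c" "\<And>m n. chord_line.adj c m n \<longleftrightarrow> d n \<in> nbrs (d m)"
proof -
  have d_eq: "d m = d n \<longleftrightarrow> m = n" for m n using bij by (auto simp: bij_betw_def inj_eq)
  have d_verts: "d n \<in> verts G" for n using bij by (auto simp: bij_betw_def)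
  have next_nbr: "d (n + 1) \<in> nbrs (d n)" for n using step[of n] by (simp add: nbrs_def)
  have prev_nbr: "d (n - 1) \<in> nbrs (d n)" for n using nbrsD(4)[OF next_nbr[of "n - 1"]] by simp
  have "\<exists>k. k \<noteq> n + 1 \<and> k \<noteq> n - 1 \<and> nbrs (d n) = {d (n + 1), d (n - 1), d k}" for n
  proof -
    have "card (nbrs (d n) - {d (n + 1), d (n - 1)}) = 1"
      using card_nbrs[OF d_verts[of n]] next_nbr prev_nbr
      by (subst card_Diff_subset) (simp_all add: d_eq)
    then obtain x where x: "nbrs (d n) - {d (n + 1), d (n - 1)} = {x}" by (auto simp: card_1_singleton_iff)
    then have "x \<in> nbrs (d n)" by blast
    then have "x \<in> d ` UNIV" using nbrsD(2) bij by (simp add: bij_betw_def)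
    then obtain k where k: "x = d k" by blast
    have "x \<noteq> d (n + 1)" "x \<noteq> d (n - 1)" using x by blast+
    moreover have "nbrs (d n) = {d (n + 1), d (n - 1), x}" using x next_nbr[of n] prev_nbr[of n] by blast
    ultimately show ?thesis unfolding k d_eq by (intro exI[of _ k] conjI)
  qed
  then obtain c where c: "\<And>n. c n \<noteq> n + 1" "\<And>n. c n \<noteq> n - 1"
    "\<And>n. nbrs (d n) = {d (n + 1), d (n - 1), d (c n)}" by metis
  have mem: "d n \<in> nbrs (d m) \<longleftrightarrow> n = m + 1 \<or> n = m - 1 \<or> n = c m" for m n
    unfolding c(3) by (simp add: d_eq)
  have "chord_line c"
  proof
    fix n
    show "c n \<noteq> n + 1" "c n \<noteq> n - 1" by (rule c)+
    have "d (c n) \<in> nbrs (d n)" by (simp add: mem)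
    note nb = nbrsD(3,4)[OF this]
    show "c n \<noteq> n" using nb(1) by (auto simp: d_eq)
    have "n = c n + 1 \<or> n = c n - 1 \<or> n = c (c n)" using nb(2) unfolding mem .
    then show "c (c n) = n" using c(1,2)[of n] by auto
  qed
  then show thesis by (rule that) (simp add: mem chord_line.adj_def[OF \<open>chord_line c\<close>])
qed

text \<open>Each small cut is an interval in the numbering. The line uses two of its at most three
  boundary edges, so at most one chord leaves, as \<open>rerouted_exists\<close> requires.\<close>

lemma second_double_ray:
  fixes d :: "int \<Rightarrow> 'a"
  assumes bij: "bij_betw d UNIV (verts G)" and step: "\<And>n. {d n, d (n + 1)} \<in> edges G"
    and cuts: "\<And>A. finite A \<Longrightarrow> A \<subseteq> verts G \<Longrightarrow>
      \<exists>S. finite S \<and> A \<subseteq> S \<and> S \<subseteq> verts G \<and> card (boundary S) \<le> 3"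
  obtains d' :: "int \<Rightarrow> 'a" where "bij_betw d' UNIV (verts G)" "\<And>n. {d' n, d' (n + 1)} \<in> edges G"
    "range (\<lambda>n. {d' n, d' (n + 1)}) \<noteq> range (\<lambda>n. {d n, d (n + 1)})"
proof -
  have inj: "inj d" using bij by (rule bij_betw_imp_inj_on)
  have d_eq: "d m = d n \<longleftrightarrow> m = n" for m n using inj by (rule inj_eq)
  obtain c where cl: "chord_line c" and adj: "\<And>m n. chord_line.adj c m n \<longleftrightarrow> d n \<in> nbrs (d m)"
    using chord_line_exists[OF bij step] by metis
  interpret chord_line c by (rule cl)
  have "\<exists>i j. i \<le> - N \<and> N \<le> j \<and> card {m \<in> {i..j}. c m \<notin> {i..j}} \<le> 1" for N
  proof -
    \<comment> \<open>The absolute value keeps this range nonempty for negative \<open>N\<close>, so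
      \<open>I\<close> has a minimum and a maximum.\<close>
    have "d ` {- \<bar>N\<bar>..\<bar>N\<bar>} \<subseteq> verts G" using bij by (auto simp: bij_betw_def)
    then obtain S where S: "finite S" "d ` {- \<bar>N\<bar>..\<bar>N\<bar>} \<subseteq> S" "card (boundary S) \<le> 3"
      using cuts[of "d ` {- \<bar>N\<bar>..\<bar>N\<bar>}"] by blast
    define I where "I = {n. d n \<in> S}"
    have fin: "finite I" using finite_vimageI[OF S(1) inj] by (simp add: I_def vimage_def)
    have sub: "{- \<bar>N\<bar>..\<bar>N\<bar>} \<subseteq> I" using S(2) by (auto simp: I_def)
    define i j where "i = Min I" and "j = Max I"
    have "I \<noteq> {}" using sub by auto
    then have ij: "i \<in> I" "j \<in> I" using fin by (simp_all add: i_def j_def)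
    have I_le: "i \<le> n" "n \<le> j" if "n \<in> I" for n using that fin by (simp_all add: i_def j_def)
    have bd: "{(u, w). u \<in> S \<and> w \<notin> S \<and> w \<in> nbrs u} = boundary S" by (simp add: boundary_def)
    have conv: "d q \<in> S" if "i \<le> q" "q \<le> j" for q
    \<comment> \<open>The positions \<open>i - 1\<close> and \<open>j + 1\<close> are the first ones
      outside \<open>S\<close> and serve as the required outer ends.\<close>
    proof (rule convex_of_small_boundary[where f = d and lo = "i - 1" and hi = "j + 1" and p = i and r = j
          and R = "\<lambda>u w. w \<in> nbrs u"])
      show "inj_on d {i - 1..j + 1}" using inj by (rule inj_on_subset) simp
      show "d (i - 1) \<notin> S" using I_le(1)[of "i - 1"] by (auto simp: I_def)
      show "d (j + 1) \<notin> S" using I_le(2)[of "j + 1"] by (auto simp: I_def)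
      show "d (t + 1) \<in> nbrs (d t)" for t using step by (simp add: nbrs_def)
      show "symp (\<lambda>u w. w \<in> nbrs u)" using nbrsD(4) by (intro sympI)
      show "finite {(u, w). u \<in> S \<and> w \<notin> S \<and> w \<in> nbrs u}" unfolding bd by (rule finite_boundary[OF S(1)])
      show "card {(u, w). u \<in> S \<and> w \<notin> S \<and> w \<in> nbrs u} \<le> 3" unfolding bd by (rule S(3))
      show "d i \<in> S" "d j \<in> S" using ij by (simp_all add: I_def)
    qed (use that in simp_all)
    have d_S: "d n \<in> S \<longleftrightarrow> n \<in> {i..j}" for n
      using conv[of n] I_le[of n] by (auto simp: I_def)
    let ?M = "{m \<in> {i..j}. c m \<notin> {i..j}}"
    let ?E = "{(d i, d (i - 1)), (d j, d (j + 1))}" and ?Y = "(\<lambda>m. (d m, d (c m))) ` ?M"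
    have le: "i \<le> j" using I_le(1)[OF ij(2)] .
    have finM: "finite ?M" by (rule finite_subset[of _ "{i..j}"]) auto
    have nb: "d (n + 1) \<in> nbrs (d n)" "d (n - 1) \<in> nbrs (d n)" "d (c n) \<in> nbrs (d n)" for n
      unfolding adj[symmetric] by (simp_all add: adj_def)
    have "?E \<union> ?Y \<subseteq> boundary S" using le nb by (auto simp: boundary_def d_S)
    then have "card (?E \<union> ?Y) \<le> 3" using card_mono[OF finite_boundary[OF S(1)]] S(3) by (meson le_trans)
    \<comment> \<open>A chord never joins neighbours on the line, so chords and line edges are
      counted separately.\<close>
    moreover have "card (?E \<union> ?Y) = card ?E + card ?Y"
      using finM chord(2,3)[symmetric] by (intro card_Un_disjoint) (auto simp: d_eq)
    moreover have "card ?E = 2" using le by (auto simp: d_eq card_insert_if)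
    moreover have "card ?Y = card ?M" by (intro card_image) (auto simp: inj_on_def d_eq)
    ultimately have "card ?M \<le> 1" by linarith
    moreover have "i \<le> - \<bar>N\<bar>" "\<bar>N\<bar> \<le> j" using sub by (intro I_le; auto)+
    then have "i \<le> - N" "N \<le> j" by linarith+
    ultimately show ?thesis by blast
  qed
  then obtain f where f: "rerouted f" using rerouted_exists by blast
  have img: "range (\<lambda>n. {d (g n), d (g (n + 1))}) = (`) d ` range (\<lambda>n. {g n, g (n + 1)})" for g :: "int \<Rightarrow> int"
    by (simp add: image_image)
  have inj_d: "inj ((`) d)" using inj_image_eq_iff[OF inj] by (auto simp: inj_def)
  show thesis
  proof (rule that[of "\<lambda>n. d (f n)"])
    show "bij_betw (\<lambda>n. d (f n)) UNIV (verts G)"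
      using bij_betw_trans[of f UNIV UNIV d] f bij by (simp add: rerouted_def comp_def)
    show "{d (f n), d (f (n + 1))} \<in> edges G" for n
    proof -
      have "d (f (n + 1)) \<in> nbrs (d (f n))" using f unfolding adj[symmetric] rerouted_def by blast
      then show ?thesis by (simp add: nbrs_def)
    qed
    show "range (\<lambda>n. {d (f n), d (f (n + 1))}) \<noteq> range (\<lambda>n. {d n, d (n + 1)})"
      using f unfolding img[of f] img[of "\<lambda>n. n"] inj_image_eq_iff[OF inj_d] rerouted_def by blast
  qed
qed

end

theorem theorem1p6:
  fixes G :: "'a graph" and \<omega> :: "(nat \<Rightarrow> 'a) set"
  assumes "simple_graph G"
    and "graph_connected G"
    and "cubic G"
    and "ends G = {\<omega>}"
    and "end_degree \<omega> \<le> 3"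
    and "hamiltonian G"
  shows "\<exists>H1 H2. hamilton_cycle G H1 \<and> hamilton_cycle G H2 \<and> H1 \<noteq> H2"
proof -
  interpret cubic_graph G using assms(1,3) by unfold_locales
  interpret one_ended_graph G \<omega> using assms(1,4) by unfold_locales
  obtain K where "hamilton_circle G K" using assms(6) by (auto simp: hamiltonian_def hamilton_cycle_def)
  then obtain d :: "int \<Rightarrow> 'a" where d: "bij_betw d UNIV (verts G)" "\<And>n. {d n, d (n + 1)} \<in> edges G"
    using double_ray_of_hamilton_circle by metis
  have cuts: "\<exists>S. finite S \<and> A \<subseteq> S \<and> S \<subseteq> verts G \<and> card (boundary S) \<le> 3"
    if "finite A" "A \<subseteq> verts G" for A
    by (rule small_boundary_exists[OF that ray_in_end assms(5)])
  obtain d' :: "int \<Rightarrow> 'a" where d': "bij_betw d' UNIV (verts G)" "\<And>n. {d' n, d' (n + 1)} \<in> edges G"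
    "range (\<lambda>n. {d' n, d' (n + 1)}) \<noteq> range (\<lambda>n. {d n, d (n + 1)})"
    by (rule second_double_ray[OF d]) (rule cuts, assumption, assumption, rule that, assumption+)
  interpret D: double_ray_graph G \<omega> d by unfold_locales (fact d)+
  interpret D': double_ray_graph G \<omega> d' by unfold_locales (fact d'(1,2))+
  obtain H where H: "hamilton_cycle G H" "edges H = range (\<lambda>n. {d n, d (n + 1)})"
    using D.hamilton_cycle_of_double_ray by blast
  obtain H' where H': "hamilton_cycle G H'" "edges H' = range (\<lambda>n. {d' n, d' (n + 1)})"
    using D'.hamilton_cycle_of_double_ray by blast
  have "H' \<noteq> H" using d'(3) unfolding H(2)[symmetric] H'(2)[symmetric] by blast
  then show ?thesis using H(1) H'(1) by blast
qed

end
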